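(* Let the Gaussian fully connected network, the inputs $\{x_\alpha\}_{\alpha\in A}$, and all the notation be as in the context, and assume: (i) $\sigma$ is continuous and bounded; (ii) there exist $\widehat{\ell}\in\{1,\ldots,L\}$ and $\gamma_1,\ldots,\gamma_L\in[1,\infty]$ such that $\lim_{n\to\infty} n_\ell(n)/n_{\widehat{\ell}}(n)=\gamma_\ell$ for all $\ell=1,\ldots,L$; set $v_n^*:=n_{\widehat{\ell}}(n)$. Then the sequence of $\mathbb{R}^{|A|\times n_{L+1}}$-valued random variables $\{(Z_h^{(L+1)}(x_\alpha)/\sqrt{v_n^*})_{\alpha\in A,\,h=1,\ldots,n_{L+1}}\}_n$ satisfies the large deviation principle on $\mathbb{R}^{|A|\times n_{L+1}}$ with speed $v_n^*$ and good rate function $$I_{Z^{(L+1)}(\underline{x})}(z):=\inf_{g^{(L)}\in\mathcal{S}_{|A|,C_b},\,r\in\mathbb{R}^{|A|\times n_{L+1}}}\{I_{G^{(L)}(\underline{x})}(g^{(L)})+\|r\|^2/2:\ g^{(L),\#}r=z\},$$ where $\|\cdot\|$ is the Euclidean norm on $\mathbb{R}^{|A|\times n_{L+1}}$, $g^{(L),\#}r$ is the matrix product $(\sum_{\gamma\in A}g^{(L),\#}_{\alpha\gamma}r_{\gamma h})_{\alpha h}$, $$I_{G^{(L)}(\underline{x})}(g^{(L)}):=\inf\Big\{\sum_{\ell=1}^L J(g^{(\ell)}|g^{(\ell-1)}):\ g^{(0)}=g^{(0)}(\underline{x}),\ g^{(1)},\ldots,g^{(L-1)}\in\mathcal{S}_{|A|,C_b}\Big\}\quad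 (g^{(L)}\in\mathcal{S}_{|A|,C_b}),$$ and, for $g^{(\ell-1)},g^{(\ell)}\in\mathcal{S}_{|A|,C_b}$, $$J(g^{(\ell)}|g^{(\ell-1)}):=\begin{cases}\gamma_\ell\,\kappa^*\big(\tfrac{g^{(\ell)}-C_b\mathbf{1}}{C_W};g^{(\ell-1)}\big)&\text{if }\gamma_\ell<\infty,\\ \Delta\big(g^{(\ell)};C_b\mathbf{1}+C_W y(g^{(\ell-1)})\big)&\text{if }\gamma_\ell=\infty.\end{cases}$$
   Context: Fix integers $L\ge1$, $n_0\ge1$, $n_{L+1}\ge1$, constants $C_b\ge0$, $C_W>0$ and a function $\sigma:\mathbb{R}\to\mathbb{R}$. For each $n\ge1$ let $n_1(n),\ldots,n_L(n)$ be positive integers with $n_\ell(n)\to\infty$ as $n\to\infty$ (write $n_\ell=n_\ell(n)$). The network is defined, for $x=(x_1,\ldots,x_{n_0})\in\mathbb{R}^{n_0}$, by $Z_i^{(1)}(x)=b_i^{(1)}+\sum_{r=1}^{n_0}W^{(1)}_{ir}x_r$ ($i=1,\ldots,n_1$) and $Z_i^{(\ell+1)}(x)=b_i^{(\ell+1)}+\sum_{j=1}^{n_\ell}W^{(\ell+1)}_{ij}\sigma(Z_j^{(\ell)}(x))$ ($i=1,\ldots,n_{\ell+1}$, $1\le\ell\le L$), where all biases $b_i^{(\ell)}$ are centered Normal with variance $C_b$ (degenerate at $0$ if $C_b=0$), all weights $W_{ij}^{(\ell+1)}$ ($0\le\ell\le L$) are centered Normal with variance $C_W/n_\ell$, and all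 these random variables are independent. Let $A$ be a finite set and $x_\alpha=(x_{\alpha,1},\ldots,x_{\alpha,n_0})\in\mathbb{R}^{n_0}$, $\alpha\in A$, fixed inputs; $\underline{x}$ denotes $\{x_\alpha\}_{\alpha\in A}$. Notation: for a symmetric positive semidefinite matrix $q=(q_{\alpha\beta})_{\alpha,\beta\in A}$, $q^\#$ is its unique symmetric positive semidefinite square root ($q^\#q^\#=q$). $\mathbf{1}$ is the $A\times A$ matrix with all entries $1$. $\mathcal{S}_{|A|,C_b}$ is the set of symmetric positive semidefinite $A\times A$ matrices $q$ such that $q-C_b\mathbf{1}$ is also positive semidefinite. Let $(N_\gamma)_{\gamma\in A}$ be i.i.d. standard Normal and $\langle q^\#_{\alpha\cdot},N_\cdot\rangle:=\sum_{\gamma\in A}q^\#_{\alpha\gamma}N_\gamma$. For $\eta\in\mathbb{R}^{A\times A}$, $\kappa(\eta;q):=\log\mathbb{E}[\exp(\sum_{\alpha,\beta\in A}\eta_{\alpha\beta}\sigma(\langle q^\#_{\alpha\cdot},N_\cdot\rangle)\sigma(\langle q^\#_{\beta\cdot},N_\cdot\rangle))]$ and $\kappa^*(y;q):=\sup_{\eta\in\mathbb{R}^{A\times A}}\{\langle\eta,y\rangle-\kappa(\eta;q)\}$ with $\langle\eta,y\rangle=\sum_{\alpha,\beta}\eta_{\alpha\beta}y_{\alpha\beta}$. $y(q)$ is the $A\times A$ matrix with entries $y_{\alpha\beta}(q):=\mathbb{E}[\sigma(\langle q^\#_{\alpha\cdot},N_\cdot\rangle)\sigma(\langle q^\#_{\beta\cdot},N_\cdot\rangle)]$.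 $g^{(0)}(\underline{x})$ is the $A\times A$ matrix with entries $C_b+\frac{C_W}{n_0}\sum_{r=1}^{n_0}x_{\alpha,r}x_{\beta,r}$. For $\bar g\in\mathcal{S}_{|A|,C_b}$, $\Delta(g;\bar g):=0$ if $g=\bar g$ and $+\infty$ otherwise. A sequence of random variables satisfies the LDP with speed $v_n\to\infty$ and rate function $I$ (lower semicontinuous, values in $[0,\infty]$) if $\limsup\frac1{v_n}\log P(\cdot\in C)\le-\inf_C I$ for closed $C$ and $\liminf\frac1{v_n}\log P(\cdot\in O)\ge-\inf_O I$ for open $O$; $I$ is good if its sublevel sets are compact. *)

theory Defs
  imports "HOL-Analysis.Analysis" "HOL-Probability.Probability"
begin

definition nlog :: "real \<Rightarrow> real \<Rightarrow> ereal" where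
  "nlog v p = (if p = 0 then - \<infinity> else ereal (ln p / v))"

definition rate_function :: "('c::topological_space \<Rightarrow> ereal) \<Rightarrow> bool" where
  "rate_function I \<longleftrightarrow> (\<forall>z. 0 \<le> I z) \<and> (\<forall>c. closed {z. I z \<le> c})"

definition good_rate_function :: "('c::topological_space \<Rightarrow> ereal) \<Rightarrow> bool" where
  "good_rate_function I \<longleftrightarrow> rate_function I \<and> (\<forall>c::real. compact {z. I z \<le> ereal c})"

definition LDP :: "(nat \<Rightarrow> 'b measure) \<Rightarrow> (nat \<Rightarrow> 'b \<Rightarrow> 'c::topological_space)
    \<Rightarrow> (nat \<Rightarrow> real) \<Rightarrow> ('c \<Rightarrow> ereal) \<Rightarrow> bool" where
  "LDP M X v I \<longleftrightarrow> filterlim v at_top sequentially \<and> rate_function I \<and>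
     (\<forall>C. closed C \<longrightarrow>
        limsup (\<lambda>n. nlog (v n) (measure (M n) {\<omega> \<in> space (M n). X n \<omega> \<in> C}))
          \<le> - (INF z\<in>C. I z)) \<and>
     (\<forall>U. open U \<longrightarrow>
        - (INF z\<in>U. I z)
          \<le> liminf (\<lambda>n. nlog (v n) (measure (M n) {\<omega> \<in> space (M n). X n \<omega> \<in> U})))"

definition centered_gaussian :: "'b measure \<Rightarrow> ('b \<Rightarrow> real) \<Rightarrow> real \<Rightarrow> bool" where
  "centered_gaussian M X s \<longleftrightarrow>
     (if s = 0 then X \<in> borel_measurable M \<and> (AE \<omega> in M. X \<omega> = 0)
      else distributed M lborel X (\<lambda>t. ennreal (normal_density 0 (sqrt s) t)))"

text \<open>netZ N \<sigma> b W l x i = Z_i^(l)(x) for l \<ge> 1; N l = n_l; b l i = b_i^(l);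
  W l i j = W_ij^(l); inputs x r for r = 1..n_0; indices start at 1.\<close>
fun netZ :: "(nat \<Rightarrow> nat) \<Rightarrow> (real \<Rightarrow> real) \<Rightarrow> (nat \<Rightarrow> nat \<Rightarrow> real)
    \<Rightarrow> (nat \<Rightarrow> nat \<Rightarrow> nat \<Rightarrow> real) \<Rightarrow> nat \<Rightarrow> (nat \<Rightarrow> real) \<Rightarrow> nat \<Rightarrow> real" where
  "netZ N \<sigma> b W 0 x i = 0"
| "netZ N \<sigma> b W (Suc 0) x i = b 1 i + (\<Sum>r=1..N 0. W 1 i r * x r)"
| "netZ N \<sigma> b W (Suc (Suc l)) x i =
     b (Suc (Suc l)) i + (\<Sum>j=1..N (Suc l). W (Suc (Suc l)) i j * \<sigma> (netZ N \<sigma> b W (Suc l) x j))"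

text \<open>Index set of all biases (Inl (l,i)) and weights (Inr (l,i,j)) for widths N and depth L.\<close>
definition param_index :: "(nat \<Rightarrow> nat) \<Rightarrow> nat \<Rightarrow> (nat \<times> nat + nat \<times> nat \<times> nat) set" where
  "param_index N L =
     {Inl (l, i) | l i. l \<in> {1..L+1} \<and> i \<in> {1..N l}} \<union>
     {Inr (l, i, j) | l i j. l \<in> {1..L+1} \<and> i \<in> {1..N l} \<and> j \<in> {1..N (l - 1)}}"

definition psd_mat :: "real^'a^'a \<Rightarrow> bool" where
  "psd_mat q \<longleftrightarrow> transpose q = q \<and> (\<forall>v. 0 \<le> v \<bullet> (q *v v))"

definition psd_sqrt :: "real^'a^'a \<Rightarrow> real^'a^'a" where
  "psd_sqrt q = (THE s. psd_mat s \<and> s ** s = q)"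

definition ones_mat :: "real^'a^'a" where
  "ones_mat = (\<chi> \<alpha> \<beta>. 1)"

definition S_set :: "real \<Rightarrow> (real^'a^'a) set" where
  "S_set Cb = {q. psd_mat q \<and> psd_mat (q - Cb *\<^sub>R ones_mat)}"

definition std_gauss_vec :: "('a::finite \<Rightarrow> real) measure" where
  "std_gauss_vec = (\<Pi>\<^sub>M \<gamma>\<in>UNIV. density lborel (\<lambda>t. ennreal (std_normal_density t)))"

definition gproj :: "real^'a^'a \<Rightarrow> 'a \<Rightarrow> ('a::finite \<Rightarrow> real) \<Rightarrow> real" where
  "gproj q \<alpha> N = (\<Sum>\<gamma>\<in>UNIV. psd_sqrt q $ \<alpha> $ \<gamma> * N \<gamma>)"

definition kappa :: "(real \<Rightarrow> real) \<Rightarrow> real^'a^'a \<Rightarrow> real^'a^'a \<Rightarrow> real" where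
  "kappa \<sigma> \<eta> q = ln (\<integral>N. exp (\<Sum>\<alpha>\<in>UNIV. \<Sum>\<beta>\<in>UNIV.
        \<eta> $ \<alpha> $ \<beta> * \<sigma> (gproj q \<alpha> N) * \<sigma> (gproj q \<beta> N)) \<partial>(std_gauss_vec::('a::finite \<Rightarrow> real) measure))"

definition kappa_star :: "(real \<Rightarrow> real) \<Rightarrow> real^'a^'a \<Rightarrow> real^'a^'a \<Rightarrow> ereal" where
  "kappa_star \<sigma> y q = (SUP \<eta>. ereal ((\<Sum>\<alpha>\<in>UNIV. \<Sum>\<beta>\<in>UNIV. \<eta> $ \<alpha> $ \<beta> * y $ \<alpha> $ \<beta>)
        - kappa \<sigma> \<eta> q))"

definition ymat :: "(real \<Rightarrow> real) \<Rightarrow> real^'a^'a \<Rightarrow> real^'a^'a" where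
  "ymat \<sigma> q = (\<chi> \<alpha> \<beta>. \<integral>N. \<sigma> (gproj q \<alpha> N) * \<sigma> (gproj q \<beta> N)
        \<partial>(std_gauss_vec::('a::finite \<Rightarrow> real) measure))"

definition g0_mat :: "real \<Rightarrow> real \<Rightarrow> nat \<Rightarrow> ('a \<Rightarrow> nat \<Rightarrow> real) \<Rightarrow> real^'a^'a" where
  "g0_mat Cb Cw n0 x = (\<chi> \<alpha> \<beta>. Cb + Cw / real n0 * (\<Sum>r=1..n0. x \<alpha> r * x \<beta> r))"

definition Delta :: "real^'a^'a \<Rightarrow> real^'a^'a \<Rightarrow> ereal" where
  "Delta g gbar = (if g = gbar then 0 else \<infinity>)"

definition Jrate :: "(real \<Rightarrow> real) \<Rightarrow> real \<Rightarrow> real \<Rightarrow> ereal \<Rightarrow> real^'a^'a \<Rightarrow> real^'a^'a \<Rightarrow> ereal" where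
  "Jrate \<sigma> Cb Cw gl g gprev =
     (if gl = \<infinity> then Delta g (Cb *\<^sub>R ones_mat + Cw *\<^sub>R ymat \<sigma> gprev)
      else gl * kappa_star \<sigma> ((1 / Cw) *\<^sub>R (g - Cb *\<^sub>R ones_mat)) gprev)"

definition IG :: "(real \<Rightarrow> real) \<Rightarrow> real \<Rightarrow> real \<Rightarrow> nat \<Rightarrow> (nat \<Rightarrow> ereal) \<Rightarrow> real^'a^'a
    \<Rightarrow> real^'a^'a \<Rightarrow> ereal" where
  "IG \<sigma> Cb Cw L \<gamma> g0 gL =
     (INF gs \<in> {gs. gs 0 = g0 \<and> gs L = gL \<and> (\<forall>l\<in>{1..L-1}. gs l \<in> S_set Cb)}.
        \<Sum>l=1..L. Jrate \<sigma> Cb Cw (\<gamma> l) (gs l) (gs (l - 1)))"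

definition IZ :: "(real \<Rightarrow> real) \<Rightarrow> real \<Rightarrow> real \<Rightarrow> nat \<Rightarrow> (nat \<Rightarrow> ereal) \<Rightarrow> real^'a^'a
    \<Rightarrow> real^'h^'a \<Rightarrow> ereal" where
  "IZ \<sigma> Cb Cw L \<gamma> g0 z =
     (INF p \<in> {(gL, r). gL \<in> S_set Cb \<and> psd_sqrt gL ** r = z}.
        IG \<sigma> Cb Cw L \<gamma> g0 (fst p) + ereal ((norm (snd p))\<^sup>2 / 2))"

end

theory Submission
  imports Defs
begin

text \<open>Given layer \<open>\<ell> - 1\<close>, the neurons of layer \<open>\<ell>\<close> are i.i.d. Gaussian vectors whose covariance is the random
  matrix \<open>G\<^sup>(\<^sup>\<ell>\<^sup>-\<^sup>1\<^sup>)\<close>, so \<open>G\<^sup>(\<^sup>0\<^sup>), \<dots>, G\<^sup>(\<^sup>L\<^sup>)\<close> is a Markov chain, and the conditional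
  moment generating function of each transition, evaluated at \<open>n\<^sub>\<ell> \<eta>\<close>, is exactly
  \<open>exp (n\<^sub>\<ell> \<kappa>(\<eta>; q))\<close> with \<open>q = G\<^sup>(\<^sup>\<ell>\<^sup>-\<^sup>1\<^sup>)\<close>. Chernoff bounds and exponential tilting, which only see \<open>\<kappa>\<close> at
  finitely many \<open>\<eta>\<close>, give upper and lower bounds for small balls that are uniform for \<open>q\<close> near a given matrix, because
  \<open>\<kappa>\<close> is continuous in \<open>q\<close>. As \<open>\<sigma>\<close> is bounded the chain lives in a compact set, so such local bounds can be
  composed along the chain by finite coverings. The output layer is one more step of the same kind, with the quadratic
  cumulant function \<open>\<theta> \<mapsto> \<langle>\<theta>, q \<theta>\<rangle> / 2\<close>, whose Legendre transform is the minimum of \<open>\<parallel>r\<parallel>\<^sup>2 / 2\<close> over \<open>q\<^sup># r = z\<close>.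
  Local bounds together with exponential tightness are the large deviation principle.\<close>

section \<open>Square roots of positive semidefinite matrices\<close>

text \<open>No conditional distribution is ever constructed: a transition enters only through
  integrals of exponentials over events of the conditioning variable, which is all that Chernoff
  bounds and tilting use. The rate function is an infimum over paths through a noncompact set, so
  neither its lower semicontinuity nor the compactness of its sublevel sets can be read off the
  formula; both are deduced from the two-sided local bounds, since a cheap point near an expensive
  one would carry too much mass. The case \<open>\<gamma> = \<infinity>\<close> shapes the one-step
  estimates: there an error \<open>k * \<rho>\<close> in an exponent is not negligible at speed
  \<open>v\<close>, however small \<open>\<rho>\<close> is, so a bound has to be exact at
  \<open>\<eta> = 0\<close> or to have a strictly positive exponent. The rate is written with the
  root \<open>q\<^sup>#\<close>, while the network supplies weighted sums of features; matching the
  two takes existence and continuity of the root, at singular matrices too, and a uniqueness theorem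
  for Gaussian laws that may be degenerate.\<close>

lemma matrix_self_inner:
  fixes D :: "real^'a^'a::finite"
  assumes "transpose D = D"
  shows "(D *v x) \<bullet> y = x \<bullet> (D *v y)"
  using assms by (metis dot_lmul_matrix vector_transpose_matrix)

lemma psd_mat_selfadjoint: "psd_mat D \<Longrightarrow> (D *v x) \<bullet> y = x \<bullet> (D *v y)"
  by (rule matrix_self_inner) (simp add: psd_mat_def)

text \<open>A maximiser \<open>w\<close> of \<open>\<parallel>D w\<parallel>\<close> on the unit sphere satisfies \<open>D\<^sup>2 w = c\<^sup>2 w\<close>, so either \<open>w\<close> or
  \<open>D w - c w\<close> is an eigenvector.\<close>

lemma sym_max_eigenvector:
  fixes D :: "real^'a^'a::finite"
  assumes sym: "transpose D = D"
  obtains v \<mu> where "norm v = 1" "D *v v = \<mu> *\<^sub>R v" "\<And>x. norm (D *v x) \<le> \<bar>\<mu>\<bar> * norm x"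
proof -
  have comp: "compact (sphere (0::real^'a) 1)" by simp
  have ne: "sphere (0::real^'a) 1 \<noteq> {}"
    using vector_choose_size[of 1] by (auto simp: dist_norm)
  have cont: "continuous_on (sphere (0::real^'a) 1) (\<lambda>x. norm (D *v x))"
    by (intro continuous_intros matrix_vector_mult_linear_continuous_on)
  obtain w where w: "w \<in> sphere 0 1" and wmax: "\<And>x. x \<in> sphere 0 1 \<Longrightarrow> norm (D *v x) \<le> norm (D *v w)"
    using continuous_attains_sup[OF comp ne cont] by blast
  define c where "c = norm (D *v w)"
  have nw: "norm w = 1" using w by simp
  have bound: "norm (D *v x) \<le> c * norm x" for x
  proof (cases "x = 0")
    case False
    have "norm (D *v ((1 / norm x) *\<^sub>R x)) \<le> c"
      unfolding c_def using False by (intro wmax) simp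
    then show ?thesis using False by (simp add: matrix_vector_mult_scaleR divide_simps mult.commute)
  qed simp
  have c0: "c \<ge> 0" by (simp add: c_def)
  define p where "p = D *v (D *v w)"
  have pw: "p \<bullet> w = (D *v w) \<bullet> (D *v w)" by (simp add: p_def matrix_self_inner[OF sym])
  have ww: "w \<bullet> w = 1" using nw by (simp add: norm_eq_1)
  \<comment> \<open>Since p.w = |Dw|^2 = c^2 and w.w = 1, the square equals |D(Dw)|^2 - c^4; the
    operator bound at \<open>D *v w\<close> makes this nonpositive, so the vector vanishes.\<close>
  have "(norm (p - c\<^sup>2 *\<^sub>R w))\<^sup>2 = p \<bullet> p - 2 * c\<^sup>2 * (p \<bullet> w) + c\<^sup>2 * c\<^sup>2 * (w \<bullet> w)"
    unfolding power2_norm_eq_inner inner_diff_left inner_diff_right inner_scaleR_left inner_scaleR_right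
    by (simp add: inner_commute algebra_simps)
  also have "\<dots> = (norm (D *v (D *v w)))\<^sup>2 - 2 * c\<^sup>2 * ((D *v w) \<bullet> (D *v w)) + (c\<^sup>2)\<^sup>2"
    unfolding pw ww by (simp add: power2_norm_eq_inner p_def)
  also have "\<dots> \<le> (c * c)\<^sup>2 - 2 * c\<^sup>2 * c\<^sup>2 + (c\<^sup>2)\<^sup>2"
    using power_mono[OF bound[of "D *v w"], of 2] by (simp add: c_def power2_norm_eq_inner)
  also have "\<dots> = 0" by (simp add: power2_eq_square)
  finally have D2: "D *v (D *v w) = c\<^sup>2 *\<^sub>R w" by (simp add: p_def)
  show ?thesis
  proof (cases "D *v w = c *\<^sub>R w")
    case True
    show ?thesis by (rule that[OF nw True]) (use bound c0 in auto)
  next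
    case False
    define u where "u = D *v w - c *\<^sub>R w"
    have u0: "u \<noteq> 0" using False by (simp add: u_def)
    have "D *v u = (- c) *\<^sub>R u"
      by (simp add: u_def matrix_vector_mult_diff_distrib D2 matrix_vector_mult_scaleR
          power2_eq_square algebra_simps)
    then have e: "D *v ((1 / norm u) *\<^sub>R u) = (- c) *\<^sub>R ((1 / norm u) *\<^sub>R u)"
      by (simp add: matrix_vector_mult_scaleR)
    have n1: "norm ((1 / norm u) *\<^sub>R u) = 1" using u0 by simp
    show ?thesis by (rule that[OF n1 e]) (use bound c0 in auto)
  qed
qed

text \<open>For a top eigenpair \<open>\<mu>\<close>, \<open>v\<close> of \<open>s - t\<close> the
  quadratic form of \<open>s ** s - t ** t\<close> at \<open>v\<close> is
  \<open>\<mu> * (a + b)\<close>, where \<open>a\<close> and \<open>b\<close> are the forms of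
  \<open>s\<close> and \<open>t\<close>; as both are nonnegative, |\<mu>| = |a - b| \<le> a + b,
  hence \<mu>^2 \<le> B^2. With \<open>B = 0\<close> this yields uniqueness of the root, with small
  \<open>B\<close> its continuity.\<close>

lemma psd_mat_diff_bound:
  fixes s t :: "real^'a^'a::finite"
  assumes s: "psd_mat s" and t: "psd_mat t"
    and B: "\<And>v. norm v = 1 \<Longrightarrow> \<bar>v \<bullet> ((s ** s - t ** t) *v v)\<bar> \<le> B\<^sup>2" and B0: "B \<ge> 0"
  shows "norm ((s - t) *v x) \<le> B * norm x"
proof -
  have sym: "transpose (s - t) = s - t"
    using s t by (simp add: psd_mat_def transpose_def vec_eq_iff)
  obtain v \<mu> where v: "norm v = 1" "(s - t) *v v = \<mu> *\<^sub>R v"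
      "\<And>x. norm ((s - t) *v x) \<le> \<bar>\<mu>\<bar> * norm x"
    using sym_max_eigenvector[OF sym] by blast
  have vv: "v \<bullet> v = 1" using v(1) by (simp add: norm_eq_1)
  define a where "a = v \<bullet> (s *v v)"
  define b where "b = v \<bullet> (t *v v)"
  have ab: "a \<ge> 0" "b \<ge> 0" using s t by (auto simp: a_def b_def psd_mat_def)
  have "a - b = v \<bullet> ((s - t) *v v)"
    by (simp add: a_def b_def matrix_vector_mult_diff_rdistrib inner_diff)
  then have mu: "\<mu> = a - b" using v(2) vv by simp
  have sv: "s *v v = t *v v + \<mu> *\<^sub>R v"
    using v(2) by (simp add: matrix_vector_mult_diff_rdistrib algebra_simps)
  have "v \<bullet> ((s ** s - t ** t) *v v) = (s *v v) \<bullet> (s *v v) - (t *v v) \<bullet> (t *v v)"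
    using psd_mat_selfadjoint[OF s, of v "s *v v"] psd_mat_selfadjoint[OF t, of v "t *v v"]
    by (simp add: matrix_vector_mult_diff_rdistrib inner_diff matrix_vector_mul_assoc[symmetric])
  also have "\<dots> = \<mu> * (2 * b + \<mu>)"
    unfolding sv using vv by (simp add: inner_add inner_commute b_def algebra_simps)
  also have "\<dots> = \<mu> * (a + b)" by (simp add: mu)
  finally have e: "\<bar>\<mu> * (a + b)\<bar> \<le> B\<^sup>2" using B[OF v(1)] by simp
  have "\<mu>\<^sup>2 = \<bar>\<mu>\<bar> * \<bar>\<mu>\<bar>" by (simp add: power2_eq_square)
  also have "\<dots> \<le> \<bar>\<mu>\<bar> * (a + b)" using ab mu by (intro mult_left_mono) auto
  also have "\<dots> \<le> B\<^sup>2" using e ab by (simp add: abs_mult)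
  finally have "\<bar>\<mu>\<bar> \<le> B" using B0 by (simp add: abs_le_square_iff[symmetric])
  then show ?thesis using v(3)[of x] by (meson mult_right_mono norm_ge_zero order_trans)
qed

lemma psd_sqrt_unique:
  fixes s t :: "real^'a^'a::finite"
  assumes "psd_mat s" "psd_mat t" "s ** s = t ** t"
  shows "s = t"
proof -
  have "norm ((s - t) *v x) \<le> 0 * norm x" for x
    by (rule psd_mat_diff_bound[OF assms(1,2)]) (auto simp: assms(3))
  then have "s *v x = t *v x" for x
    by (simp add: matrix_vector_mult_diff_rdistrib)
  then show ?thesis by (simp add: matrix_eq)
qed

definition outer_mat :: "real^'a \<Rightarrow> real^'a^'a::finite" where
  "outer_mat v = (\<chi> i j. v $ i * v $ j)"

lemma outer_mat_mult: "outer_mat v *v x = (v \<bullet> x) *\<^sub>R v"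
  by (simp add: vec_eq_iff outer_mat_def matrix_vector_mult_def inner_vec_def sum_distrib_right
      sum_distrib_left mult_ac)

lemma psd_mat_outer: "psd_mat (outer_mat v)"
  by (simp add: psd_mat_def outer_mat_mult inner_commute)
     (simp add: outer_mat_def transpose_def vec_eq_iff mult.commute)

lemma psd_mat_add: "psd_mat p \<Longrightarrow> psd_mat q \<Longrightarrow> psd_mat (p + q)"
  by (auto simp: psd_mat_def transpose_def vec_eq_iff matrix_vector_mult_add_rdistrib inner_add)

lemma psd_mat_scaleR: "psd_mat p \<Longrightarrow> c \<ge> 0 \<Longrightarrow> psd_mat (c *\<^sub>R p)"
  by (auto simp: psd_mat_def transpose_def vec_eq_iff scaleR_matrix_vector_assoc[symmetric])

lemma psd_mat_zero: "psd_mat 0"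
  by (auto simp: psd_mat_def transpose_def vec_eq_iff)

text \<open>Deflation, by induction on the rank, written as dimension minus nullity: subtracting
  \<open>\<mu>\<close> times the projection onto a top eigenvector enlarges the kernel, and adding
  \<open>sqrt \<mu>\<close> times that projection to the root of the remainder gives a root of
  \<open>A\<close>.\<close>

lemma psd_sqrt_exists:
  fixes A :: "real^'a^'a::finite"
  assumes "psd_mat A"
  shows "\<exists>s. psd_mat s \<and> s ** s = A"
  using assms
proof (induction "CARD('a) - dim {x. A *v x = 0}" arbitrary: A rule: less_induct)
  case less
  show ?case
  proof (cases "A = 0")
    case True
    then show ?thesis using psd_mat_zero by (intro exI[of _ 0]) simp
  next
    case False
    have sym: "transpose A = A" using less.prems by (simp add: psd_mat_def)
    obtain v \<mu> where v: "norm v = 1" "A *v v = \<mu> *\<^sub>R v"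
        "\<And>x. norm (A *v x) \<le> \<bar>\<mu>\<bar> * norm x"
      using sym_max_eigenvector[OF sym] by blast
    have vv: "v \<bullet> v = 1" using v(1) by (simp add: norm_eq_1)
    have "\<mu> = v \<bullet> (A *v v)" using v(2) vv by simp
    then have "\<mu> \<ge> 0" using less.prems by (simp add: psd_mat_def)
    moreover have "\<mu> \<noteq> 0"
    proof
      assume "\<mu> = 0"
      then have "\<forall>x. A *v x = 0 *v x" using v(3) by simp
      then show False using False by (simp only: matrix_eq[symmetric])
    qed
    ultimately have mu: "\<mu> > 0" by simp
    define A' where "A' = A - \<mu> *\<^sub>R outer_mat v"
    have A'x: "A' *v x = A *v x - (\<mu> * (v \<bullet> x)) *\<^sub>R v" for x
      by (simp add: A'_def matrix_vector_mult_diff_rdistrib scaleR_matrix_vector_assoc[symmetric]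
          outer_mat_mult)
    have vA: "v \<bullet> (A *v x) = \<mu> * (v \<bullet> x)" for x
      using psd_mat_selfadjoint[OF less.prems, of v x] v(2) by simp
    have psd': "psd_mat A'"
      unfolding psd_mat_def
    proof (intro conjI allI)
      show "transpose A' = A'"
        using sym by (simp add: A'_def outer_mat_def transpose_def vec_eq_iff mult.commute)
    next
      fix x
      \<comment> \<open>\<open>y\<close> is the projection of \<open>x\<close> onto the complement
        of \<open>v\<close>; \<open>A'\<close> agrees with \<open>A\<close> there and annihilates
        \<open>v\<close>, so its form at \<open>x\<close> is the form of \<open>A\<close> at
        \<open>y\<close>.\<close>
      define y where "y = x - (v \<bullet> x) *\<^sub>R v"
      have "y \<bullet> (A *v y) = x \<bullet> (A' *v x)"
        using vv by (simp add: y_def A'x matrix_vector_mult_diff_distrib matrix_vector_mult_scaleR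
            v(2) inner_diff vA inner_commute algebra_simps)
      then show "0 \<le> x \<bullet> (A' *v x)" using less.prems by (metis psd_mat_def)
    qed
    have sub: "{x. A *v x = 0} \<subseteq> {x. A' *v x = 0}"
    proof safe
      fix x assume "A *v x = 0"
      then show "A' *v x = 0" using vA[of x] mu by (simp add: A'x)
    qed
    have vin: "A' *v v = 0" by (simp add: A'x vv v(2))
    have vnin: "A *v v \<noteq> 0" using v mu by auto
    have subA: "subspace {x. A *v x = 0}" and subA': "subspace {x. A' *v x = 0}"
      by (auto simp: subspace_def matrix_vector_right_distrib matrix_vector_mult_scaleR)
    have "{x. A *v x = 0} \<subset> {x. A' *v x = 0}" using sub vin vnin by blast
    then have "dim {x. A *v x = 0} < dim {x. A' *v x = 0}"
      using subA subA' by (intro dim_psubset) (simp add: span_eq_iff[THEN iffD2])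
    moreover have "dim {x. A' *v x = 0} \<le> CARD('a)"
      using dim_subset_UNIV[of "{x. A' *v x = 0}"] by simp
    ultimately have "CARD('a) - dim {x. A' *v x = 0} < CARD('a) - dim {x. A *v x = 0}"
      by linarith
    from less.hyps[OF this psd'] obtain s where s: "psd_mat s" "s ** s = A'" by blast
    \<comment> \<open>\<open>s *v v\<close> has squared length v.(A'v) = 0, so the cross terms in
      \<open>r ** r\<close> vanish.\<close>
    have "(s *v v) \<bullet> (s *v v) = v \<bullet> (A' *v v)"
      using psd_mat_selfadjoint[OF s(1), of v "s *v v"]
      by (simp add: s(2)[symmetric] matrix_vector_mul_assoc[symmetric])
    then have sv: "s *v v = 0" using vin by simp
    have vs: "v \<bullet> (s *v x) = 0" for x
      using psd_mat_selfadjoint[OF s(1), of v x] sv by simp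
    define r where "r = s + sqrt \<mu> *\<^sub>R outer_mat v"
    have "psd_mat r" unfolding r_def
      using s mu by (intro psd_mat_add psd_mat_scaleR psd_mat_outer) auto
    moreover have "r ** r = A"
    proof -
      have rx: "r *v x = s *v x + (sqrt \<mu> * (v \<bullet> x)) *\<^sub>R v" for x
        by (simp add: r_def matrix_vector_mult_add_rdistrib scaleR_matrix_vector_assoc[symmetric]
            outer_mat_mult)
      have "(r ** r) *v x = A *v x" for x
      proof -
        have "(r ** r) *v x = r *v (r *v x)" by (simp add: matrix_vector_mul_assoc)
        also have "\<dots> = s *v (s *v x) + (\<mu> * (v \<bullet> x)) *\<^sub>R v"
          using mu vv by (simp add: rx matrix_vector_right_distrib matrix_vector_mult_scaleR sv vs
              inner_add)
        also have "s *v (s *v x) = A' *v x"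
          by (simp add: s(2)[symmetric] matrix_vector_mul_assoc)
        finally show ?thesis by (simp add: A'x)
      qed
      then show ?thesis by (simp add: matrix_eq)
    qed
    ultimately show ?thesis by blast
  qed
qed

lemma psd_sqrt:
  fixes q :: "real^'a^'a::finite"
  assumes "psd_mat q"
  shows "psd_mat (psd_sqrt q)" and "psd_sqrt q ** psd_sqrt q = q"
proof -
  have "\<exists>!s. psd_mat s \<and> s ** s = q"
    using psd_sqrt_exists[OF assms] psd_sqrt_unique by metis
  from theI'[OF this] show "psd_mat (psd_sqrt q)" "psd_sqrt q ** psd_sqrt q = q"
    by (auto simp: psd_sqrt_def)
qed

lemma norm_psd_sqrt_mult:
  fixes q :: "real^'a^'a::finite"
  assumes "psd_mat q"
  shows "(norm (psd_sqrt q *v v))\<^sup>2 = v \<bullet> (q *v v)"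
  using psd_mat_selfadjoint[OF psd_sqrt(1)[OF assms], of v "psd_sqrt q *v v"] psd_sqrt(2)[OF assms]
  by (simp add: power2_norm_eq_inner matrix_vector_mul_assoc)

text \<open>The norm of the matrix type is the Frobenius norm, so the bound is Cauchy-Schwarz
  applied to each row.\<close>

lemma norm_matrix_vector_le:
  fixes A :: "real^'n^'m::finite"
  shows "norm (A *v x) \<le> norm A * norm x"
proof -
  have "(norm (A *v x))\<^sup>2 = (\<Sum>i\<in>UNIV. (A $ i \<bullet> x)\<^sup>2)"
    unfolding power2_norm_eq_inner inner_vec_def[of "A *v x"]
    by (simp add: matrix_vector_mult_def inner_vec_def power2_eq_square)
  also have "\<dots> \<le> (\<Sum>i\<in>UNIV. (norm (A $ i))\<^sup>2 * (norm x)\<^sup>2)"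
    by (intro sum_mono) (metis Cauchy_Schwarz_ineq power2_norm_eq_inner)
  also have "\<dots> = (norm A)\<^sup>2 * (norm x)\<^sup>2"
    by (simp add: power2_norm_eq_inner[of A] inner_vec_def[of A] power2_norm_eq_inner sum_distrib_right)
  finally show ?thesis by (simp add: power_mult_distrib[symmetric] abs_le_square_iff[symmetric])
qed

lemma continuous_on_psd_sqrt: "continuous_on {q. psd_mat q} (psd_sqrt :: real^'a^'a::finite \<Rightarrow> _)"
  unfolding continuous_on_iff
proof safe
  fix q :: "real^'a^'a" and e :: real assume q: "psd_mat q" and e: "e > 0"
  \<comment> \<open>The square appears because the root is only Hoelder continuous of order 1/2; the
    factor \<open>2 * CARD('a)\<close> pays for passing from the operator bound to the Frobenius
    norm by summing the rows.\<close>
  define d where "d = (e / (2 * CARD('a)))\<^sup>2"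
  have d: "d > 0" using e by (simp add: d_def)
  show "\<exists>d>0. \<forall>q'\<in>{q. psd_mat q}. dist q' q < d \<longrightarrow> dist (psd_sqrt q') (psd_sqrt q) < e"
  proof (intro exI[of _ d] conjI ballI impI d)
    fix q' assume "q' \<in> {q. psd_mat q}" and dq: "dist q' q < d"
    then have q': "psd_mat q'" by simp
    let ?D = "psd_sqrt q' - psd_sqrt q"
    have bd: "norm (?D *v x) \<le> (e / (2 * CARD('a))) * norm x" for x
    proof (rule psd_mat_diff_bound[OF psd_sqrt(1)[OF q'] psd_sqrt(1)[OF q]])
      fix v :: "real^'a" assume v: "norm v = 1"
      have "\<bar>v \<bullet> ((q' - q) *v v)\<bar> \<le> norm v * norm ((q' - q) *v v)"
        by (rule Cauchy_Schwarz_ineq2)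
      also have "\<dots> \<le> norm (q' - q)" using norm_matrix_vector_le[of "q' - q" v] v by simp
      also have "\<dots> \<le> (e / (2 * CARD('a)))\<^sup>2" using dq by (simp add: d_def dist_norm)
      finally show "\<bar>v \<bullet> ((psd_sqrt q' ** psd_sqrt q' - psd_sqrt q ** psd_sqrt q) *v v)\<bar> \<le> (e / real (2 * CARD('a)))\<^sup>2"
        using psd_sqrt(2)[OF q] psd_sqrt(2)[OF q'] by simp
    qed (use e in simp)
    have rowsym: "transpose ?D = ?D"
      using psd_sqrt(1)[OF q] psd_sqrt(1)[OF q'] by (simp add: psd_mat_def transpose_def vec_eq_iff)
    have "norm (?D $ i) \<le> e / (2 * CARD('a))" for i
    proof -
      have "?D *v axis i 1 = ?D $ i"
        using rowsym by (simp add: vec_eq_iff matrix_vector_mult_def axis_def transpose_def if_distrib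
            cong: if_cong)
      then show ?thesis using bd[of "axis i 1"] by (simp add: norm_axis_1)
    qed
    then have "(\<Sum>i\<in>UNIV. norm (?D $ i)) \<le> CARD('a) * (e / (2 * CARD('a)))"
      using sum_bounded_above[of UNIV "\<lambda>i. norm (?D $ i)" "e / (2 * CARD('a))"] by simp
    also have "\<dots> = e / 2" by simp
    also have "\<dots> < e" using e by simp
    finally have "(\<Sum>i\<in>UNIV. norm (?D $ i)) < e" .
    moreover have "norm ?D \<le> (\<Sum>i\<in>UNIV. norm (?D $ i))"
      unfolding norm_vec_def by (rule L2_set_le_sum) simp
    ultimately show "dist (psd_sqrt q') (psd_sqrt q) < e" by (simp add: dist_norm)
  qed
qed

lemma closed_psd: "closed {q::real^'a^'a::finite. psd_mat q}"
proof -
  have "{q::real^'a^'a. psd_mat q} = (\<Inter>i. \<Inter>j. {q. q $ j $ i = q $ i $ j}) \<inter>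
      (\<Inter>v. {q. 0 \<le> (\<Sum>i\<in>UNIV. v $ i * (\<Sum>j\<in>UNIV. q $ i $ j * v $ j))})"
    by (auto simp: psd_mat_def transpose_def matrix_vector_mult_def vec_eq_iff inner_vec_def)
  also have "closed \<dots>"
    by (intro closed_Int closed_INT ballI closed_Collect_eq closed_Collect_le continuous_intros)
  finally show ?thesis .
qed

section \<open>Cumulant generating functions and tilting bounds\<close>

text \<open>These two gradient inequalities are all that the bounds below use about \<open>\<Lambda>\<close> with gradient \<open>m\<close>; they hold
  for bounded and for Gaussian variables alike.\<close>

definition smooth_cgf :: "('e::euclidean_space \<Rightarrow> real) \<Rightarrow> ('e \<Rightarrow> 'e) \<Rightarrow> real \<Rightarrow> bool" where
  "smooth_cgf \<Lambda> m K \<longleftrightarrow> K \<ge> 0 \<and> \<Lambda> 0 = 0 \<and> (\<forall>\<eta> h. \<Lambda> \<eta> + h \<bullet> m \<eta> \<le> \<Lambda> (\<eta> + h)) \<and>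
     (\<forall>\<eta> h. norm h \<le> 1 \<longrightarrow> \<Lambda> (\<eta> + h) \<le> \<Lambda> \<eta> + h \<bullet> m \<eta> + K * (norm h)\<^sup>2)"

definition legendre :: "('e::euclidean_space \<Rightarrow> real) \<Rightarrow> 'e \<Rightarrow> ereal" where
  "legendre \<Lambda> y = (SUP \<eta>. ereal (\<eta> \<bullet> y - \<Lambda> \<eta>))"

lemma smooth_cgfD:
  assumes "smooth_cgf \<Lambda> m K"
  shows "K \<ge> 0" "\<Lambda> 0 = 0" "\<Lambda> \<eta> + h \<bullet> m \<eta> \<le> \<Lambda> (\<eta> + h)"
    "norm h \<le> 1 \<Longrightarrow> \<Lambda> (\<eta> + h) \<le> \<Lambda> \<eta> + h \<bullet> m \<eta> + K * (norm h)\<^sup>2"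
  using assms by (auto simp: smooth_cgf_def)

lemma legendre_upper: "ereal (\<eta> \<bullet> y - \<Lambda> \<eta>) \<le> legendre \<Lambda> y"
  unfolding legendre_def by (rule SUP_upper) simp

lemma legendre_nonneg: "smooth_cgf \<Lambda> m K \<Longrightarrow> 0 \<le> legendre \<Lambda> y"
  using legendre_upper[of 0 y \<Lambda>] by (simp add: smooth_cgfD(2) zero_ereal_def)

lemma smooth_cgf_continuous:
  assumes s: "smooth_cgf \<Lambda> m K"
  shows "continuous_on UNIV \<Lambda>"
  unfolding continuous_on_def
proof
  fix \<eta>
  have "((\<lambda>x. \<Lambda> x - \<Lambda> \<eta>) \<longlongrightarrow> 0) (at \<eta>)"
  proof (rule tendsto_sandwich)
    show "\<forall>\<^sub>F x in at \<eta>. (x - \<eta>) \<bullet> m \<eta> \<le> \<Lambda> x - \<Lambda> \<eta>"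
      using smooth_cgfD(3)[OF s, of \<eta> "x - \<eta>" for x] by (simp add: algebra_simps)
    show "\<forall>\<^sub>F x in at \<eta>. \<Lambda> x - \<Lambda> \<eta> \<le> (x - \<eta>) \<bullet> m \<eta> + K * (norm (x - \<eta>))\<^sup>2"
    proof -
      have "\<forall>\<^sub>F x in at \<eta>. dist x \<eta> < 1"
        by (rule eventually_at_ball'[of 1 \<eta> UNIV, THEN eventually_mono]) (auto simp: dist_commute)
      then show ?thesis
        by eventually_elim (use smooth_cgfD(4)[OF s, of "x - \<eta>" \<eta> for x] in \<open>force simp: dist_norm algebra_simps\<close>)
    qed
    show "((\<lambda>x. (x - \<eta>) \<bullet> m \<eta>) \<longlongrightarrow> 0) (at \<eta>)"
      by (rule tendsto_eq_intros refl | simp)+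
    show "((\<lambda>x. (x - \<eta>) \<bullet> m \<eta> + K * (norm (x - \<eta>))\<^sup>2) \<longlongrightarrow> 0) (at \<eta>)"
      by (rule tendsto_eq_intros refl | simp)+
  qed
  then show "(\<Lambda> \<longlongrightarrow> \<Lambda> \<eta>) (at \<eta> within UNIV)"
    by (simp add: LIM_zero_iff)
qed

text \<open>At a maximiser of \<open>\<eta> \<bullet> y - \<Lambda> \<eta> - \<epsilon> \<parallel>\<eta>\<parallel>\<^sup>2 / 2\<close> one has \<open>m \<eta> = y - \<epsilon> \<eta>\<close>, and the maximum
  being at most the Legendre transform forces \<open>\<epsilon> \<parallel>\<eta>\<parallel> \<longlongrightarrow> 0\<close>. This replaces the usual discussion of
  exposed points.\<close>

lemma legendre_approx:
  assumes s: "smooth_cgf \<Lambda> m K" and lt: "legendre \<Lambda> y < ereal c" and d: "d > 0"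
  obtains \<eta> where "norm (m \<eta> - y) < d" "\<eta> \<bullet> m \<eta> - \<Lambda> \<eta> < c"
proof -
  obtain c' where c': "legendre \<Lambda> y = ereal c'"
    using lt legendre_nonneg[OF s, of y] by (cases "legendre \<Lambda> y") auto
  have c'0: "c' \<ge> 0" using legendre_nonneg[OF s, of y] c' by simp
  have c'c: "c' < c" using lt c' by simp
  have le: "\<eta> \<bullet> y - \<Lambda> \<eta> \<le> c'" for \<eta> using legendre_upper[of \<eta> y \<Lambda>] c' by simp
  \<comment> \<open>Nonnegativity of the maximum will give \<epsilon> |\<eta>|^2 / 2 \<le> c', that
    is |\<epsilon> \<eta>|^2 \<le> 2 \<epsilon> c', and this choice makes the right side smaller
    than d^2; the summand 1 covers c' = 0.\<close>
  define \<epsilon> where "\<epsilon> = d\<^sup>2 / (2 * (c' + 1))"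
  have e: "\<epsilon> > 0" using d c'0 by (simp add: \<epsilon>_def)
  define F where "F \<eta> = \<eta> \<bullet> y - \<Lambda> \<eta> - \<epsilon> / 2 * (\<eta> \<bullet> \<eta>)" for \<eta>
  \<comment> \<open>Beyond this radius the tangent of \<Lambda> at 0 already forces
    \<open>F x \<le> 0 = F 0\<close>, so a maximiser on the ball is a global one.\<close>
  define R where "R = 2 * norm (y - m 0) / \<epsilon>"
  have R: "R \<ge> 0" using e by (simp add: R_def)
  have F0: "F 0 = 0" using smooth_cgfD(2)[OF s] by (simp add: F_def)
  have "continuous_on (cball 0 R) F" unfolding F_def
    by (intro continuous_intros continuous_on_subset[OF smooth_cgf_continuous[OF s]]) auto
  then obtain \<eta> where \<eta>: "\<eta> \<in> cball 0 R" and max: "\<And>x. x \<in> cball 0 R \<Longrightarrow> F x \<le> F \<eta>"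
    using continuous_attains_sup[of "cball (0::'a) R" F] R by auto
  have F\<eta>: "0 \<le> F \<eta>" using max[of 0] F0 R by simp
  have gmax: "F x \<le> F \<eta>" for x
  proof (cases "norm x \<le> R")
    case False
    have "F x \<le> x \<bullet> (y - m 0) - \<epsilon> / 2 * (x \<bullet> x)"
      using smooth_cgfD(2)[OF s] smooth_cgfD(3)[OF s, of 0 x] by (simp add: F_def inner_diff)
    also have "\<dots> \<le> norm x * norm (y - m 0) - \<epsilon> / 2 * (norm x * norm x)"
      using norm_cauchy_schwarz[of x "y - m 0"] by (simp add: norm_eq_sqrt_inner)
    also have "\<dots> = norm x * (\<epsilon> / 2) * (R - norm x)" using e by (simp add: R_def field_simps)
    also have "\<dots> \<le> 0" using False e by (intro mult_nonneg_nonpos) auto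
    finally show ?thesis using F\<eta> by simp
  qed (use max in simp)
  define g where "g = y - \<epsilon> *\<^sub>R \<eta> - m \<eta>"
  have g0: "g = 0"
  proof (rule ccontr)
    assume "g \<noteq> 0"
    then have gg: "g \<bullet> g > 0" by simp
    \<comment> \<open>In place of a derivative: moving by \<open>t\<close> along the residual
      \<open>g\<close> raises \<open>F\<close> by at least t |g|^2 - B t^2 |g|^2, which is positive
      for t \<le> 1 / (2 B).\<close>
    define B where "B = K + \<epsilon> / 2"
    have B: "B > 0" using smooth_cgfD(1)[OF s] e by (simp add: B_def)
    define t where "t = min (1 / (norm g + 1)) (1 / (2 * B))"
    have t: "t > 0" using B by (simp add: t_def add_nonneg_pos)
    have "t * norm g \<le> 1 / (norm g + 1) * norm g" by (intro mult_right_mono) (auto simp: t_def)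
    also have "\<dots> \<le> 1" by (simp add: divide_simps add_nonneg_pos)
    finally have tg: "norm (t *\<^sub>R g) \<le> 1" using t by simp
    have u: "\<Lambda> (\<eta> + t *\<^sub>R g) \<le> \<Lambda> \<eta> + t * (g \<bullet> m \<eta>) + K * (t * t * (g \<bullet> g))"
      using smooth_cgfD(4)[OF s tg, of \<eta>] t
      by (simp add: power_mult_distrib power2_norm_eq_inner power2_eq_square[of t])
    have "F (\<eta> + t *\<^sub>R g) \<le> F \<eta>" by (rule gmax)
    then have "t * (g \<bullet> y) - \<epsilon> / 2 * (2 * t * (g \<bullet> \<eta>) + t * t * (g \<bullet> g)) \<le> \<Lambda> (\<eta> + t *\<^sub>R g) - \<Lambda> \<eta>"
      by (simp add: F_def inner_add inner_commute algebra_simps)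
    with u have "t * (g \<bullet> y) - \<epsilon> / 2 * (2 * t * (g \<bullet> \<eta>) + t * t * (g \<bullet> g))
       \<le> t * (g \<bullet> m \<eta>) + K * (t * t * (g \<bullet> g))" by linarith
    then have "t * (g \<bullet> y - \<epsilon> * (g \<bullet> \<eta>) - g \<bullet> m \<eta>) \<le> B * (t * t * (g \<bullet> g))"
      by (simp add: B_def algebra_simps)
    moreover have "g \<bullet> g = g \<bullet> y - \<epsilon> * (g \<bullet> \<eta>) - g \<bullet> m \<eta>"
      by (subst (2) g_def) (simp add: inner_diff)
    ultimately have "t * (g \<bullet> g) \<le> B * (t * t * (g \<bullet> g))" by simp
    then have "1 \<le> B * t" using t gg
      by (simp add: mult.assoc[symmetric]) 
    moreover have "B * t \<le> B * (1 / (2 * B))" using B by (intro mult_left_mono) (auto simp: t_def)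
    ultimately show False using B by simp
  qed
  then have m\<eta>: "m \<eta> = y - \<epsilon> *\<^sub>R \<eta>" by (simp add: g_def algebra_simps)
  have "\<epsilon> / 2 * (\<eta> \<bullet> \<eta>) \<le> c'" using F\<eta> le[of \<eta>] by (simp add: F_def)
  then have "(\<epsilon> * norm \<eta>)\<^sup>2 \<le> 2 * \<epsilon> * c'"
    using mult_left_mono[of "\<epsilon> / 2 * (\<eta> \<bullet> \<eta>)" c' "2 * \<epsilon>"] e
    by (simp add: power_mult_distrib power2_norm_eq_inner power2_eq_square[of \<epsilon>])
  also have "\<dots> = d\<^sup>2 * (c' / (c' + 1))" using c'0 by (simp add: \<epsilon>_def field_simps)
  also have "\<dots> < d\<^sup>2 * 1" using d c'0 by (intro mult_strict_left_mono) auto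
  finally have "\<epsilon> * norm \<eta> < d" using d e by (simp add: power_less_imp_less_base)
  then have 1: "norm (m \<eta> - y) < d" using e by (simp add: m\<eta>)
  have "\<eta> \<bullet> m \<eta> - \<Lambda> \<eta> = \<eta> \<bullet> y - \<Lambda> \<eta> - \<epsilon> * (\<eta> \<bullet> \<eta>)" by (simp add: m\<eta> inner_diff)
  also have "\<dots> \<le> \<eta> \<bullet> y - \<Lambda> \<eta>" using e by simp
  also have "\<dots> \<le> c'" by (rule le)
  finally show ?thesis using 1 c'c by (intro that) auto
qed

text \<open>A short step along \<open>y - m 0\<close> works, because the quadratic term of the upper
  gradient inequality is of second order in \<open>t\<close>. This is what makes every
  \<open>y\<close> other than the mean infinitely expensive when the layer is much wider than the
  speed.\<close>

lemma legendre_pos: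
  assumes s: "smooth_cgf \<Lambda> m K" and ne: "y \<noteq> m 0"
  obtains \<eta> where "\<eta> \<bullet> y - \<Lambda> \<eta> > 0"
proof -
  define g where "g = y - m 0"
  have gg: "g \<bullet> g > 0" using ne by (simp add: g_def)
  have gy: "y = g + m 0" by (simp add: g_def)
  define t where "t = min (1 / (norm g + 1)) (1 / (2 * (K + 1)))"
  have K: "K \<ge> 0" by (rule smooth_cgfD(1)[OF s])
  have t: "t > 0" using K by (simp add: t_def add_nonneg_pos)
  have "t * norm g \<le> 1 / (norm g + 1) * norm g" by (intro mult_right_mono) (auto simp: t_def)
  also have "\<dots> \<le> 1" by (simp add: divide_simps add_nonneg_pos)
  finally have tg: "norm (t *\<^sub>R g) \<le> 1" using t by simp
  have u: "\<Lambda> (t *\<^sub>R g) \<le> t * (g \<bullet> m 0) + K * t * (t * (g \<bullet> g))"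
    using smooth_cgfD(4)[OF s tg, of 0] smooth_cgfD(2)[OF s] t
    by (simp add: power_mult_distrib power2_norm_eq_inner power2_eq_square[of t])
  have "K * t \<le> K * (1 / (2 * (K + 1)))" using K by (intro mult_left_mono) (auto simp: t_def)
  also have "\<dots> \<le> 1 / 2" using K by (simp add: field_simps)
  finally have "K * t * (t * (g \<bullet> g)) \<le> 1 / 2 * (t * (g \<bullet> g))" using t gg by (intro mult_right_mono) auto
  then have "\<Lambda> (t *\<^sub>R g) < t * (g \<bullet> m 0) + t * (g \<bullet> g)"
    using u mult_pos_pos[OF t gg] by linarith
  also have "\<dots> = (t *\<^sub>R g) \<bullet> y" by (simp add: gy inner_add inner_commute algebra_simps)
  finally show ?thesis by (intro that[of "t *\<^sub>R g"]) simp
qed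

text \<open>\<open>A\<close> will be an event of the conditioning variable and \<open>L w\<close>
  the conditional cumulant at \<eta>, bounded by \<open>U\<close> on \<open>A\<close>. Keeping the
  factor \<open>prob A\<close> makes the bound relative, so that bounds multiply along the
  chain.\<close>

lemma (in prob_space) chernoff_on_event:
  fixes Y :: "'a \<Rightarrow> 'e::euclidean_space"
  assumes [measurable]: "A \<in> events" "Y \<in> borel_measurable M"
    and eq: "(\<integral>\<^sup>+w. indicator A w * ennreal (exp (k * (\<eta> \<bullet> Y w))) \<partial>M)
           = (\<integral>\<^sup>+w. indicator A w * ennreal (exp (k * L w)) \<partial>M)"
    and k: "k \<ge> 0" and U: "\<And>w. w \<in> A \<Longrightarrow> L w \<le> U"
  shows "prob {w \<in> A. a \<le> \<eta> \<bullet> Y w} \<le> exp (- k * (a - U)) * prob A"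
proof -
  have sub: "A \<subseteq> space M" using assms(1) by (rule sets.sets_into_space)
  have m: "{w \<in> A. a \<le> \<eta> \<bullet> Y w} = A \<inter> {w \<in> space M. a \<le> \<eta> \<bullet> Y w}" using sub by auto
  have [measurable]: "{w \<in> A. a \<le> \<eta> \<bullet> Y w} \<in> events" unfolding m by measurable
  have "ennreal (exp (k * a)) * emeasure M {w \<in> A. a \<le> \<eta> \<bullet> Y w}
      = (\<integral>\<^sup>+w. ennreal (exp (k * a)) * indicator {w \<in> A. a \<le> \<eta> \<bullet> Y w} w \<partial>M)"
    by (simp add: nn_integral_cmult_indicator)
  also have "\<dots> \<le> (\<integral>\<^sup>+w. indicator A w * ennreal (exp (k * (\<eta> \<bullet> Y w))) \<partial>M)"
    using k by (intro nn_integral_mono) (auto simp: indicator_def intro!: ennreal_leI mult_left_mono)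
  also have "\<dots> = (\<integral>\<^sup>+w. indicator A w * ennreal (exp (k * L w)) \<partial>M)" by (rule eq)
  also have "\<dots> \<le> (\<integral>\<^sup>+w. ennreal (exp (k * U)) * indicator A w \<partial>M)"
    using k U by (intro nn_integral_mono) (auto simp: indicator_def intro!: ennreal_leI mult_left_mono)
  also have "\<dots> = ennreal (exp (k * U)) * emeasure M A" by (simp add: nn_integral_cmult_indicator)
  finally have "exp (k * a) * prob {w \<in> A. a \<le> \<eta> \<bullet> Y w} \<le> exp (k * U) * prob A"
    by (simp add: emeasure_eq_measure ennreal_mult[symmetric])
  then show ?thesis
    by (simp add: exp_diff exp_minus right_diff_distrib field_simps)
qed

text \<open>The half spaces in these directions cover the complement of a box, so a deviation of a
  vector in any direction is controlled by finitely many tilts.\<close>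

definition signed_basis :: "'e::euclidean_space set" where
  "signed_basis = Basis \<union> uminus ` Basis"

lemma finite_signed_basis: "finite signed_basis" by (simp add: signed_basis_def)

lemma norm_signed_basis: "h \<in> signed_basis \<Longrightarrow> norm h = 1" by (auto simp: signed_basis_def)

lemma card_signed_basis: "card (signed_basis :: 'e::euclidean_space set) \<le> 2 * DIM('e)"
  unfolding signed_basis_def
  by (rule order_trans[OF card_Un_le]) (simp add: card_image)

lemma norm_lt_signed_basis:
  fixes x :: "'e::euclidean_space" and r :: real
  assumes "\<And>h. h \<in> signed_basis \<Longrightarrow> h \<bullet> x \<le> r"
  shows "norm x \<le> DIM('e) * r"
proof -
  have "\<bar>x \<bullet> b\<bar> \<le> r" if "b \<in> Basis" for b
    using assms[of b] assms[of "- b"] that by (simp add: signed_basis_def inner_commute abs_le_iff)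
  then have "(\<Sum>b\<in>Basis. \<bar>x \<bullet> b\<bar>) \<le> DIM('e) * r" using sum_bounded_above[of Basis "\<lambda>b. \<bar>x \<bullet> b\<bar>" r] by simp
  then show ?thesis using norm_le_l1[of x] by linarith
qed

text \<open>The change of measure is carried out inside the integrals. On the ball about
  \<open>m\<close> the weight exp (k \<eta>.Y) is at most an explicit factor; off the ball some h.(Y
  - m) exceeds \<open>r\<close>, and a further tilt by \<open>t\<close> along \<open>h\<close>
  bounds that part. Here \<open>m\<close> plays the mean of \<open>Y\<close> under the tilt \<eta>,
  and the last summand is a fraction of the left side once \<open>t * r\<close> dominates the
  second-order error.\<close>

lemma (in prob_space) tilting_lower_bound:
  fixes Y :: "'a \<Rightarrow> 'e::euclidean_space" and L :: "'e \<Rightarrow> 'a \<Rightarrow> real" and r :: real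
  assumes [measurable]: "A \<in> events" "Y \<in> borel_measurable M"
    and eq: "\<And>\<eta>. (\<integral>\<^sup>+w. indicator A w * ennreal (exp (k * (\<eta> \<bullet> Y w))) \<partial>M)
           = (\<integral>\<^sup>+w. indicator A w * ennreal (exp (k * L \<eta> w)) \<partial>M)"
    and k: "k \<ge> 0" and r: "r > 0" and t: "t > 0"
    and lo: "\<And>w. w \<in> A \<Longrightarrow> l \<le> L \<eta> w"
    and up: "\<And>w h. w \<in> A \<Longrightarrow> h \<in> signed_basis \<Longrightarrow> L (\<eta> + t *\<^sub>R h) w \<le> u + t * (h \<bullet> m)"
  shows "exp (k * l) * prob A \<le>
      exp (k * (\<eta> \<bullet> m + norm \<eta> * (DIM('e) * r))) * prob {w \<in> A. norm (Y w - m) \<le> DIM('e) * r}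
      + 2 * real DIM('e) * (exp (k * (u - t * r)) * prob A)"
proof -
  let ?N = "{w \<in> A. norm (Y w - m) \<le> DIM('e) * r}"
  let ?a = "exp (k * (\<eta> \<bullet> m + norm \<eta> * (DIM('e) * r)))"
  have sub: "A \<subseteq> space M" using assms(1) by (rule sets.sets_into_space)
  have N: "?N = A \<inter> {w \<in> space M. norm (Y w - m) \<le> DIM('e) * r}" using sub by auto
  have [measurable]: "?N \<in> events" unfolding N by measurable
  \<comment> \<open>Where h.(Y - m) > r the factor exp (k t (h.(Y - m) - r)) is at least 1;
    multiplying by it turns the tilt \<eta> into \<eta> + t h.\<close>
  let ?T = "\<lambda>h w. ennreal (exp (- k * t * (h \<bullet> m + r))) *
              (indicator A w * ennreal (exp (k * ((\<eta> + t *\<^sub>R h) \<bullet> Y w))))"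
  have pw: "indicator A w * ennreal (exp (k * (\<eta> \<bullet> Y w)))
      \<le> ennreal ?a * indicator ?N w + (\<Sum>h\<in>signed_basis. ?T h w)" for w
  proof (cases "w \<in> A")
    case A: True
    show ?thesis
    proof (cases "w \<in> ?N")
      case True
      have "\<eta> \<bullet> Y w = \<eta> \<bullet> m + \<eta> \<bullet> (Y w - m)" by (simp add: inner_diff)
      also have "\<dots> \<le> \<eta> \<bullet> m + norm \<eta> * norm (Y w - m)"
        using norm_cauchy_schwarz by (rule add_left_mono)
      also have "\<dots> \<le> \<eta> \<bullet> m + norm \<eta> * (DIM('e) * r)"
        using True by (intro add_left_mono mult_left_mono) auto
      finally have "ennreal (exp (k * (\<eta> \<bullet> Y w))) \<le> ennreal ?a"
        using k by (intro ennreal_leI) (simp add: mult_left_mono)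
      then show ?thesis using True by (simp add: add_increasing2)
    next
      case False
      then obtain h where h: "h \<in> signed_basis" "h \<bullet> (Y w - m) > r"
        using norm_lt_signed_basis[of "Y w - m" r] A by force
      have "k * t * r \<le> k * t * (h \<bullet> (Y w - m))" using h k t by (intro mult_left_mono) auto
      then have "k * (\<eta> \<bullet> Y w) \<le> - k * t * (h \<bullet> m + r) + k * ((\<eta> + t *\<^sub>R h) \<bullet> Y w)"
        by (simp add: inner_add inner_diff algebra_simps)
      then have "exp (k * (\<eta> \<bullet> Y w)) \<le> exp (- k * t * (h \<bullet> m + r)) * exp (k * ((\<eta> + t *\<^sub>R h) \<bullet> Y w))"
        by (simp add: exp_add[symmetric])
      then have "ennreal (exp (k * (\<eta> \<bullet> Y w))) \<le> ?T h w"
        using A by (simp add: ennreal_mult[symmetric] ennreal_leI)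
      also have "\<dots> \<le> (\<Sum>h\<in>signed_basis. ?T h w)"
        using h by (intro member_le_sum) (auto simp: finite_signed_basis)
      finally show ?thesis using A by (simp add: add_increasing)
    qed
  qed simp
  have T: "(\<integral>\<^sup>+w. ?T h w \<partial>M) \<le> ennreal (exp (k * (u - t * r))) * emeasure M A"
    if h: "h \<in> signed_basis" for h
  proof -
    have "(\<integral>\<^sup>+w. ?T h w \<partial>M) = ennreal (exp (- k * t * (h \<bullet> m + r))) *
       (\<integral>\<^sup>+w. indicator A w * ennreal (exp (k * L (\<eta> + t *\<^sub>R h) w)) \<partial>M)"
      by (subst nn_integral_cmult) (auto simp: eq)
    also have "\<dots> \<le> ennreal (exp (- k * t * (h \<bullet> m + r))) *
       (\<integral>\<^sup>+w. ennreal (exp (k * (u + t * (h \<bullet> m)))) * indicator A w \<partial>M)"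
      using k up h by (intro mult_left_mono nn_integral_mono)
        (auto simp: indicator_def intro!: ennreal_leI mult_left_mono)
    also have "\<dots> = ennreal (exp (- k * t * (h \<bullet> m + r)) * exp (k * (u + t * (h \<bullet> m)))) * emeasure M A"
      by (simp add: nn_integral_cmult_indicator ennreal_mult mult.assoc)
    also have "exp (- k * t * (h \<bullet> m + r)) * exp (k * (u + t * (h \<bullet> m))) = exp (k * (u - t * r))"
      by (simp add: exp_add[symmetric] algebra_simps)
    finally show ?thesis .
  qed
  have "ennreal (exp (k * l)) * emeasure M A = (\<integral>\<^sup>+w. ennreal (exp (k * l)) * indicator A w \<partial>M)"
    by (simp add: nn_integral_cmult_indicator)
  also have "\<dots> \<le> (\<integral>\<^sup>+w. indicator A w * ennreal (exp (k * L \<eta> w)) \<partial>M)"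
    using k lo by (intro nn_integral_mono) (auto simp: indicator_def intro!: ennreal_leI mult_left_mono)
  also have "\<dots> = (\<integral>\<^sup>+w. indicator A w * ennreal (exp (k * (\<eta> \<bullet> Y w))) \<partial>M)" by (rule eq[symmetric])
  also have "\<dots> \<le> (\<integral>\<^sup>+w. ennreal ?a * indicator ?N w + (\<Sum>h\<in>signed_basis. ?T h w) \<partial>M)"
    by (intro nn_integral_mono pw)
  also have "\<dots> = ennreal ?a * emeasure M ?N + (\<Sum>h\<in>signed_basis. \<integral>\<^sup>+w. ?T h w \<partial>M)"
    by (subst nn_integral_add, measurable, subst nn_integral_sum)
       (auto simp: nn_integral_cmult_indicator)
  also have "\<dots> \<le> ennreal ?a * emeasure M ?N +
      (\<Sum>h\<in>(signed_basis::'e set). ennreal (exp (k * (u - t * r))) * emeasure M A)"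
    by (intro add_left_mono sum_mono T)
  also have "\<dots> = ennreal (?a * prob ?N + real (card (signed_basis::'e set)) * (exp (k * (u - t * r)) * prob A))"
    by (simp add: emeasure_eq_measure ennreal_mult[symmetric] ennreal_plus[symmetric] ennreal_of_nat_eq_real_of_nat
        del: ennreal_plus)
  finally have "exp (k * l) * prob A \<le> ?a * prob ?N + real (card (signed_basis::'e set)) * (exp (k * (u - t * r)) * prob A)"
    by (simp add: emeasure_eq_measure ennreal_mult[symmetric] ennreal_plus[symmetric] del: ennreal_plus)
  also have "\<dots> \<le> ?a * prob ?N + 2 * real DIM('e) * (exp (k * (u - t * r)) * prob A)"
    using of_nat_mono[OF card_signed_basis[where 'e='e], where 'a=real]
    by (intro add_left_mono mult_right_mono) auto
  finally show ?thesis .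
qed

section \<open>One step of a Markov chain\<close>

text \<open>States that exp (k \<Lambda>(G, \<eta>)) is the conditional expectation of exp (k
  \<eta>.Y) given \<open>G\<close>, without kernels: integrals over all events of \<open>G\<close>
  determine it. Values in \<open>ennreal\<close> leave no integrability to check.\<close>

definition mgf_link ::
  "'b measure \<Rightarrow> ('b \<Rightarrow> 'g::euclidean_space) \<Rightarrow> ('b \<Rightarrow> 'e::euclidean_space) \<Rightarrow> real \<Rightarrow> ('g \<Rightarrow> 'e \<Rightarrow> real) \<Rightarrow> bool" where
  "mgf_link M G Y k \<Lambda> \<longleftrightarrow> prob_space M \<and> G \<in> borel_measurable M \<and> Y \<in> borel_measurable M \<and>
     (\<forall>\<eta>. \<forall>B\<in>sets borel. (\<integral>\<^sup>+w. indicator B (G w) * ennreal (exp (k * (\<eta> \<bullet> Y w))) \<partial>M)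
        = (\<integral>\<^sup>+w. indicator B (G w) * ennreal (exp (k * \<Lambda> (G w) \<eta>)) \<partial>M))"

text \<open>One radius per centre is enough for upper bounds, while lower bounds are required for
  every radius. Quantifying over real \<open>c\<close> includes infinite rates without a case
  distinction. The set \<open>S\<close> restricts the centres to the values of the conditioning
  variable at which the next transition is controlled.\<close>

definition ldp_upper :: "(nat \<Rightarrow> 'b measure) \<Rightarrow> (nat \<Rightarrow> 'b \<Rightarrow> 'c::metric_space) \<Rightarrow> (nat \<Rightarrow> real)
    \<Rightarrow> ('c \<Rightarrow> ereal) \<Rightarrow> 'c set \<Rightarrow> bool" where
  "ldp_upper M X v I S \<longleftrightarrow> (\<forall>g\<in>S. \<forall>c::real. ereal c < I g \<longrightarrow> (\<exists>\<delta>>0. \<forall>\<^sub>F n in sequentially.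
      \<P>(w in M n. X n w \<in> ball g \<delta>) \<le> exp (- c * v n)))"

definition ldp_lower :: "(nat \<Rightarrow> 'b measure) \<Rightarrow> (nat \<Rightarrow> 'b \<Rightarrow> 'c::metric_space) \<Rightarrow> (nat \<Rightarrow> real)
    \<Rightarrow> ('c \<Rightarrow> ereal) \<Rightarrow> 'c set \<Rightarrow> bool" where
  "ldp_lower M X v I S \<longleftrightarrow> (\<forall>g\<in>S. \<forall>c::real. I g < ereal c \<longrightarrow> (\<forall>\<delta>>0. \<forall>\<^sub>F n in sequentially.
      exp (- c * v n) \<le> \<P>(w in M n. X n w \<in> ball g \<delta>)))"

text \<open>Cumulants live at speed \<open>k\<close>; as k / v tends to \<gamma>, the Legendre
  transform is rescaled by \<gamma>. For an infinite ratio only its zero \<open>m q 0\<close>, the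
  law of large numbers limit, has finite cost.\<close>

definition step_rate :: "ereal \<Rightarrow> ('g \<Rightarrow> 'e::euclidean_space \<Rightarrow> real) \<Rightarrow> ('g \<Rightarrow> 'e \<Rightarrow> 'e) \<Rightarrow> 'e \<Rightarrow> 'g \<Rightarrow> ereal" where
  "step_rate \<gamma> \<Lambda> m y q = (if \<gamma> = \<infinity> then (if y = m q 0 then 0 else \<infinity>) else \<gamma> * legendre (\<Lambda> q) y)"

text \<open>Converts exponents at speed \<open>k\<close> into exponents at speed \<open>v\<close>;
  when the ratio is infinite, any positive \<open>a\<close> beats every \<open>b\<close>.\<close>

lemma speed_ratio_eventually:
  assumes lim: "(\<lambda>n. ereal (k n / v n)) \<longlonglongrightarrow> \<gamma>" and v: "filterlim v at_top sequentially"
    and a: "(\<gamma> = ereal g \<and> b < g * a) \<or> (\<gamma> = \<infinity> \<and> a > 0)"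
  shows "\<forall>\<^sub>F n in sequentially. b * v n \<le> k n * a"
proof -
  have vpos: "\<forall>\<^sub>F n in sequentially. v n > 0" using v by (simp add: filterlim_at_top_dense)
  from a show ?thesis
  proof
    assume g: "\<gamma> = ereal g \<and> b < g * a"
    then have "(\<lambda>n. k n / v n) \<longlonglongrightarrow> g" using lim by simp
    then have "(\<lambda>n. k n / v n * a) \<longlonglongrightarrow> g * a" by (intro tendsto_intros)
    then have "\<forall>\<^sub>F n in sequentially. b < k n / v n * a" using g by (auto dest: order_tendstoD)
    with vpos show ?thesis by eventually_elim (simp add: field_simps)
  next
    assume g: "\<gamma> = \<infinity> \<and> a > 0"
    then have "\<forall>\<^sub>F n in sequentially. ereal (b / a) < ereal (k n / v n)"
      using lim by (intro order_tendstoD(1)) auto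
    with vpos show ?thesis by eventually_elim (use g in \<open>simp add: field_simps\<close>)
  qed
qed

text \<open>A strict gap between the exponents absorbs any constant factor, such as the number of
  balls in a cover.\<close>

lemma eventually_mult_exp_le:
  fixes v :: "nat \<Rightarrow> real"
  assumes v: "filterlim v at_top sequentially" and c: "c < c'" and N: "N > 0"
  shows "\<forall>\<^sub>F n in sequentially. N * exp (- c' * v n) \<le> exp (- c * v n)"
proof -
  have "filterlim (\<lambda>n. v n * (c' - c)) at_top sequentially"
    using c v by (intro filterlim_at_top_mult_tendsto_pos[where c="c' - c"]) (auto simp: mult.commute)
  then have "\<forall>\<^sub>F n in sequentially. ln N \<le> v n * (c' - c)" by (simp add: filterlim_at_top)
  then show ?thesis
  proof eventually_elim
    case (elim n)
    have "N * exp (- c' * v n) = exp (ln N + - c' * v n)" using N by (simp only: exp_add exp_ln)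
    also have "\<dots> \<le> exp (- c * v n)" using elim by (simp add: algebra_simps)
    finally show ?case .
  qed
qed

lemma mgf_link_event:
  assumes "mgf_link M G Y k \<Lambda>" and B: "B \<in> sets borel"
  defines "A \<equiv> {w \<in> space M. G w \<in> B}"
  shows "A \<in> sets M"
    and "(\<integral>\<^sup>+w. indicator A w * ennreal (exp (k * (\<eta> \<bullet> Y w))) \<partial>M)
        = (\<integral>\<^sup>+w. indicator A w * ennreal (exp (k * \<Lambda> (G w) \<eta>)) \<partial>M)"
proof -
  have [measurable]: "G \<in> borel_measurable M" using assms(1) by (simp add: mgf_link_def)
  show "A \<in> sets M" unfolding A_def using B by measurable
  have "(\<integral>\<^sup>+w. indicator A w * f w \<partial>M) = (\<integral>\<^sup>+w. indicator B (G w) * f w \<partial>M)" for f :: "_ \<Rightarrow> ennreal"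
    by (intro nn_integral_cong) (auto simp: A_def indicator_def)
  then show "(\<integral>\<^sup>+w. indicator A w * ennreal (exp (k * (\<eta> \<bullet> Y w))) \<partial>M)
        = (\<integral>\<^sup>+w. indicator A w * ennreal (exp (k * \<Lambda> (G w) \<eta>)) \<partial>M)"
    using assms(1) B by (simp add: mgf_link_def)
qed

lemma cgf_near:
  assumes "continuous_on S (\<lambda>q. \<Lambda> q \<eta>)" "q \<in> S" "\<epsilon> > (0::real)"
  shows "\<exists>\<delta>>0. \<forall>q'\<in>S. dist q q' < \<delta> \<longrightarrow> \<bar>\<Lambda> q' \<eta> - \<Lambda> q \<eta>\<bar> < \<epsilon>"
  using assms(1)[unfolded continuous_on_iff, rule_format, OF assms(2,3)]
  by (simp add: dist_real_def dist_commute)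

lemma cgf_near_finite:
  assumes cont: "\<And>\<eta>. continuous_on S (\<lambda>q. \<Lambda> q \<eta>)" and q: "q \<in> S" and e: "\<epsilon> > (0::real)" and fin: "finite H"
  shows "\<exists>\<delta>>0. \<forall>\<eta>\<in>H. \<forall>q'\<in>S. dist q q' < \<delta> \<longrightarrow> \<bar>\<Lambda> q' \<eta> - \<Lambda> q \<eta>\<bar> < \<epsilon>"
  using fin
proof induction
  case (insert \<eta> H)
  obtain d1 where "d1 > 0" "\<forall>q'\<in>S. dist q q' < d1 \<longrightarrow> \<bar>\<Lambda> q' \<eta> - \<Lambda> q \<eta>\<bar> < \<epsilon>"
    using cgf_near[where \<Lambda>=\<Lambda> and \<eta>=\<eta>, OF cont q e] by blast
  moreover obtain d2 where "d2 > 0" "\<forall>\<eta>\<in>H. \<forall>q'\<in>S. dist q q' < d2 \<longrightarrow> \<bar>\<Lambda> q' \<eta> - \<Lambda> q \<eta>\<bar> < \<epsilon>"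
    using insert.IH by blast
  ultimately show ?case by (intro exI[of _ "min d1 d2"]) auto
qed (use zero_less_one in blast)

text \<open>Distributes a bound on a total cost over the chain so far and one transition. The thirds
  leave strict room on all sides; an infinite summand is given whatever the other one lacks.\<close>

lemma ereal_less_add_split:
  fixes I J :: ereal
  assumes "0 \<le> I" "0 \<le> J" "ereal c < I + J"
  shows "\<exists>a b. ereal a < I \<and> ereal b < J \<and> c < a + b"
proof (cases I)
  case (real i)
  show ?thesis
  proof (cases J)
    case r: (real j)
    have "c < i + j" using assms(3) real r by simp
    then show ?thesis using real r
      by (intro exI[of _ "i - (i + j - c) / 3"] exI[of _ "j - (i + j - c) / 3"]) (simp add: field_simps)
  next
    case PInf
    then show ?thesis using real by (intro exI[of _ "i - 1"] exI[of _ "c - i + 2"]) simp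
  qed (use assms in simp)
next
  case PInf
  then show ?thesis
  proof (cases J)
    case r: (real j)
    then show ?thesis using PInf by (intro exI[of _ "c - j + 2"] exI[of _ "j - 1"]) simp
  next
    case p: PInf
    then show ?thesis using PInf by (intro exI[of _ "c"] exI[of _ 1]) simp
  qed (use assms in simp)
qed (use assms in simp)

lemma ereal_add_less_split:
  fixes I J :: ereal
  assumes "0 \<le> I" "0 \<le> J" "I + J < ereal c"
  shows "\<exists>a b. I < ereal a \<and> J < ereal b \<and> a + b < c"
proof -
  obtain i j where ij: "I = ereal i" "J = ereal j"
    using assms by (cases I; cases J) auto
  then have "i + j < c" using assms(3) by simp
  then show ?thesis using ij
    by (intro exI[of _ "i + (c - i - j) / 3"] exI[of _ "j + (c - i - j) / 3"]) (simp add: field_simps)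
qed

text \<open>\<open>k\<close> is the number of conditionally independent terms, \<open>v\<close> the
  speed of the deviation principle. The locale serves the hidden layers with \<open>k\<close> the
  width and the output layer with \<open>k = v\<close> and ratio 1. The constant \<open>K\<close>
  may vary with \<open>q\<close>, since every local estimate freezes \<open>q\<close> at the centre
  of a ball.\<close>

locale mgf_step =
  fixes M :: "nat \<Rightarrow> 'b measure" and G :: "nat \<Rightarrow> 'b \<Rightarrow> 'g::euclidean_space"
    and Y :: "nat \<Rightarrow> 'b \<Rightarrow> 'e::euclidean_space" and k v :: "nat \<Rightarrow> real"
    and \<Lambda> :: "'g \<Rightarrow> 'e \<Rightarrow> real" and m :: "'g \<Rightarrow> 'e \<Rightarrow> 'e" and K :: "'g \<Rightarrow> real"
    and S :: "'g set" and \<gamma> :: ereal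
  assumes link: "\<And>n. mgf_link (M n) (G n) (Y n) (k n) \<Lambda>"
    and GS: "\<And>n w. w \<in> space (M n) \<Longrightarrow> G n w \<in> S"
    and cgf: "\<And>q. q \<in> S \<Longrightarrow> smooth_cgf (\<Lambda> q) (m q) (K q)"
    and cont: "\<And>\<eta>. continuous_on S (\<lambda>q. \<Lambda> q \<eta>)"
    and k0: "\<And>n. k n \<ge> 0" and klim: "filterlim k at_top sequentially"
    and vlim: "filterlim v at_top sequentially"
    and ratio: "(\<lambda>n. ereal (k n / v n)) \<longlonglongrightarrow> \<gamma>" and \<gamma>: "\<gamma> \<ge> 1"
begin

abbreviation G_ball :: "nat \<Rightarrow> 'g \<Rightarrow> real \<Rightarrow> 'b set" where
  "G_ball n q \<delta> \<equiv> {w \<in> space (M n). G n w \<in> ball q \<delta>}"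

abbreviation GY_balls :: "nat \<Rightarrow> 'g \<Rightarrow> real \<Rightarrow> 'e \<Rightarrow> real \<Rightarrow> 'b set" where
  "GY_balls n q \<delta> y \<epsilon> \<equiv> {w \<in> space (M n). G n w \<in> ball q \<delta> \<and> Y n w \<in> ball y \<epsilon>}"

lemma probM: "prob_space (M n)"
  using link by (simp add: mgf_link_def)

lemma measG [measurable]: "G n \<in> borel_measurable (M n)"
  using link by (simp add: mgf_link_def)

lemma measY [measurable]: "Y n \<in> borel_measurable (M n)"
  using link by (simp add: mgf_link_def)

lemma step_rate_nonneg: "q \<in> S \<Longrightarrow> 0 \<le> step_rate \<gamma> \<Lambda> m y q"
  using \<gamma> legendre_nonneg[OF cgf] unfolding step_rate_def
  by (auto intro!: ereal_0_le_mult intro: order_trans[of 0 1])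

lemma measure_pair_le:
  "measure (M n) (GY_balls n q \<delta> y \<delta>')
    \<le> measure (M n) (G_ball n q \<delta>)"
proof -
  interpret prob_space "M n" by (rule probM)
  show ?thesis by (rule finite_measure_mono) auto
qed

lemma pair_upper_halfspace:
  assumes q: "q \<in> S" and lt: "\<And>q'. q' \<in> S \<Longrightarrow> dist q q' < \<delta> \<Longrightarrow> \<Lambda> q' \<eta> \<le> U"
  shows "measure (M n) (GY_balls n q \<delta> y \<delta>)
     \<le> exp (- k n * (\<eta> \<bullet> y - norm \<eta> * \<delta> - U)) * measure (M n) (G_ball n q \<delta>)"
proof -
  interpret prob_space "M n" by (rule probM)
  let ?A = "G_ball n q \<delta>"
  have ev: "?A \<in> events" by (rule mgf_link_event(1)[OF link]) simp
  have eq: "(\<integral>\<^sup>+w. indicator ?A w * ennreal (exp (k n * (\<eta> \<bullet> Y n w))) \<partial>M n)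
        = (\<integral>\<^sup>+w. indicator ?A w * ennreal (exp (k n * \<Lambda> (G n w) \<eta>)) \<partial>M n)"
    by (rule mgf_link_event(2)[OF link]) simp
  have "prob (GY_balls n q \<delta> y \<delta>)
     \<le> prob {w \<in> ?A. \<eta> \<bullet> y - norm \<eta> * \<delta> \<le> \<eta> \<bullet> Y n w}"
  proof (rule finite_measure_mono)
    show "(GY_balls n q \<delta> y \<delta>)
        \<subseteq> {w \<in> ?A. \<eta> \<bullet> y - norm \<eta> * \<delta> \<le> \<eta> \<bullet> Y n w}"
    proof safe
      fix w assume "Y n w \<in> ball y \<delta>"
      then have "\<eta> \<bullet> (y - Y n w) \<le> norm \<eta> * \<delta>"
        using norm_cauchy_schwarz[of \<eta> "y - Y n w"]
          mult_left_mono[of "norm (y - Y n w)" \<delta> "norm \<eta>"] by (simp add: dist_norm)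
      then show "\<eta> \<bullet> y - norm \<eta> * \<delta> \<le> \<eta> \<bullet> Y n w" by (simp add: inner_diff)
    qed
    have "{w \<in> ?A. \<eta> \<bullet> y - norm \<eta> * \<delta> \<le> \<eta> \<bullet> Y n w}
        = ?A \<inter> {w \<in> space (M n). \<eta> \<bullet> y - norm \<eta> * \<delta> \<le> \<eta> \<bullet> Y n w}" by auto
    also have "\<dots> \<in> events" using ev by measurable
    finally show "{w \<in> ?A. \<eta> \<bullet> y - norm \<eta> * \<delta> \<le> \<eta> \<bullet> Y n w} \<in> events" .
  qed
  also have "\<dots> \<le> exp (- k n * (\<eta> \<bullet> y - norm \<eta> * \<delta> - U)) * prob ?A"
    by (rule chernoff_on_event[OF ev measY eq k0]) (use GS lt in auto)
  finally show ?thesis .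
qed

text \<open>A tilt that is nearly optimal for \<open>y\<close> at \<open>q\<close> stays good for
  nearby \<open>q'\<close> by continuity of \<Lambda> at this single tilt. The bound holds for all
  smaller radii as well, because the radius still has to be matched with the one that the previous
  layer requires.\<close>

lemma pair_upper:
  assumes q: "q \<in> S" and b: "ereal b < step_rate \<gamma> \<Lambda> m y q"
  shows "\<exists>\<delta>>0. \<forall>\<delta>'>0. \<delta>' \<le> \<delta> \<longrightarrow> (\<forall>\<^sub>F n in sequentially.
     measure (M n) (GY_balls n q \<delta>' y \<delta>')
     \<le> exp (- b * v n) * measure (M n) (G_ball n q \<delta>'))"
\<comment> \<open>A nonpositive \<open>b\<close> is trivial and is split off because for an infinite
  ratio and \<open>y = m q 0\<close> no tilt has a positive exponent.\<close>
proof (cases "b \<le> 0")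
  case True
  have "\<forall>\<^sub>F n in sequentially. v n > 0" using vlim by (simp add: filterlim_at_top_dense)
  then have "\<forall>\<^sub>F n in sequentially.
     measure (M n) (GY_balls n q \<delta>' y \<delta>')
     \<le> exp (- b * v n) * measure (M n) (G_ball n q \<delta>')" for \<delta>'
  proof eventually_elim
    case (elim n)
    have "1 * measure (M n) (G_ball n q \<delta>')
        \<le> exp (- b * v n) * measure (M n) (G_ball n q \<delta>')"
      using True elim by (intro mult_right_mono) (auto simp: mult_nonpos_nonneg)
    then show ?case using measure_pair_le[of n q \<delta>' y \<delta>'] by simp
  qed
  then show ?thesis by (intro exI[of _ 1]) auto
next
  case False
  obtain \<eta> a where a: "\<eta> \<bullet> y - \<Lambda> q \<eta> > a"
    and ga: "(\<exists>g. \<gamma> = ereal g \<and> b < g * a) \<or> (\<gamma> = \<infinity> \<and> a > 0)"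
  proof (cases "\<gamma> = \<infinity>")
    case True
    then have "y \<noteq> m q 0" using b False by (auto simp: step_rate_def zero_ereal_def split: if_splits)
    then obtain \<eta> where "\<eta> \<bullet> y - \<Lambda> q \<eta> > 0" using legendre_pos[OF cgf[OF q]] by blast
    then show ?thesis using True by (intro that[of "(\<eta> \<bullet> y - \<Lambda> q \<eta>) / 2" \<eta>]) auto
  next
    case gf: False
    then obtain g where g: "\<gamma> = ereal g" using \<gamma> by (cases \<gamma>) auto
    have g1: "g \<ge> 1" using \<gamma> g by (simp add: one_ereal_def)
    have "ereal b < ereal g * legendre (\<Lambda> q) y" using b g by (simp add: step_rate_def)
    then have "ereal (b / g) < legendre (\<Lambda> q) y" using g1
      by (cases "legendre (\<Lambda> q) y") (auto simp: field_simps)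
    then obtain \<eta> where "ereal (b / g) < ereal (\<eta> \<bullet> y - \<Lambda> q \<eta>)"
      unfolding legendre_def less_SUP_iff by blast
    then obtain a where "b / g < a" "a < \<eta> \<bullet> y - \<Lambda> q \<eta>" using dense by auto
    then show ?thesis using g g1 by (intro that[of a \<eta>]) (auto simp: field_simps)
  qed
  \<comment> \<open>Half of the slack goes to the variation of \<Lambda> in \<open>q\<close>, the
    other half to the diameter of the ball around \<open>y\<close>.\<close>
  define s where "s = (\<eta> \<bullet> y - \<Lambda> q \<eta> - a) / 2"
  have s: "s > 0" using a by (simp add: s_def)
  obtain d where d: "d > 0" "\<And>q'. q' \<in> S \<Longrightarrow> dist q q' < d \<Longrightarrow> \<bar>\<Lambda> q' \<eta> - \<Lambda> q \<eta>\<bar> < s"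
    using cgf_near[where \<Lambda>=\<Lambda> and \<eta>=\<eta>, OF cont q s] by blast
  define \<delta> where "\<delta> = min d (s / (norm \<eta> + 1))"
  have \<delta>: "\<delta> > 0" using d s by (simp add: \<delta>_def add_nonneg_pos)
  have ev: "\<forall>\<^sub>F n in sequentially. b * v n \<le> k n * a"
    using ga speed_ratio_eventually[OF ratio vlim] by blast
  show ?thesis
  proof (intro exI[of _ \<delta>] conjI allI impI \<delta>)
    fix \<delta>' :: real assume \<delta>': "\<delta>' > 0" "\<delta>' \<le> \<delta>"
    have "norm \<eta> * \<delta>' \<le> (norm \<eta> + 1) * (s / (norm \<eta> + 1))"
      using \<delta>' by (intro mult_mono) (auto simp: \<delta>_def)
    also have "\<dots> = s" by (simp add: add_nonneg_eq_0_iff)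
    finally have ns: "norm \<eta> * \<delta>' \<le> s" .
    show "\<forall>\<^sub>F n in sequentially.
     measure (M n) (GY_balls n q \<delta>' y \<delta>')
     \<le> exp (- b * v n) * measure (M n) (G_ball n q \<delta>')"
      using ev
    proof eventually_elim
      case (elim n)
      have "measure (M n) (GY_balls n q \<delta>' y \<delta>')
        \<le> exp (- k n * (\<eta> \<bullet> y - norm \<eta> * \<delta>' - (\<Lambda> q \<eta> + s))) * measure (M n) (G_ball n q \<delta>')"
      proof (rule pair_upper_halfspace[OF q])
        fix q' assume "q' \<in> S" "dist q q' < \<delta>'"
        then show "\<Lambda> q' \<eta> \<le> \<Lambda> q \<eta> + s" using d(2)[of q'] \<delta>' by (simp add: \<delta>_def)
      qed
      also have "\<dots> \<le> exp (- b * v n) * measure (M n) (G_ball n q \<delta>')"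
      proof -
        have "k n * a \<le> k n * (\<eta> \<bullet> y - norm \<eta> * \<delta>' - (\<Lambda> q \<eta> + s))"
          using ns k0 by (intro mult_left_mono) (simp_all add: s_def field_simps)
        then show ?thesis using elim by (intro mult_right_mono) auto
      qed
      finally show ?case .
    qed
  qed
qed

text \<open>For \<open>\<gamma> = \<infinity>\<close> the untilted law (\<open>\<eta> = 0\<close>) has cost exactly zero; for \<open>\<gamma> < \<infinity>\<close> a strictly cheaper tilt
  than \<open>b / \<gamma>\<close> absorbs all error terms.\<close>

lemma pair_lower:
  assumes q: "q \<in> S" and b: "step_rate \<gamma> \<Lambda> m y q < ereal b" and \<epsilon>: "\<epsilon> > 0"
  shows "\<exists>\<delta>>0. \<forall>\<^sub>F n in sequentially.
     exp (- b * v n) * measure (M n) (G_ball n q \<delta>)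
     \<le> measure (M n) (GY_balls n q \<delta> y \<epsilon>)"
proof -
  have b0: "b > 0" using le_less_trans[OF step_rate_nonneg[OF q, of y] b] by (simp add: zero_ereal_def)
  let ?D = "real DIM('e)"
  have D: "?D > 0" by simp
  obtain \<eta> c where m\<eta>: "norm (m q \<eta> - y) < \<epsilon>" and cost: "\<eta> \<bullet> m q \<eta> - \<Lambda> q \<eta> < c"
    and gc: "(\<exists>g. \<gamma> = ereal g \<and> g * c < b) \<or> (\<gamma> = \<infinity> \<and> \<eta> = 0)"
  proof (cases "\<gamma> = \<infinity>")
    case True
    then have "y = m q 0" using b by (auto simp: step_rate_def split: if_splits)
    then show ?thesis using True \<epsilon> smooth_cgfD(2)[OF cgf[OF q]] by (intro that[of 0 1]) auto
  next
    case gf: False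
    then obtain g where g: "\<gamma> = ereal g" using \<gamma> by (cases \<gamma>) auto
    have g1: "g \<ge> 1" using \<gamma> g by (simp add: one_ereal_def)
    have "ereal g * legendre (\<Lambda> q) y < ereal b" using b g by (simp add: step_rate_def)
    then obtain l where l: "legendre (\<Lambda> q) y = ereal l" "g * l < b"
      using g1 legendre_nonneg[OF cgf[OF q], of y] by (cases "legendre (\<Lambda> q) y") auto
    then have "l < b / g" using g1 by (simp add: field_simps)
    then obtain c where c: "l < c" "c < b / g" using dense by blast
    then have "legendre (\<Lambda> q) y < ereal c" using l by simp
    then obtain \<eta> where "norm (m q \<eta> - y) < \<epsilon>" "\<eta> \<bullet> m q \<eta> - \<Lambda> q \<eta> < c"
      using legendre_approx[OF cgf[OF q] _ \<epsilon>] by blast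
    then show ?thesis using g g1 c by (intro that[of \<eta> c]) (auto simp: field_simps)
  qed
  define s where "s = (c - (\<eta> \<bullet> m q \<eta> - \<Lambda> q \<eta>)) / 2"
  have s: "s > 0" using cost by (simp add: s_def)
  \<comment> \<open>The first term places the closed ball of radius \<open>?D * r\<close> about
    \<open>m q \<eta>\<close> inside \<open>ball y \<epsilon>\<close>; the second keeps the loss
    \<open>norm \<eta> * (?D * r)\<close> below \<open>s\<close>.\<close>
  define r where "r = min ((\<epsilon> - norm (m q \<eta> - y)) / (2 * ?D)) (s / (?D * (norm \<eta> + 1)))"
  have r: "r > 0" using m\<eta> s D by (simp add: r_def add_nonneg_pos)
  have r1: "?D * r < \<epsilon> - norm (m q \<eta> - y)"
  proof -
    have "?D * r \<le> ?D * ((\<epsilon> - norm (m q \<eta> - y)) / (2 * ?D))"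
      by (intro mult_left_mono) (auto simp: r_def)
    also have "\<dots> < \<epsilon> - norm (m q \<eta> - y)" using m\<eta> by simp
    finally show ?thesis .
  qed
  have r2: "norm \<eta> * (?D * r) \<le> s"
  proof -
    have "norm \<eta> * (?D * r) \<le> (norm \<eta> + 1) * (?D * (s / (?D * (norm \<eta> + 1))))"
      using r by (intro mult_mono mult_left_mono) (auto simp: r_def)
    also have "\<dots> = s" by (simp add: add_nonneg_eq_0_iff)
    finally show ?thesis .
  qed
  \<comment> \<open>Of the gain \<open>t * r\<close> from leaving the ball, the curvature term K t^2
    takes at most one half, and twice the \<rho> chosen below takes one quarter; the exponent of
    every deviating direction keeps \<open>t * r / 4\<close>.\<close>
  define t where "t = min 1 (r / (2 * (K q + 1)))"
  have K: "K q \<ge> 0" by (rule smooth_cgfD(1)[OF cgf[OF q]])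
  have t: "t > 0" "t \<le> 1" using r K by (auto simp: t_def)
  have "K q * t \<le> K q * (r / (2 * (K q + 1)))" using K by (intro mult_left_mono) (auto simp: t_def)
  also have "\<dots> \<le> r / 2" using K r by (simp add: field_simps)
  finally have Kt: "K q * t\<^sup>2 \<le> t * r / 2"
    using mult_left_mono[of "K q * t" "r / 2" t] t by (simp add: power2_eq_square mult_ac)
  define \<rho> where "\<rho> = min s (t * r / 8)"
  have \<rho>: "\<rho> > 0" using s t r by (simp add: \<rho>_def)
  let ?H = "insert \<eta> ((\<lambda>h. \<eta> + t *\<^sub>R h) ` signed_basis)"
  have "finite ?H" by (simp add: finite_signed_basis)
  then obtain \<delta> where \<delta>: "\<delta> > 0"
    and near: "\<And>\<eta>' q'. \<eta>' \<in> ?H \<Longrightarrow> q' \<in> S \<Longrightarrow> dist q q' < \<delta> \<Longrightarrow> \<bar>\<Lambda> q' \<eta>' - \<Lambda> q \<eta>'\<bar> < \<rho>"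
    using cgf_near_finite[where \<Lambda>=\<Lambda> and H="?H", OF cont q \<rho>] by blast
  let ?A = "\<lambda>n. (G_ball n q \<delta>)"
  let ?P = "\<lambda>n. measure (M n) (GY_balls n q \<delta> y \<epsilon>)"
  \<comment> \<open>At the tilt 0 every cumulant function vanishes, so no error \<rho> may be
    charged there: with an infinite ratio, \<open>k n * \<rho>\<close> would outgrow
    \<open>b * v n\<close>.\<close>
  define l where "l = (if \<eta> = 0 then 0 else \<Lambda> q \<eta> - \<rho>)"
  have L0: "\<Lambda> q' 0 = 0" if "q' \<in> S" for q' using smooth_cgfD(2)[OF cgf[OF that]] .
  have base: "exp (k n * l) * measure (M n) (?A n) \<le>
      exp (k n * (\<eta> \<bullet> m q \<eta> + norm \<eta> * (?D * r))) * ?P n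
      + 2 * ?D * (exp (k n * (\<Lambda> q \<eta> + \<rho> + K q * t\<^sup>2 - t * r)) * measure (M n) (?A n))" for n
  proof -
    interpret prob_space "M n" by (rule probM)
    have ev: "?A n \<in> events" by (rule mgf_link_event(1)[OF link]) simp
    have eq: "(\<integral>\<^sup>+w. indicator (?A n) w * ennreal (exp (k n * (\<eta> \<bullet> Y n w))) \<partial>M n)
        = (\<integral>\<^sup>+w. indicator (?A n) w * ennreal (exp (k n * \<Lambda> (G n w) \<eta>)) \<partial>M n)" for \<eta>
      by (rule mgf_link_event(2)[OF link]) simp
    have "exp (k n * l) * prob (?A n) \<le>
      exp (k n * (\<eta> \<bullet> m q \<eta> + norm \<eta> * (?D * r))) * prob {w \<in> ?A n. norm (Y n w - m q \<eta>) \<le> ?D * r}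
      + 2 * ?D * (exp (k n * (\<Lambda> q \<eta> + \<rho> + K q * t\<^sup>2 - t * r)) * prob (?A n))"
    proof (rule tilting_lower_bound[where L="\<lambda>\<eta> w. \<Lambda> (G n w) \<eta>", OF ev measY eq k0 r t(1)])
      fix w assume w: "w \<in> ?A n"
      show "l \<le> \<Lambda> (G n w) \<eta>"
        using near[of \<eta> "G n w"] w GS[of w n] L0 by (auto simp: l_def)
      fix h :: 'e assume h: "h \<in> signed_basis"
      have "\<Lambda> (G n w) (\<eta> + t *\<^sub>R h) \<le> \<Lambda> q (\<eta> + t *\<^sub>R h) + \<rho>"
        using near[of "\<eta> + t *\<^sub>R h" "G n w", OF insertI2[OF imageI[OF h]]] w GS[of w n] by auto
      also have "\<Lambda> q (\<eta> + t *\<^sub>R h) \<le> \<Lambda> q \<eta> + (t *\<^sub>R h) \<bullet> m q \<eta> + K q * (norm (t *\<^sub>R h))\<^sup>2"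
        using t norm_signed_basis[OF h] by (intro smooth_cgfD(4)[OF cgf[OF q]]) simp
      finally show "\<Lambda> (G n w) (\<eta> + t *\<^sub>R h) \<le> \<Lambda> q \<eta> + \<rho> + K q * t\<^sup>2 + t * (h \<bullet> m q \<eta>)"
        using t norm_signed_basis[OF h] by simp
    qed
    also have "prob {w \<in> ?A n. norm (Y n w - m q \<eta>) \<le> ?D * r} \<le> ?P n"
    proof (rule finite_measure_mono)
      show "{w \<in> ?A n. norm (Y n w - m q \<eta>) \<le> ?D * r} \<subseteq> (GY_balls n q \<delta> y \<epsilon>)"
      proof safe
        fix w assume "norm (Y n w - m q \<eta>) \<le> ?D * r"
        then have "norm (Y n w - y) < \<epsilon>"
          using r1 norm_triangle_ineq[of "Y n w - m q \<eta>" "m q \<eta> - y"] by simp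
        then show "Y n w \<in> ball y \<epsilon>" by (simp add: dist_norm norm_minus_commute)
      qed
      show "(GY_balls n q \<delta> y \<epsilon>) \<in> events"
        by (simp add: mem_ball) measurable
    qed
    finally show ?thesis by simp
  qed
  \<comment> \<open>The remaining exponent eventually beats the factor 4 D, so the deviating
    directions together account for at most half of the left side of \<open>base\<close>.\<close>
  have "filterlim (\<lambda>n. k n * (t * r / 4)) at_top sequentially"
    using t r klim by (intro filterlim_at_top_mult_tendsto_pos[where c="t * r / 4"]) (auto simp: mult.commute)
  then have ev1: "\<forall>\<^sub>F n in sequentially. ln (4 * ?D) \<le> k n * (t * r / 4)"
    by (simp add: filterlim_at_top)
  have ev2: "\<forall>\<^sub>F n in sequentially. ln 2 + k n * (\<eta> \<bullet> m q \<eta> + norm \<eta> * (?D * r) - l) \<le> b * v n"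
  proof (cases "\<eta> = 0")
    case True
    have "filterlim (\<lambda>n. v n * b) at_top sequentially"
      using b0 vlim by (intro filterlim_at_top_mult_tendsto_pos[where c=b]) (auto simp: mult.commute)
    then have "\<forall>\<^sub>F n in sequentially. ln 2 \<le> v n * b"
      by (simp add: filterlim_at_top)
    then show ?thesis using True by (simp add: l_def mult.commute)
  next
    case False
    then obtain g where g: "\<gamma> = ereal g" "g * c < b" using gc by auto
    define b' where "b' = (g * c + b) / 2"
    have b': "g * c < b'" "b' < b" using g by (auto simp: b'_def field_simps)
    have "\<forall>\<^sub>F n in sequentially. - b' * v n \<le> k n * (- c)"
      using g b' by (intro speed_ratio_eventually[OF ratio vlim]) auto
    moreover have "filterlim (\<lambda>n. v n * (b - b')) at_top sequentially"
      using b' vlim by (intro filterlim_at_top_mult_tendsto_pos[where c="b - b'"]) (auto simp: mult.commute)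
    then have "\<forall>\<^sub>F n in sequentially. ln 2 \<le> v n * (b - b')"
      by (simp add: filterlim_at_top)
    ultimately show ?thesis
    proof eventually_elim
      case (elim n)
      have "\<eta> \<bullet> m q \<eta> + norm \<eta> * (?D * r) - l \<le> c"
        using r2 False s by (simp add: l_def s_def \<rho>_def min_def field_simps split: if_splits)
      then have "k n * (\<eta> \<bullet> m q \<eta> + norm \<eta> * (?D * r) - l) \<le> k n * c"
        using k0 by (rule mult_left_mono)
      then show ?case using elim by (simp add: algebra_simps)
    qed
  qed
  have "\<forall>\<^sub>F n in sequentially. exp (- b * v n) * measure (M n) (?A n) \<le> ?P n"
    using ev1 ev2
  proof eventually_elim
    case (elim n)
    let ?p = "measure (M n) (?A n)"
    have "l \<ge> \<Lambda> q \<eta> - \<rho>" using L0[OF q] \<rho> by (auto simp: l_def)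
    then have "\<Lambda> q \<eta> + \<rho> + K q * t\<^sup>2 - t * r \<le> l - t * r / 4"
      using Kt \<rho>_def t r by (simp add: \<rho>_def min_def field_simps split: if_splits)
    then have "k n * (\<Lambda> q \<eta> + \<rho> + K q * t\<^sup>2 - t * r) \<le> k n * (l - t * r / 4)"
      using k0 by (rule mult_left_mono)
    also have "\<dots> \<le> k n * l - ln (4 * ?D)" using elim(1) by (simp add: algebra_simps)
    finally have "exp (k n * (\<Lambda> q \<eta> + \<rho> + K q * t\<^sup>2 - t * r)) \<le> exp (k n * l - ln (4 * ?D))" by simp
    also have "\<dots> = exp (k n * l) / (4 * ?D)" by (simp add: exp_diff)
    finally have "2 * ?D * (exp (k n * (\<Lambda> q \<eta> + \<rho> + K q * t\<^sup>2 - t * r)) * ?p) \<le> 2 * ?D * (exp (k n * l) / (4 * ?D) * ?p)"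
      by (intro mult_left_mono mult_right_mono) auto
    also have "\<dots> = exp (k n * l) * ?p / 2" by simp
    finally have "exp (k n * l) * ?p / 2 \<le> exp (k n * (\<eta> \<bullet> m q \<eta> + norm \<eta> * (?D * r))) * ?P n"
      using base[of n] by linarith
    then have "exp (k n * l) / 2 / exp (k n * (\<eta> \<bullet> m q \<eta> + norm \<eta> * (?D * r))) * ?p \<le> ?P n"
      by (simp add: field_simps)
    moreover have "exp (k n * l) / 2 / exp (k n * (\<eta> \<bullet> m q \<eta> + norm \<eta> * (?D * r)))
        = exp (- (ln 2 + k n * (\<eta> \<bullet> m q \<eta> + norm \<eta> * (?D * r) - l)))"
      by (simp add: exp_diff exp_minus exp_add algebra_simps divide_simps)
    moreover have "exp (- b * v n) \<le> exp (- (ln 2 + k n * (\<eta> \<bullet> m q \<eta> + norm \<eta> * (?D * r) - l)))"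
      using elim(2) by simp
    ultimately show ?case by (smt (verit) mult_right_mono measure_nonneg)
  qed
  then show ?thesis using \<delta> by blast
qed


text \<open>The events that \<open>G\<close> is near \<open>q\<close> and \<open>Y\<close> is near
  \<open>y\<close> are bounded by the cost of reaching \<open>q\<close> times the cost of the
  transition. Compactness is needed of the set \<open>C\<close> that contains the values of
  \<open>G\<close>, whereas the infimum may run over the larger \<open>S\<close>.\<close>

lemma compose_upper:
  assumes up: "ldp_upper M G v I S" and I0: "\<And>q. 0 \<le> I q"
    and comp: "compact C" and CS: "C \<subseteq> S" and GC: "\<And>n w. w \<in> space (M n) \<Longrightarrow> G n w \<in> C"
  shows "ldp_upper M Y v (\<lambda>y. INF q\<in>S. I q + step_rate \<gamma> \<Lambda> m y q) UNIV"
  unfolding ldp_upper_def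
proof (intro ballI allI impI)
  fix y c assume c: "ereal c < (INF q\<in>S. I q + step_rate \<gamma> \<Lambda> m y q)"
  then obtain c' where c': "c < c'" "ereal c' < (INF q\<in>S. I q + step_rate \<gamma> \<Lambda> m y q)"
    using ereal_dense2 ereal_less_eq(3) less_ereal.simps(1) by metis
  let ?P = "\<lambda>q \<delta> n. measure (M n) (GY_balls n q \<delta> y \<delta>)"
  have "\<exists>\<delta>>0. \<forall>\<^sub>F n in sequentially. ?P q \<delta> n \<le> exp (- c' * v n)" if q: "q \<in> C" for q
  proof -
    have qS: "q \<in> S" using q CS by blast
    have "ereal c' < I q + step_rate \<gamma> \<Lambda> m y q"
      using c'(2) qS by (meson INF_lower less_le_trans)
    then obtain a b where ab: "ereal a < I q" "ereal b < step_rate \<gamma> \<Lambda> m y q" "c' < a + b"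
      using ereal_less_add_split[OF I0 step_rate_nonneg[OF qS]] by blast
    obtain d1 where d1: "d1 > 0" "\<forall>\<^sub>F n in sequentially.
        measure (M n) (G_ball n q d1) \<le> exp (- a * v n)"
      using up qS ab(1) unfolding ldp_upper_def by blast
    obtain d2 where d2: "d2 > 0" "\<And>\<delta>'. \<delta>' > 0 \<Longrightarrow> \<delta>' \<le> d2 \<Longrightarrow> \<forall>\<^sub>F n in sequentially.
       ?P q \<delta>' n \<le> exp (- b * v n) * measure (M n) (G_ball n q \<delta>')"
      using pair_upper[OF qS ab(2)] by blast
    define \<delta> where "\<delta> = min d1 d2"
    have \<delta>: "\<delta> > 0" "\<delta> \<le> d1" "\<delta> \<le> d2" using d1 d2 by (auto simp: \<delta>_def)
    have "\<forall>\<^sub>F n in sequentially. v n > 0" using vlim by (simp add: filterlim_at_top_dense)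
    with d1(2) d2(2)[OF \<delta>(1,3)] have "\<forall>\<^sub>F n in sequentially. ?P q \<delta> n \<le> exp (- c' * v n)"
    proof eventually_elim
      case (elim n)
      interpret prob_space "M n" by (rule probM)
      have "prob (G_ball n q \<delta>) \<le> prob (G_ball n q d1)"
        using \<delta> by (intro finite_measure_mono) auto
      with elim have "prob (G_ball n q \<delta>) \<le> exp (- a * v n)" by linarith
      then have "exp (- b * v n) * prob (G_ball n q \<delta>)
          \<le> exp (- b * v n) * exp (- a * v n)"
        by (intro mult_left_mono) auto
      also have "\<dots> = exp (- (a + b) * v n)" by (simp add: exp_add[symmetric] algebra_simps)
      also have "\<dots> \<le> exp (- c' * v n)"
        using mult_right_mono[of c' "a + b" "v n"] ab(3) elim by (simp add: algebra_simps)
      finally show ?case using elim by linarith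
    qed
    then show ?thesis using \<delta> by blast
  qed
  then have "\<forall>q\<in>C. \<exists>\<delta>. \<delta> > 0 \<and> (\<forall>\<^sub>F n in sequentially. ?P q \<delta> n \<le> exp (- c' * v n))" by blast
  from bchoice[OF this] obtain d where d: "\<And>q. q \<in> C \<Longrightarrow> d q > 0"
      "\<And>q. q \<in> C \<Longrightarrow> \<forall>\<^sub>F n in sequentially. ?P q (d q) n \<le> exp (- c' * v n)" by blast
  obtain T where T: "T \<subseteq> C" "finite T" "C \<subseteq> (\<Union>q\<in>T. ball q (d q))"
  proof (rule compactE_image[OF comp, of C "\<lambda>q. ball q (d q)"])
    show "C \<subseteq> (\<Union>q\<in>C. ball q (d q))" using d(1) by force
  qed auto
  \<comment> \<open>The element 1 keeps the minimum defined, and the summand 1 in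
    \<open>card T + 1\<close> keeps the constant positive, should \<open>T\<close> be empty.\<close>
  define \<delta> where "\<delta> = Min (insert 1 (d ` T))"
  have \<delta>: "\<delta> > 0" using T d(1) by (auto simp: \<delta>_def)
  have \<delta>d: "\<delta> \<le> d q" if "q \<in> T" for q unfolding \<delta>_def using T that by (intro Min_le) auto
  have ev1: "\<forall>\<^sub>F n in sequentially. (real (card T) + 1) * exp (- c' * v n) \<le> exp (- c * v n)"
    using c' by (intro eventually_mult_exp_le[OF vlim]) auto
  have ev2: "\<forall>\<^sub>F n in sequentially. \<forall>q\<in>T. ?P q (d q) n \<le> exp (- c' * v n)"
    using T d(2) by (intro eventually_ball_finite) auto
  from ev1 ev2 have "\<forall>\<^sub>F n in sequentially.
      \<P>(w in M n. Y n w \<in> ball y \<delta>) \<le> exp (- c * v n)"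
  proof eventually_elim
    case (elim n)
    interpret prob_space "M n" by (rule probM)
    have "prob {w \<in> space (M n). Y n w \<in> ball y \<delta>}
        \<le> prob (\<Union>q\<in>T. (GY_balls n q (d q) y (d q)))"
    proof (rule finite_measure_mono)
      show "{w \<in> space (M n). Y n w \<in> ball y \<delta>}
          \<subseteq> (\<Union>q\<in>T. (GY_balls n q (d q) y (d q)))"
      proof
        fix w assume w: "w \<in> {w \<in> space (M n). Y n w \<in> ball y \<delta>}"
        then have "G n w \<in> C" using GC by auto
        then obtain q where "q \<in> T" "G n w \<in> ball q (d q)" using T by blast
        then show "w \<in> (\<Union>q\<in>T. (GY_balls n q (d q) y (d q)))"
          using w \<delta>d by fastforce
      qed
      show "(\<Union>q\<in>T. (GY_balls n q (d q) y (d q))) \<in> events"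
        using T by (intro sets.finite_UN) (auto, measurable)
    qed
    also have "\<dots> \<le> (\<Sum>q\<in>T. ?P q (d q) n)"
      using T by (intro finite_measure_subadditive_finite) (auto, measurable)
    also have "\<dots> \<le> (\<Sum>q\<in>T. exp (- c' * v n))" using elim by (intro sum_mono) auto
    also have "\<dots> \<le> (real (card T) + 1) * exp (- c' * v n)" by simp
    also have "\<dots> \<le> exp (- c * v n)" by (rule elim(1))
    finally show ?case .
  qed
  then show "\<exists>\<delta>>0. \<forall>\<^sub>F n in sequentially.
      \<P>(w in M n. Y n w \<in> ball y \<delta>) \<le> exp (- c * v n)" using \<delta> by blast
qed

lemma compose_lower:
  assumes lo: "ldp_lower M G v I S" and I0: "\<And>q. 0 \<le> I q"
  shows "ldp_lower M Y v (\<lambda>y. INF q\<in>S. I q + step_rate \<gamma> \<Lambda> m y q) UNIV"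
  unfolding ldp_lower_def
proof (intro ballI allI impI)
  fix y c and \<epsilon> :: real
  assume c: "(INF q\<in>S. I q + step_rate \<gamma> \<Lambda> m y q) < ereal c" and \<epsilon>: "\<epsilon> > 0"
  then obtain q where q: "q \<in> S" "I q + step_rate \<gamma> \<Lambda> m y q < ereal c"
    unfolding INF_less_iff by blast
  obtain a b where ab: "I q < ereal a" "step_rate \<gamma> \<Lambda> m y q < ereal b" "a + b < c"
    using ereal_add_less_split[OF I0 step_rate_nonneg[OF q(1)] q(2)] by blast
  obtain \<delta> where \<delta>: "\<delta> > 0" and ev: "\<forall>\<^sub>F n in sequentially.
     exp (- b * v n) * measure (M n) (G_ball n q \<delta>)
     \<le> measure (M n) (GY_balls n q \<delta> y \<epsilon>)"
    using pair_lower[OF q(1) ab(2) \<epsilon>] by blast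
  have ev2: "\<forall>\<^sub>F n in sequentially. exp (- a * v n) \<le> measure (M n) (G_ball n q \<delta>)"
    using lo q(1) ab(1) \<delta> unfolding ldp_lower_def by blast
  have "\<forall>\<^sub>F n in sequentially. v n > 0" using vlim by (simp add: filterlim_at_top_dense)
  with ev ev2 show "\<forall>\<^sub>F n in sequentially.
      exp (- c * v n) \<le> \<P>(w in M n. Y n w \<in> ball y \<epsilon>)"
  proof eventually_elim
    case (elim n)
    interpret prob_space "M n" by (rule probM)
    have "exp (- c * v n) \<le> exp (- (a + b) * v n)"
      using mult_right_mono[of "a + b" c "v n"] ab(3) elim by (simp add: algebra_simps)
    also have "\<dots> = exp (- b * v n) * exp (- a * v n)" by (simp add: exp_add[symmetric] algebra_simps)
    also have "\<dots> \<le> exp (- b * v n) * prob (G_ball n q \<delta>)"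
      using elim by (intro mult_left_mono) auto
    also have "\<dots> \<le> prob (GY_balls n q \<delta> y \<epsilon>)" using elim by simp
    also have "\<dots> \<le> prob {w \<in> space (M n). Y n w \<in> ball y \<epsilon>}"
      by (intro finite_measure_mono) auto
    finally show ?case .
  qed
qed

end

section \<open>From local bounds to the large deviation principle\<close>

lemma nlog_le_iff:
  assumes "v > 0" "p \<ge> 0"
  shows "nlog v p \<le> ereal c \<longleftrightarrow> p \<le> exp (c * v)"
proof (cases "p = 0")
  case False
  then have "p > 0" using assms by simp
  then have "ln p \<le> c * v \<longleftrightarrow> p \<le> exp (c * v)" by (metis exp_le_cancel_iff exp_ln)
  then show ?thesis using False assms by (simp add: nlog_def pos_divide_le_eq)
qed (simp add: nlog_def)

lemma nlog_ge_iff: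
  assumes "v > 0" "p \<ge> 0"
  shows "ereal c \<le> nlog v p \<longleftrightarrow> exp (c * v) \<le> p"
proof (cases "p = 0")
  case False
  then have "p > 0" using assms by simp
  then have "c * v \<le> ln p \<longleftrightarrow> exp (c * v) \<le> p" by (metis exp_le_cancel_iff exp_ln)
  then show ?thesis using False assms by (simp add: nlog_def pos_le_divide_eq)
qed (simp add: nlog_def)

text \<open>The output layer is unbounded, so exponential tightness replaces the compact set that
  was available for the hidden layers.\<close>

locale local_ldp =
  fixes M :: "nat \<Rightarrow> 'b measure" and X :: "nat \<Rightarrow> 'b \<Rightarrow> 'c::euclidean_space"
    and v :: "nat \<Rightarrow> real" and I :: "'c \<Rightarrow> ereal"
  assumes prob: "\<And>n. prob_space (M n)" and meas: "\<And>n. X n \<in> borel_measurable (M n)"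
    and vlim: "filterlim v at_top sequentially" and I0: "\<And>z. 0 \<le> I z"
    and up: "ldp_upper M X v I UNIV" and lo: "ldp_lower M X v I UNIV"
    and tight: "\<And>c. \<exists>R. \<forall>\<^sub>F n in sequentially. \<P>(w in M n. R < norm (X n w)) \<le> exp (- c * v n)"
begin

abbreviation "P n C \<equiv> \<P>(w in M n. X n w \<in> C)"

lemma event: "C \<in> sets borel \<Longrightarrow> {w \<in> space (M n). X n w \<in> C} \<in> sets (M n)"
  using measurable_sets[OF meas[of n]] by (simp add: vimage_def Int_def conj_commute)

lemma P_mono: "C \<subseteq> D \<Longrightarrow> D \<in> sets borel \<Longrightarrow> P n C \<le> P n D"
  using event[of D n] prob_space.finite_measure[OF prob[of n]]
  by (auto intro!: finite_measure.finite_measure_mono)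

lemma vpos: "\<forall>\<^sub>F n in sequentially. v n > 0" using vlim by (simp add: filterlim_at_top_dense)

text \<open>If a point \<open>g'\<close> of the ball had cost at most \<open>c\<close>, the lower
  bound on a small ball around \<open>g'\<close> would contradict the upper bound on the ball around
  \<open>g\<close> that contains it. The midpoint of \<open>c\<close> and \<open>c'\<close> provides
  the strict gap.\<close>

lemma lsc:
  assumes "ereal c < I g"
  shows "\<exists>\<delta>>0. \<forall>g'\<in>ball g \<delta>. ereal c < I g'"
proof -
  obtain c' where c': "c < c'" "ereal c' < I g"
    using assms ereal_dense2 ereal_less_eq(3) less_ereal.simps(1) by metis
  then obtain \<delta> where d: "\<delta> > 0" "\<forall>\<^sub>F n in sequentially. P n (ball g \<delta>) \<le> exp (- c' * v n)"
    using up unfolding ldp_upper_def by blast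
  have "ereal c < I g'" if g': "g' \<in> ball g \<delta>" for g'
  proof (rule ccontr)
    assume "\<not> ereal c < I g'"
    then have "I g' < ereal ((c + c') / 2)" using c' by (simp add: not_less order.strict_trans1)
    moreover obtain \<delta>' where d': "\<delta>' > 0" "ball g' \<delta>' \<subseteq> ball g \<delta>"
      using g' openE[OF open_ball] by metis
    ultimately have "\<forall>\<^sub>F n in sequentially. exp (- ((c + c') / 2) * v n) \<le> P n (ball g' \<delta>')"
      using lo unfolding ldp_lower_def by blast
    with d(2) vpos have "\<forall>\<^sub>F n in sequentially. False"
    proof eventually_elim
      case (elim n)
      have "P n (ball g' \<delta>') \<le> P n (ball g \<delta>)" using d' by (intro P_mono) auto
      with elim have "exp (- ((c + c') / 2) * v n) \<le> exp (- c' * v n)" by linarith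
      then have "c' * v n \<le> (c + c') / 2 * v n" by simp
      then have "c' \<le> (c + c') / 2" using elim(2) mult_right_le_imp_le by blast
      then show False using c' by simp
    qed
    then show False by simp
  qed
  then show ?thesis using d by blast
qed

lemma closed_sublevel: "closed {z. I z \<le> c}"
proof -
  have "open {z. c < I z}"
  proof (rule openI)
    fix z assume z: "z \<in> {z. c < I z}"
    then obtain c1 where c1: "c < c1" "c1 < I z" using dense by blast
    show "\<exists>e>0. ball z e \<subseteq> {z. c < I z}"
    proof (cases c1)
      case (real r)
      then obtain \<delta> where "\<delta> > 0" "\<forall>g'\<in>ball z \<delta>. ereal r < I g'" using lsc c1 by blast
      then show ?thesis using c1 real by (intro exI[of _ \<delta>]) (auto intro: less_trans)
    next
      case MInf
      then show ?thesis using c1 by simp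
    next
      case PInf
      then show ?thesis using c1 by simp
    qed
  qed
  moreover have "- {z. I z \<le> c} = {z. c < I z}" by auto
  ultimately show ?thesis by (simp add: closed_def)
qed

text \<open>A point of cost at most \<open>c\<close> beyond radius R + 1 would put mass exp (-(c +
  1) v) into a unit ball lying in a tail of mass at most exp (-(c + 2) v).\<close>

lemma bounded_sublevel: "bounded {z. I z \<le> ereal c}"
proof -
  obtain R where R: "\<forall>\<^sub>F n in sequentially.
      \<P>(w in M n. R < norm (X n w)) \<le> exp (- (c + 2) * v n)"
    using tight by blast
  have "norm z \<le> R + 1" if z: "I z \<le> ereal c" for z
  proof (rule ccontr)
    assume nz: "\<not> norm z \<le> R + 1"
    have "I z < ereal (c + 1)" using z by (simp add: order.strict_trans1)
    then have "\<forall>\<^sub>F n in sequentially. exp (- (c + 1) * v n) \<le> P n (ball z 1)"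
      using lo zero_less_one unfolding ldp_lower_def by blast
    with R vpos have "\<forall>\<^sub>F n in sequentially. False"
    proof eventually_elim
      case (elim n)
      have "P n (ball z 1) \<le> P n {x. R < norm x}"
      proof (rule P_mono)
        show "ball z 1 \<subseteq> {x. R < norm x}"
        proof
          fix x assume "x \<in> ball z 1"
          then have "norm (z - x) < 1" by (simp add: dist_norm)
          then show "x \<in> {x. R < norm x}" using nz norm_triangle_ineq2[of z x] by auto
        qed
      qed (auto intro!: borel_open open_Collect_less continuous_intros)
      with elim have "exp (- (c + 1) * v n) \<le> exp (- (c + 2) * v n)"
        unfolding mem_Collect_eq by linarith
      then have "(c + 2) * v n \<le> (c + 1) * v n" by (simp add: algebra_simps)
      then show False using elim by (simp add: algebra_simps)
    qed
    then show False by simp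
  qed
  then show ?thesis by (intro boundedI[where B="R + 1"]) auto
qed

text \<open>Finitely many balls cover the part of \<open>C\<close> within radius \<open>R\<close>;
  the tail beyond it is the extra 1 in \<open>card T + 1\<close>.\<close>

lemma closed_bound:
  assumes C: "closed C" and c: "ereal c < (INF z\<in>C. I z)"
  shows "limsup (\<lambda>n. nlog (v n) (P n C)) \<le> - ereal c"
proof -
  obtain c' where c': "c < c'" "ereal c' < (INF z\<in>C. I z)"
    using c ereal_dense2 ereal_less_eq(3) less_ereal.simps(1) by metis
  obtain R where R: "\<forall>\<^sub>F n in sequentially.
      \<P>(w in M n. R < norm (X n w)) \<le> exp (- c' * v n)"
    using tight by blast
  have "\<forall>z\<in>C. \<exists>\<delta>. \<delta> > 0 \<and> (\<forall>\<^sub>F n in sequentially. P n (ball z \<delta>) \<le> exp (- c' * v n))"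
  proof
    fix z assume "z \<in> C"
    then have "ereal c' < I z" using c'(2) by (meson INF_lower less_le_trans)
    then show "\<exists>\<delta>. \<delta> > 0 \<and> (\<forall>\<^sub>F n in sequentially. P n (ball z \<delta>) \<le> exp (- c' * v n))"
      using up unfolding ldp_upper_def by blast
  qed
  from bchoice[OF this] obtain d where d: "\<And>z. z \<in> C \<Longrightarrow> d z > 0"
      "\<And>z. z \<in> C \<Longrightarrow> \<forall>\<^sub>F n in sequentially. P n (ball z (d z)) \<le> exp (- c' * v n)" by blast
  have comp: "compact (C \<inter> cball 0 R)" using C by (intro closed_Int_compact) auto
  obtain T where T: "T \<subseteq> C \<inter> cball 0 R" "finite T" "C \<inter> cball 0 R \<subseteq> (\<Union>z\<in>T. ball z (d z))"
  proof (rule compactE_image[OF comp, of "C \<inter> cball 0 R" "\<lambda>z. ball z (d z)"])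
    show "C \<inter> cball 0 R \<subseteq> (\<Union>z\<in>C \<inter> cball 0 R. ball z (d z))" using d(1) by force
  qed auto
  have ev1: "\<forall>\<^sub>F n in sequentially. (real (card T) + 1) * exp (- c' * v n) \<le> exp (- c * v n)"
    using c' by (intro eventually_mult_exp_le[OF vlim]) auto
  have ev2: "\<forall>\<^sub>F n in sequentially. \<forall>z\<in>T. P n (ball z (d z)) \<le> exp (- c' * v n)"
    using T d(2) by (intro eventually_ball_finite) auto
  from ev1 ev2 R vpos have "\<forall>\<^sub>F n in sequentially. nlog (v n) (P n C) \<le> - ereal c"
  proof eventually_elim
    case (elim n)
    interpret prob_space "M n" by (rule prob)
    have Rm: "{w \<in> space (M n). R < norm (X n w)} \<in> events"
      using event[of "{x. R < norm x}" n] by (auto intro!: borel_open open_Collect_less continuous_intros)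
    have bm: "{w \<in> space (M n). X n w \<in> ball z (d z)} \<in> events" for z by (rule event) simp
    have Um: "(\<Union>z\<in>T. {w \<in> space (M n). X n w \<in> ball z (d z)}) \<in> events"
      using T bm by (intro sets.finite_UN) auto
    have "P n C \<le> prob ((\<Union>z\<in>T. {w \<in> space (M n). X n w \<in> ball z (d z)}) \<union> {w \<in> space (M n). R < norm (X n w)})"
    proof (rule finite_measure_mono)
      show "{w \<in> space (M n). X n w \<in> C} \<subseteq>
         (\<Union>z\<in>T. {w \<in> space (M n). X n w \<in> ball z (d z)}) \<union> {w \<in> space (M n). R < norm (X n w)}"
      proof
        fix w assume w: "w \<in> {w \<in> space (M n). X n w \<in> C}"
        show "w \<in> (\<Union>z\<in>T. {w \<in> space (M n). X n w \<in> ball z (d z)}) \<union> {w \<in> space (M n). R < norm (X n w)}"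
        proof (cases "R < norm (X n w)")
          case False
          then have "X n w \<in> C \<inter> cball 0 R" using w by auto
          then have "X n w \<in> (\<Union>z\<in>T. ball z (d z))" using T(3) by blast
          then show ?thesis using w by auto
        qed (use w in auto)
      qed
    qed (use Rm Um in auto)
    also have "\<dots> \<le> prob (\<Union>z\<in>T. {w \<in> space (M n). X n w \<in> ball z (d z)}) + prob {w \<in> space (M n). R < norm (X n w)}"
      by (rule measure_Un_le[OF Um Rm])
    also have "\<dots> \<le> (\<Sum>z\<in>T. P n (ball z (d z))) + exp (- c' * v n)"
      using T bm elim by (intro add_mono finite_measure_subadditive_finite) auto
    also have "\<dots> \<le> (\<Sum>z\<in>T. exp (- c' * v n)) + exp (- c' * v n)"
      using elim by (intro add_right_mono sum_mono) auto
    also have "\<dots> = (real (card T) + 1) * exp (- c' * v n)" by (simp add: algebra_simps)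
    also have "\<dots> \<le> exp (- c * v n)" by (rule elim(1))
    finally show ?case using nlog_le_iff[of "v n" "P n C" "- c"] elim by simp
  qed
  then show ?thesis by (rule Limsup_bounded)
qed

lemma open_bound:
  assumes U: "open U" and c: "(INF z\<in>U. I z) < ereal c"
  shows "- ereal c \<le> liminf (\<lambda>n. nlog (v n) (P n U))"
proof -
  obtain z where z: "z \<in> U" "I z < ereal c" using c unfolding INF_less_iff by blast
  obtain \<delta> where d: "\<delta> > 0" "ball z \<delta> \<subseteq> U" using openE[OF U z(1)] by blast
  have "\<forall>\<^sub>F n in sequentially. exp (- c * v n) \<le> P n (ball z \<delta>)"
    using lo z d unfolding ldp_lower_def by blast
  with vpos have "\<forall>\<^sub>F n in sequentially. - ereal c \<le> nlog (v n) (P n U)"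
  proof eventually_elim
    case (elim n)
    have "P n (ball z \<delta>) \<le> P n U" using d U by (intro P_mono) auto
    then show ?case using elim nlog_ge_iff[of "v n" "P n U" "- c"] by simp
  qed
  then show ?thesis by (rule Liminf_bounded)
qed

lemma rate_function: "rate_function I"
  unfolding rate_function_def using I0 closed_sublevel by blast

theorem LDP: "LDP M X v I"
  unfolding LDP_def
proof (intro conjI allI impI vlim rate_function)
  fix C :: "'c set" assume C: "closed C"
  show "limsup (\<lambda>n. nlog (v n) (P n C)) \<le> - (INF z\<in>C. I z)"
  proof (rule ccontr)
    assume "\<not> ?thesis"
    then have "- (INF z\<in>C. I z) < limsup (\<lambda>n. nlog (v n) (P n C))" by simp
    then obtain a where a: "- (INF z\<in>C. I z) < ereal a" "ereal a < limsup (\<lambda>n. nlog (v n) (P n C))"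
      using ereal_dense2 by blast
    then have "ereal (- a) < (INF z\<in>C. I z)"
      by (metis ereal_uminus_less_reorder uminus_ereal.simps(1))
    from closed_bound[OF C this] a(2) show False by simp
  qed
next
  fix U :: "'c set" assume U: "open U"
  show "- (INF z\<in>U. I z) \<le> liminf (\<lambda>n. nlog (v n) (P n U))"
  proof (rule ccontr)
    assume "\<not> ?thesis"
    then have "liminf (\<lambda>n. nlog (v n) (P n U)) < - (INF z\<in>U. I z)" by simp
    then obtain a where a: "ereal a < - (INF z\<in>U. I z)" "liminf (\<lambda>n. nlog (v n) (P n U)) < ereal a"
      using ereal_dense2 by blast
    then have "(INF z\<in>U. I z) < ereal (- a)"
      by (metis ereal_less_uminus_reorder uminus_ereal.simps(1))
    from open_bound[OF U this] a(2) show False by simp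
  qed
qed

theorem good: "good_rate_function I"
  unfolding good_rate_function_def
  using rate_function closed_sublevel bounded_sublevel by (simp add: compact_eq_bounded_closed)

end

section \<open>Cumulants of the features\<close>

lemma exp_le_quadratic:
  fixes x B :: real
  assumes "\<bar>x\<bar> \<le> B"
  shows "exp x \<le> 1 + x + x\<^sup>2 * exp B"
proof -
  obtain t where t: "\<bar>t\<bar> \<le> \<bar>x\<bar>" "exp x = (\<Sum>m<2. x ^ m / fact m) + exp t / fact 2 * x ^ 2"
    using Maclaurin_exp_le[of x 2] by blast
  have "exp t \<le> exp B" using t assms by simp
  then have "exp t / 2 * x\<^sup>2 \<le> exp B * x\<^sup>2"
    using exp_gt_zero[of B] by (intro mult_right_mono) (linarith, simp)
  then show ?thesis using t(2) by (simp add: numeral_2_eq_2 mult.commute)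
qed

text \<open>\<open>m\<close> is the mean under the exponentially tilted law. No differentiation
  under the integral takes place: the lower gradient inequality integrates 1 + x \<le> exp x at x =
  h.\<phi> - h.m, and the upper one integrates the quadratic bound for exp (h.\<phi>), where
  |h.\<phi>| \<le> B since \<open>h\<close> has length at most 1.\<close>

lemma (in prob_space) smooth_cgf_bounded:
  fixes \<phi> :: "'a \<Rightarrow> 'e::euclidean_space"
  assumes [measurable]: "\<phi> \<in> borel_measurable M" and B: "\<And>w. norm (\<phi> w) \<le> B"
  defines "m \<equiv> \<lambda>\<eta>. (\<integral>w. exp (\<eta> \<bullet> \<phi> w) *\<^sub>R \<phi> w \<partial>M) /\<^sub>R (\<integral>w. exp (\<eta> \<bullet> \<phi> w) \<partial>M)"
  shows "smooth_cgf (\<lambda>\<eta>. ln (\<integral>w. exp (\<eta> \<bullet> \<phi> w) \<partial>M)) m (B\<^sup>2 * exp B)"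
proof -
  have B0: "B \<ge> 0" using B[of undefined] norm_ge_zero order_trans by blast
  have ip: "\<bar>\<eta> \<bullet> \<phi> w\<bar> \<le> norm \<eta> * B" for \<eta> w
    using Cauchy_Schwarz_ineq2[of \<eta> "\<phi> w"] mult_left_mono[OF B[of w], of "norm \<eta>"] by simp
  have eb: "exp (\<eta> \<bullet> \<phi> w) \<le> exp (norm \<eta> * B)" for \<eta> w using ip[of \<eta> w] by simp
  define E where "E \<eta> = (\<integral>w. exp (\<eta> \<bullet> \<phi> w) \<partial>M)" for \<eta>
  have int: "integrable M (\<lambda>w. exp (\<eta> \<bullet> \<phi> w))" for \<eta>
    by (rule integrable_const_bound[where B="exp (norm \<eta> * B)"]) (use eb in auto)
  have intv: "integrable M (\<lambda>w. exp (\<eta> \<bullet> \<phi> w) *\<^sub>R \<phi> w)" for \<eta>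
    by (rule integrable_const_bound[where B="exp (norm \<eta> * B) * B"])
       (use eb B B0 in \<open>auto intro!: mult_mono\<close>)
  have E: "E \<eta> > 0" for \<eta>
  proof -
    have "exp (- (norm \<eta> * B)) = (\<integral>w. exp (- (norm \<eta> * B)) \<partial>M)" by (simp add: prob_space)
    also have "\<dots> \<le> E \<eta>" unfolding E_def
      by (intro integral_mono int) (use ip[of \<eta>] in \<open>auto simp: abs_le_iff minus_le_iff\<close>)
    finally show ?thesis by (rule less_le_trans[rotated]) simp
  qed
  have hm: "(\<integral>w. exp (\<eta> \<bullet> \<phi> w) * (h \<bullet> \<phi> w) \<partial>M) = E \<eta> * (h \<bullet> m \<eta>)" for \<eta> h
  proof -
    have "(\<integral>w. exp (\<eta> \<bullet> \<phi> w) * (h \<bullet> \<phi> w) \<partial>M) = (\<integral>w. h \<bullet> (exp (\<eta> \<bullet> \<phi> w) *\<^sub>R \<phi> w) \<partial>M)" by simp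
    also have "\<dots> = h \<bullet> (\<integral>w. exp (\<eta> \<bullet> \<phi> w) *\<^sub>R \<phi> w \<partial>M)"
      by (rule integral_inner_right) (use intv in auto)
    finally show ?thesis using E[of \<eta>] by (simp add: m_def E_def)
  qed
  have inth: "integrable M (\<lambda>w. exp (\<eta> \<bullet> \<phi> w) * (h \<bullet> \<phi> w))" for \<eta> h
    using integrable_inner_right[of h M "\<lambda>w. exp (\<eta> \<bullet> \<phi> w) *\<^sub>R \<phi> w"] intv[of \<eta>] by simp
  have lower: "ln (E \<eta>) + h \<bullet> m \<eta> \<le> ln (E (\<eta> + h))" for \<eta> h
  proof -
    let ?a = "h \<bullet> m \<eta>"
    have "exp ?a * E \<eta> = (\<integral>w. exp ?a * (exp (\<eta> \<bullet> \<phi> w) + (exp (\<eta> \<bullet> \<phi> w) * (h \<bullet> \<phi> w) - exp (\<eta> \<bullet> \<phi> w) * ?a)) \<partial>M)"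
      using int inth by (simp add: hm E_def[symmetric])
    also have "\<dots> \<le> E (\<eta> + h)" unfolding E_def
    proof (rule integral_mono[OF _ int])
      show "integrable M (\<lambda>w. exp ?a * (exp (\<eta> \<bullet> \<phi> w) + (exp (\<eta> \<bullet> \<phi> w) * (h \<bullet> \<phi> w) - exp (\<eta> \<bullet> \<phi> w) * ?a)))"
        using int inth by simp
      fix w
      have "exp ?a * exp (\<eta> \<bullet> \<phi> w) * (1 + (h \<bullet> \<phi> w - ?a)) \<le> exp ?a * exp (\<eta> \<bullet> \<phi> w) * exp (h \<bullet> \<phi> w - ?a)"
        by (intro mult_left_mono exp_ge_add_one_self) auto
      also have "\<dots> = exp ((\<eta> + h) \<bullet> \<phi> w)" by (simp add: exp_add[symmetric] inner_add)
      finally show "exp ?a * (exp (\<eta> \<bullet> \<phi> w) + (exp (\<eta> \<bullet> \<phi> w) * (h \<bullet> \<phi> w) - exp (\<eta> \<bullet> \<phi> w) * ?a)) \<le> exp ((\<eta> + h) \<bullet> \<phi> w)"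
        by (simp add: algebra_simps)
    qed
    finally have "ln (exp ?a * E \<eta>) \<le> ln (E (\<eta> + h))" using E[of \<eta>] E[of "\<eta> + h"] by simp
    then show ?thesis using E[of \<eta>] by (simp add: ln_mult)
  qed
  have upper: "ln (E (\<eta> + h)) \<le> ln (E \<eta>) + h \<bullet> m \<eta> + B\<^sup>2 * exp B * (norm h)\<^sup>2" if h: "norm h \<le> 1" for \<eta> h
  proof -
    let ?q = "B\<^sup>2 * exp B * (norm h)\<^sup>2"
    have "E (\<eta> + h) \<le> (\<integral>w. exp (\<eta> \<bullet> \<phi> w) + exp (\<eta> \<bullet> \<phi> w) * (h \<bullet> \<phi> w) + exp (\<eta> \<bullet> \<phi> w) * ?q \<partial>M)"
      unfolding E_def
    proof (rule integral_mono[OF int])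
      show "integrable M (\<lambda>w. exp (\<eta> \<bullet> \<phi> w) + exp (\<eta> \<bullet> \<phi> w) * (h \<bullet> \<phi> w) + exp (\<eta> \<bullet> \<phi> w) * ?q)"
        using int inth by simp
      fix w
      have "\<bar>h \<bullet> \<phi> w\<bar> \<le> 1 * B" using ip[of h w] mult_right_mono[OF h B0] by linarith
      then have "exp (h \<bullet> \<phi> w) \<le> 1 + h \<bullet> \<phi> w + (h \<bullet> \<phi> w)\<^sup>2 * exp B" by (intro exp_le_quadratic) simp
      also have "(h \<bullet> \<phi> w)\<^sup>2 \<le> (norm h * B)\<^sup>2"
        using ip[of h w] by (metis abs_ge_zero power2_abs power_mono)
      then have "1 + h \<bullet> \<phi> w + (h \<bullet> \<phi> w)\<^sup>2 * exp B \<le> 1 + h \<bullet> \<phi> w + ?q"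
        by (simp add: power_mult_distrib mult_ac)
      finally have "exp (\<eta> \<bullet> \<phi> w) * exp (h \<bullet> \<phi> w) \<le> exp (\<eta> \<bullet> \<phi> w) * (1 + h \<bullet> \<phi> w + ?q)"
        by (intro mult_left_mono) auto
      then show "exp ((\<eta> + h) \<bullet> \<phi> w) \<le> exp (\<eta> \<bullet> \<phi> w) + exp (\<eta> \<bullet> \<phi> w) * (h \<bullet> \<phi> w) + exp (\<eta> \<bullet> \<phi> w) * ?q"
        by (simp add: inner_add exp_add algebra_simps)
    qed
    also have "\<dots> = E \<eta> * (1 + (h \<bullet> m \<eta> + ?q))"
    proof -
      have "(\<integral>w. exp (\<eta> \<bullet> \<phi> w) + exp (\<eta> \<bullet> \<phi> w) * (h \<bullet> \<phi> w) + exp (\<eta> \<bullet> \<phi> w) * ?q \<partial>M)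
          = E \<eta> + E \<eta> * (h \<bullet> m \<eta>) + E \<eta> * ?q"
        using int inth by (simp add: hm E_def[symmetric])
      then show ?thesis by (simp add: algebra_simps)
    qed
    also have "\<dots> \<le> E \<eta> * exp (h \<bullet> m \<eta> + ?q)"
      using E[of \<eta>] by (intro mult_left_mono exp_ge_add_one_self) auto
    finally have "ln (E (\<eta> + h)) \<le> ln (E \<eta> * exp (h \<bullet> m \<eta> + ?q))" using E[of \<eta>] E[of "\<eta> + h"] by simp
    then show ?thesis using E[of \<eta>] by (simp add: ln_mult)
  qed
  show ?thesis unfolding smooth_cgf_def E_def[symmetric]
    using lower upper by (auto simp: E_def prob_space)
qed

text \<open>Makes the quadratic exponent in the definition of \<open>kappa\<close> a linear
  functional of one bounded matrix-valued variable, so that \<open>kappa\<close> becomes an ordinary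
  cumulant generating function.\<close>

definition feature_mat :: "(real \<Rightarrow> real) \<Rightarrow> ('a::finite \<Rightarrow> real) \<Rightarrow> real^'a^'a" where
  "feature_mat \<sigma> z = (\<chi> \<alpha> \<beta>. \<sigma> (z \<alpha>) * \<sigma> (z \<beta>))"

lemma inner_feature_mat:
  "\<eta> \<bullet> feature_mat \<sigma> z = (\<Sum>\<alpha>\<in>UNIV. \<Sum>\<beta>\<in>UNIV. \<eta> $ \<alpha> $ \<beta> * \<sigma> (z \<alpha>) * \<sigma> (z \<beta>))"
  by (simp add: inner_vec_def feature_mat_def mult.assoc)

lemma norm_feature_mat_le:
  fixes B :: real
  assumes "\<And>t. \<bar>\<sigma> t\<bar> \<le> B"
  shows "norm (feature_mat \<sigma> z :: real^'a^'a::finite) \<le> CARD('a) * (CARD('a) * B\<^sup>2)"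
proof -
  have "norm (feature_mat \<sigma> z $ \<alpha>) \<le> CARD('a) * B\<^sup>2" for \<alpha>
  proof -
    have "norm (feature_mat \<sigma> z $ \<alpha>) \<le> (\<Sum>\<beta>\<in>UNIV. norm (feature_mat \<sigma> z $ \<alpha> $ \<beta>))"
      unfolding norm_vec_def by (rule L2_set_le_sum) simp
    also have "\<dots> \<le> (\<Sum>\<beta>\<in>(UNIV::'a set). B\<^sup>2)"
      using assms by (intro sum_mono)
        (auto simp: feature_mat_def abs_mult power2_eq_square intro!: mult_mono intro: order_trans[OF abs_ge_zero])
    finally show ?thesis by simp
  qed
  then have "(\<Sum>\<alpha>\<in>UNIV. norm (feature_mat \<sigma> z $ \<alpha>)) \<le> CARD('a) * (CARD('a) * B\<^sup>2)"
    using sum_bounded_above[of UNIV "\<lambda>\<alpha>. norm (feature_mat \<sigma> z $ \<alpha>)" "CARD('a) * B\<^sup>2"] by simp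
  moreover have "norm (feature_mat \<sigma> z) \<le> (\<Sum>\<alpha>\<in>UNIV. norm (feature_mat \<sigma> z $ \<alpha>))"
    unfolding norm_vec_def[of "feature_mat \<sigma> z"] by (rule L2_set_le_sum) simp
  ultimately show ?thesis by linarith
qed

lemma abs_inner_feature_mat_le:
  fixes B :: real and \<eta> :: "real^'a^'a::finite"
  assumes "\<And>t. \<bar>\<sigma> t\<bar> \<le> B"
  shows "\<bar>\<eta> \<bullet> feature_mat \<sigma> z\<bar> \<le> norm \<eta> * (CARD('a) * (CARD('a) * B\<^sup>2))"
  using Cauchy_Schwarz_ineq2[of \<eta> "feature_mat \<sigma> z"]
    mult_left_mono[OF norm_feature_mat_le[of \<sigma> B z, OF assms] norm_ge_zero[of \<eta>]] by linarith

section \<open>The function \<open>kappa\<close>: gradient inequalities and continuity in the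
  covariance\<close>

lemma prob_space_std_gauss_vec: "prob_space std_gauss_vec"
  unfolding std_gauss_vec_def
  by (intro prob_space_PiM prob_space_normal_density) simp

lemma measurable_std_gauss_component [measurable]: "(\<lambda>N. N \<gamma>) \<in> borel_measurable std_gauss_vec"
proof -
  have "(\<lambda>N. N \<gamma>) \<in> measurable std_gauss_vec (density lborel (\<lambda>t. ennreal (std_normal_density t)))"
    unfolding std_gauss_vec_def by (rule measurable_component_singleton) simp
  then show ?thesis by (simp cong: measurable_cong_sets)
qed

lemma measurable_gproj [measurable]: "gproj q \<alpha> \<in> borel_measurable std_gauss_vec"
  unfolding gproj_def[abs_def] by measurable

lemma kappa_eq: "kappa \<sigma> \<eta> q = ln (\<integral>N. exp (\<eta> \<bullet> feature_mat \<sigma> (\<lambda>\<alpha>. gproj q \<alpha> N)) \<partial>std_gauss_vec)"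
  by (simp add: kappa_def inner_feature_mat)

lemma measurable_feature_mat:
  assumes "continuous_on UNIV \<sigma>"
  shows "(\<lambda>N. feature_mat \<sigma> (\<lambda>\<alpha>. gproj q \<alpha> N)) \<in> borel_measurable std_gauss_vec"
proof -
  have [measurable]: "\<sigma> \<in> borel_measurable borel" using assms by (rule borel_measurable_continuous_onI)
  have "(\<lambda>N. feature_mat \<sigma> (\<lambda>\<alpha>. gproj q \<alpha> N) \<bullet> b) \<in> borel_measurable std_gauss_vec" for b
    unfolding inner_commute[of _ b] inner_feature_mat by measurable
  then show ?thesis by (intro borel_measurable_euclidean_space[THEN iffD2]) auto
qed

text \<open>The constant is uniform in \<open>q\<close> because the bound on \<sigma> is. The value
  of the gradient at 0 identifies the cost \<open>Delta\<close> of an infinite width ratio with the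
  corresponding branch of \<open>step_rate\<close>.\<close>

lemma kappa_smooth_cgf:
  fixes B :: real
  assumes \<sigma>: "continuous_on UNIV \<sigma>" and B: "\<And>t. \<bar>\<sigma> t\<bar> \<le> B"
  obtains m K where "\<And>q::real^'a^'a::finite. smooth_cgf (\<lambda>\<eta>. kappa \<sigma> \<eta> q) (m q) K" "\<And>q. m q 0 = ymat \<sigma> q"
proof -
  interpret prob_space "std_gauss_vec :: ('a \<Rightarrow> real) measure" by (rule prob_space_std_gauss_vec)
  let ?\<phi> = "\<lambda>q::real^'a^'a. \<lambda>N. feature_mat \<sigma> (\<lambda>\<alpha>. gproj q \<alpha> N)"
  let ?B = "CARD('a) * (CARD('a) * B\<^sup>2)"
  define m where "m q = (\<lambda>\<eta>. (\<integral>w. exp (\<eta> \<bullet> ?\<phi> q w) *\<^sub>R ?\<phi> q w \<partial>std_gauss_vec) /\<^sub>R (\<integral>w. exp (\<eta> \<bullet> ?\<phi> q w) \<partial>std_gauss_vec))" for q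
  have "smooth_cgf (\<lambda>\<eta>. kappa \<sigma> \<eta> q) (m q) (?B\<^sup>2 * exp ?B)" for q
    unfolding kappa_eq m_def
    by (rule smooth_cgf_bounded[OF measurable_feature_mat[OF \<sigma>] norm_feature_mat_le[of \<sigma> B, OF B]])
  moreover have "m q 0 = ymat \<sigma> q" for q
  proof -
    have i: "integrable std_gauss_vec (?\<phi> q)"
      by (rule integrable_const_bound[where B="?B"])
         (use norm_feature_mat_le[of \<sigma> B, OF B] measurable_feature_mat[OF \<sigma>] in auto)
    have "m q 0 = (\<integral>N. ?\<phi> q N \<partial>std_gauss_vec)" by (simp add: m_def prob_space)
    also have "\<dots> = ymat \<sigma> q"
    proof (rule vec_eq_iff[THEN iffD2], rule allI, rule vec_eq_iff[THEN iffD2], rule allI)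
      fix \<alpha> \<beta>
      have bl: "bounded_linear (\<lambda>A::real^'a^'a. A $ \<alpha> $ \<beta>)"
        by (intro bounded_linear_compose[OF bounded_linear_vec_nth] bounded_linear_vec_nth)
      show "(\<integral>N. ?\<phi> q N \<partial>std_gauss_vec) $ \<alpha> $ \<beta> = ymat \<sigma> q $ \<alpha> $ \<beta>"
        using integral_bounded_linear[OF bl i] by (simp add: ymat_def feature_mat_def)
    qed
    finally show ?thesis .
  qed
  ultimately show ?thesis by (rule that)
qed

text \<open>Boundedness of \<sigma> makes the expectation finite and bounded away from 0, so neither
  the Bochner integral nor \<open>ln\<close> takes a default value.\<close>

lemma exp_kappa:
  fixes B :: real and q :: "real^'a^'a::finite"
  assumes \<sigma>: "continuous_on UNIV \<sigma>" and B: "\<And>t. \<bar>\<sigma> t\<bar> \<le> B"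
  shows "exp (kappa \<sigma> \<eta> q) = (\<integral>N. exp (\<eta> \<bullet> feature_mat \<sigma> (\<lambda>\<alpha>. gproj q \<alpha> N)) \<partial>std_gauss_vec)" (is "_ = ?E")
    and "integrable std_gauss_vec (\<lambda>N. exp (\<eta> \<bullet> feature_mat \<sigma> (\<lambda>\<alpha>. gproj q \<alpha> N)))"
proof -
  interpret prob_space "std_gauss_vec :: ('a \<Rightarrow> real) measure" by (rule prob_space_std_gauss_vec)
  let ?\<phi> = "\<lambda>N. feature_mat \<sigma> (\<lambda>\<alpha>. gproj q \<alpha> N)"
  let ?B = "norm \<eta> * (CARD('a) * (CARD('a) * B\<^sup>2))"
  note ip = abs_inner_feature_mat_le[of \<sigma> B \<eta>, OF B]
  show int: "integrable std_gauss_vec (\<lambda>N. exp (\<eta> \<bullet> ?\<phi> N))"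
    by (rule integrable_const_bound[where B="exp ?B"])
      (use ip measurable_feature_mat[OF \<sigma>, of q] in \<open>auto simp: abs_le_iff\<close>)
  have "exp (- ?B) = (\<integral>N. exp (- ?B) \<partial>(std_gauss_vec::('a \<Rightarrow> real) measure))" by (simp add: prob_space)
  also have "\<dots> \<le> ?E"
    by (intro integral_mono int) (use ip in \<open>auto simp: abs_le_iff minus_le_iff\<close>)
  finally have "?E > 0" by (rule less_le_trans[rotated]) simp
  then show "exp (kappa \<sigma> \<eta> q) = ?E" by (simp add: kappa_eq)
qed

text \<open>For a fixed Gaussian vector the projections depend on \<open>q\<close> through its root
  alone, whose continuity gives pointwise convergence; boundedness of \<sigma> gives a constant
  dominating function.\<close>

lemma continuous_on_kappa:
  fixes B :: real
  assumes \<sigma>: "continuous_on UNIV \<sigma>" and B: "\<And>t. \<bar>\<sigma> t\<bar> \<le> B"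
  shows "continuous_on {q::real^'a^'a::finite. psd_mat q} (\<lambda>q. kappa \<sigma> \<eta> q)"
proof -
  interpret prob_space "std_gauss_vec :: ('a \<Rightarrow> real) measure" by (rule prob_space_std_gauss_vec)
  let ?\<phi> = "\<lambda>q::real^'a^'a. \<lambda>N. feature_mat \<sigma> (\<lambda>\<alpha>. gproj q \<alpha> N)"
  let ?B = "norm \<eta> * (CARD('a) * (CARD('a) * B\<^sup>2))"
  note ip = abs_inner_feature_mat_le[of \<sigma> B \<eta>, OF B]
  note int = exp_kappa(2)[OF \<sigma> B]
  have "continuous_on {q. psd_mat q} (\<lambda>q. \<integral>N. exp (\<eta> \<bullet> ?\<phi> q N) \<partial>std_gauss_vec)"
    unfolding continuous_on_sequentially comp_def
  proof (intro allI ballI impI)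
    fix u :: "nat \<Rightarrow> real^'a^'a" and q
    assume q: "q \<in> {q. psd_mat q}" and u: "(\<forall>n. u n \<in> {q. psd_mat q}) \<and> u \<longlonglongrightarrow> q"
    have s: "(\<lambda>n. psd_sqrt (u n)) \<longlonglongrightarrow> psd_sqrt q"
      using continuous_on_psd_sqrt q u unfolding continuous_on_sequentially comp_def by blast
    show "(\<lambda>n. \<integral>N. exp (\<eta> \<bullet> ?\<phi> (u n) N) \<partial>std_gauss_vec) \<longlonglongrightarrow> (\<integral>N. exp (\<eta> \<bullet> ?\<phi> q N) \<partial>std_gauss_vec)"
    proof (rule integral_dominated_convergence[where w="\<lambda>_. exp ?B"])
      have "(\<lambda>n. exp (\<eta> \<bullet> ?\<phi> (u n) N)) \<longlonglongrightarrow> exp (\<eta> \<bullet> ?\<phi> q N)" for N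
      proof -
        have "(\<lambda>n. gproj (u n) \<alpha> N) \<longlonglongrightarrow> gproj q \<alpha> N" for \<alpha>
          unfolding gproj_def by (intro tendsto_intros tendsto_vec_nth s)
        then have "(\<lambda>n. \<sigma> (gproj (u n) \<alpha> N)) \<longlonglongrightarrow> \<sigma> (gproj q \<alpha> N)" for \<alpha>
          using continuous_on_tendsto_compose[OF \<sigma>] by auto
        then show ?thesis unfolding inner_feature_mat by (intro tendsto_intros)
      qed
      then show "AE N in std_gauss_vec. (\<lambda>n. exp (\<eta> \<bullet> ?\<phi> (u n) N)) \<longlonglongrightarrow> exp (\<eta> \<bullet> ?\<phi> q N)" by simp
      show "AE N in std_gauss_vec. norm (exp (\<eta> \<bullet> ?\<phi> (u n) N)) \<le> exp ?B" for n
        using ip by (auto simp: abs_le_iff)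
    qed (auto intro!: borel_measurable_integrable int)
  qed
  then have "continuous_on {q. psd_mat q} (\<lambda>q. ln (exp (kappa \<sigma> \<eta> q)))"
    unfolding exp_kappa(1)[OF \<sigma> B, symmetric] by (intro continuous_on_ln) auto
  then show ?thesis by simp
qed

section \<open>Uniqueness of Gaussian laws\<close>

text \<open>Both have the same measurable sets; \<open>pi_lborel\<close> carries Lebesgue measure,
  while \<open>pi_borel\<close> is used only for its sigma-algebra. Functions replace vectors here
  because \<open>std_gauss_vec\<close> is a product measure.\<close>

abbreviation pi_borel :: "('a \<Rightarrow> real) measure" where "pi_borel \<equiv> Pi\<^sub>M UNIV (\<lambda>_. borel)"
abbreviation pi_lborel :: "('a \<Rightarrow> real) measure" where "pi_lborel \<equiv> Pi\<^sub>M UNIV (\<lambda>_. lborel)"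

lemma iexp_integrable_prob: "prob_space M \<Longrightarrow> f \<in> borel_measurable M \<Longrightarrow> integrable M (\<lambda>x. iexp (f x :: real))"
  by (rule finite_measure.integrable_const_bound[where B=1])
     (auto simp: prob_space.finite_measure)

lemma char_std_gauss_vec:
  "(\<integral>N. iexp (\<Sum>\<alpha>\<in>UNIV. w \<alpha> * N \<alpha>) \<partial>(std_gauss_vec :: ('a::finite \<Rightarrow> real) measure))
    = complex_of_real (exp (- (\<Sum>\<alpha>\<in>UNIV. (w \<alpha>)\<^sup>2) / 2))"
proof -
  let ?n = "density lborel (\<lambda>t. ennreal (std_normal_density t))"
  interpret n: prob_space ?n by (rule prob_space_normal_density) simp
  interpret product_sigma_finite "\<lambda>_::'a. ?n" ..
  have "(\<integral>N. iexp (\<Sum>\<alpha>\<in>UNIV. w \<alpha> * N \<alpha>) \<partial>(std_gauss_vec :: ('a \<Rightarrow> real) measure))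
      = (\<integral>N. (\<Prod>\<alpha>\<in>UNIV. iexp (w \<alpha> * N \<alpha>)) \<partial>(\<Pi>\<^sub>M \<alpha>\<in>(UNIV::'a set). ?n))"
    unfolding std_gauss_vec_def by (simp add: sum_distrib_left exp_sum)
  also have "\<dots> = (\<Prod>\<alpha>\<in>UNIV. \<integral>t. iexp (w \<alpha> * t) \<partial>?n)"
    by (rule product_integral_prod) (simp, intro iexp_integrable_prob n.prob_space_axioms, simp)
  also have "\<dots> = (\<Prod>\<alpha>\<in>UNIV. complex_of_real (exp (- (w \<alpha>)\<^sup>2 / 2)))"
    using char_std_normal_distribution by (simp add: char_def fun_eq_iff)
  also have "\<dots> = complex_of_real (exp (- (\<Sum>\<alpha>\<in>UNIV. (w \<alpha>)\<^sup>2) / 2))"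
    by (simp add: exp_sum[symmetric] sum_negf sum_divide_distrib del: of_real_exp)
       (simp add: of_real_prod[symmetric] exp_sum[symmetric] sum_negf sum_divide_distrib del: of_real_prod of_real_exp)
  finally show ?thesis .
qed

text \<open>Both sides are identified, by their values on boxes, with the product of the
  one-dimensional normal laws of mean \<open>z \<alpha>\<close> and standard deviation
  \<epsilon>.\<close>

lemma shifted_gauss_vec:
  fixes z :: "'a::finite \<Rightarrow> real"
  assumes e: "\<epsilon> > 0"
  shows "distr std_gauss_vec pi_borel (\<lambda>N \<alpha>. z \<alpha> + \<epsilon> * N \<alpha>)
       = density pi_lborel (\<lambda>u. \<Prod>\<alpha>\<in>UNIV. ennreal (normal_density (z \<alpha>) \<epsilon> (u \<alpha>)))"
proof -
  let ?n = "density lborel (\<lambda>t. ennreal (std_normal_density t))"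
  let ?d = "\<lambda>\<alpha>. density lborel (\<lambda>t. ennreal (normal_density (z \<alpha>) \<epsilon> t))"
  interpret n: prob_space ?n by (rule prob_space_normal_density) simp
  interpret np: product_sigma_finite "\<lambda>_::'a. ?n" ..
  interpret d: prob_space "?d \<alpha>" for \<alpha> by (rule prob_space_normal_density) (rule e)
  interpret dp: product_sigma_finite ?d ..
  interpret lp: product_sigma_finite "\<lambda>_::'a. lborel :: real measure" ..
  have one: "emeasure (?d \<alpha>) A = emeasure ?n {t. z \<alpha> + \<epsilon> * t \<in> A}" if A: "A \<in> sets borel" for \<alpha> A
  proof -
    have "distributed ?n lborel (\<lambda>t. t) (\<lambda>t. ennreal (std_normal_density t))"
      by (auto simp: distributed_def distr_id2)
    then have "distributed ?n lborel (\<lambda>t. z \<alpha> + t * \<epsilon>) (\<lambda>t. ennreal (normal_density (z \<alpha> + 0 * \<epsilon>) (\<bar>\<epsilon>\<bar> * 1) t))"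
      using n.normal_density_affine[of "\<lambda>t. t" 0 1 \<epsilon> "z \<alpha>"] e by (simp add: mult.commute)
    then have "distr ?n lborel (\<lambda>t. z \<alpha> + t * \<epsilon>) = ?d \<alpha>"
      using e by (simp add: distributed_def)
    then have "emeasure (?d \<alpha>) A = emeasure (distr ?n lborel (\<lambda>t. z \<alpha> + t * \<epsilon>)) A" by simp
    also have "\<dots> = emeasure ?n {t. z \<alpha> + \<epsilon> * t \<in> A}"
      using A by (subst emeasure_distr) (auto simp: vimage_def mult.commute)
    finally show ?thesis .
  qed
  have "distr std_gauss_vec pi_borel (\<lambda>N \<alpha>. z \<alpha> + \<epsilon> * N \<alpha>) = Pi\<^sub>M UNIV ?d"
  proof (rule dp.PiM_eqI)
    show "sets (distr std_gauss_vec pi_borel (\<lambda>N \<alpha>. z \<alpha> + \<epsilon> * N \<alpha>)) = sets (Pi\<^sub>M UNIV ?d)"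
      by (simp, intro sets_PiM_cong) auto
    fix A :: "'a \<Rightarrow> real set" assume "\<And>i. i \<in> UNIV \<Longrightarrow> A i \<in> sets (?d i)"
    then have A: "\<And>i. A i \<in> sets borel" by simp
    have A': "{t. z \<alpha> + \<epsilon> * t \<in> A \<alpha>} \<in> sets borel" for \<alpha>
      using measurable_sets[of "\<lambda>t. z \<alpha> + \<epsilon> * t" borel borel "A \<alpha>"] A by (simp add: vimage_def)
    have "emeasure (distr std_gauss_vec pi_borel (\<lambda>N \<alpha>. z \<alpha> + \<epsilon> * N \<alpha>)) (Pi\<^sub>E UNIV A)
      = emeasure std_gauss_vec (Pi\<^sub>E UNIV (\<lambda>\<alpha>. {t. z \<alpha> + \<epsilon> * t \<in> A \<alpha>}))"
    proof (subst emeasure_distr)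
      show "(\<lambda>N \<alpha>. z \<alpha> + \<epsilon> * N \<alpha>) \<in> std_gauss_vec \<rightarrow>\<^sub>M pi_borel"
        by (intro measurable_PiM_single') auto
      show "Pi\<^sub>E UNIV A \<in> sets pi_borel" using A by (intro sets_PiM_I_finite) auto
    qed (auto simp: vimage_def PiE_def std_gauss_vec_def space_PiM intro!: arg_cong[where f="emeasure _"])
    also have "\<dots> = (\<Prod>\<alpha>\<in>UNIV. emeasure ?n {t. z \<alpha> + \<epsilon> * t \<in> A \<alpha>})"
      unfolding std_gauss_vec_def using A' by (subst np.emeasure_PiM) auto
    also have "\<dots> = (\<Prod>\<alpha>\<in>UNIV. emeasure (?d \<alpha>) (A \<alpha>))" by (simp add: one[OF A])
    finally show "emeasure (distr std_gauss_vec pi_borel (\<lambda>N \<alpha>. z \<alpha> + \<epsilon> * N \<alpha>)) (Pi\<^sub>E UNIV A)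
        = (\<Prod>i\<in>UNIV. emeasure (?d i) (A i))" .
  qed simp
  moreover have "density pi_lborel (\<lambda>u. \<Prod>\<alpha>\<in>UNIV. ennreal (normal_density (z \<alpha>) \<epsilon> (u \<alpha>))) = Pi\<^sub>M UNIV ?d"
  proof (rule dp.PiM_eqI)
    show "sets (density pi_lborel (\<lambda>u. \<Prod>\<alpha>\<in>UNIV. ennreal (normal_density (z \<alpha>) \<epsilon> (u \<alpha>)))) = sets (Pi\<^sub>M UNIV ?d)"
      by (simp, intro sets_PiM_cong) auto
    fix A :: "'a \<Rightarrow> real set" assume "\<And>i. i \<in> UNIV \<Longrightarrow> A i \<in> sets (?d i)"
    then have A [measurable]: "\<And>i. A i \<in> sets borel" by simp
    have ind: "indicator (Pi\<^sub>E UNIV A) u = (\<Prod>\<alpha>\<in>UNIV. indicator (A \<alpha>) (u \<alpha>) :: ennreal)" for u :: "'a \<Rightarrow> real"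
      by (auto simp: indicator_def PiE_def Pi_iff prod_zero_iff)
    have [measurable]: "(\<lambda>u. u \<alpha>) \<in> borel_measurable (pi_lborel :: ('a \<Rightarrow> real) measure)" for \<alpha>
      using measurable_component_singleton[of \<alpha> UNIV "\<lambda>_. lborel :: real measure"] by simp
    have [measurable]: "(\<lambda>u. \<Prod>\<alpha>\<in>UNIV. ennreal (normal_density (z \<alpha>) \<epsilon> (u \<alpha>))) \<in> borel_measurable pi_lborel"
      by measurable
    have "emeasure (density pi_lborel (\<lambda>u. \<Prod>\<alpha>\<in>UNIV. ennreal (normal_density (z \<alpha>) \<epsilon> (u \<alpha>)))) (Pi\<^sub>E UNIV A)
        = (\<integral>\<^sup>+u. (\<Prod>\<alpha>\<in>UNIV. ennreal (normal_density (z \<alpha>) \<epsilon> (u \<alpha>)) * indicator (A \<alpha>) (u \<alpha>)) \<partial>pi_lborel)"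
      using A by (subst emeasure_density) (auto simp: ind prod.distrib intro!: sets_PiM_I_finite)
    also have "\<dots> = (\<Prod>\<alpha>\<in>UNIV. \<integral>\<^sup>+t. ennreal (normal_density (z \<alpha>) \<epsilon> t) * indicator (A \<alpha>) t \<partial>lborel)"
      by (rule lp.product_nn_integral_prod) auto
    also have "\<dots> = (\<Prod>\<alpha>\<in>UNIV. emeasure (?d \<alpha>) (A \<alpha>))"
      using A by (simp add: emeasure_density)
    finally show "emeasure (density pi_lborel (\<lambda>u. \<Prod>\<alpha>\<in>UNIV. ennreal (normal_density (z \<alpha>) \<epsilon> (u \<alpha>)))) (Pi\<^sub>E UNIV A)
        = (\<Prod>i\<in>UNIV. emeasure (?d i) (A i))" .
  qed simp
  ultimately show ?thesis by simp
qed

text \<open>The density of \<open>X + \<epsilon> N\<close> with \<open>N\<close> standard Gaussian is a Gaussian average of the characteristic function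
  of \<open>X\<close>, so no Fourier inversion theorem is needed; then \<open>\<epsilon> \<longlongrightarrow> 0\<close>.\<close>

definition smoothed_density :: "'b measure \<Rightarrow> ('b \<Rightarrow> 'a::finite \<Rightarrow> real) \<Rightarrow> real \<Rightarrow> ('a \<Rightarrow> real) \<Rightarrow> real" where
  "smoothed_density M X \<epsilon> u = (\<integral>w. (\<Prod>\<alpha>\<in>UNIV. normal_density (X w \<alpha>) \<epsilon> (u \<alpha>)) \<partial>M)"

lemma normal_density_le: "\<epsilon> > 0 \<Longrightarrow> normal_density \<mu> \<epsilon> t \<le> 1 / sqrt (2 * pi * \<epsilon>\<^sup>2)"
  unfolding normal_density_def by (intro mult_left_le) auto

lemma measurable_normal_density_prod [measurable]:
  assumes [measurable]: "\<And>\<alpha>. (\<lambda>w. X w \<alpha>) \<in> borel_measurable M" "\<And>\<alpha>. (\<lambda>w. u w \<alpha>) \<in> borel_measurable M"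
  shows "(\<lambda>w. \<Prod>\<alpha>\<in>(UNIV::'a::finite set). normal_density (X w \<alpha>) \<epsilon> (u w \<alpha>)) \<in> borel_measurable M"
  unfolding normal_density_def by measurable

text \<open>Up to its constant, the Gaussian density is the characteristic function of a standard
  Gaussian vector at (u - X) / \<epsilon>; Fubini then produces the characteristic function of
  \<open>X\<close> at -N / \<epsilon>.\<close>

lemma smoothed_density_char:
  fixes X :: "'b \<Rightarrow> 'a::finite \<Rightarrow> real"
  assumes M: "prob_space M" and [measurable]: "\<And>\<alpha>. (\<lambda>w. X w \<alpha>) \<in> borel_measurable M" and e: "\<epsilon> > 0"
  shows "complex_of_real (smoothed_density M X \<epsilon> u) = of_real ((1 / sqrt (2 * pi * \<epsilon>\<^sup>2)) ^ CARD('a)) *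
     (\<integral>N. iexp (\<Sum>\<alpha>\<in>UNIV. u \<alpha> * N \<alpha> / \<epsilon>) * (\<integral>w. iexp (\<Sum>\<alpha>\<in>UNIV. (- N \<alpha> / \<epsilon>) * X w \<alpha>) \<partial>M) \<partial>std_gauss_vec)"
proof -
  interpret M: prob_space M by (rule M)
  interpret G: prob_space "std_gauss_vec :: ('a \<Rightarrow> real) measure" by (rule prob_space_std_gauss_vec)
  interpret P: pair_prob_space M "std_gauss_vec :: ('a \<Rightarrow> real) measure" ..
  let ?C = "(1 / sqrt (2 * pi * \<epsilon>\<^sup>2)) ^ CARD('a)"
  have pt: "(\<Prod>\<alpha>\<in>UNIV. normal_density (X w \<alpha>) \<epsilon> (u \<alpha>)) = ?C * exp (- (\<Sum>\<alpha>\<in>UNIV. ((u \<alpha> - X w \<alpha>) / \<epsilon>)\<^sup>2) / 2)" for w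
    unfolding normal_density_def prod.distrib
    by (simp add: exp_sum[symmetric] sum_negf sum_divide_distrib power_divide mult.commute)
  have "complex_of_real (smoothed_density M X \<epsilon> u) = (\<integral>w. complex_of_real (\<Prod>\<alpha>\<in>UNIV. normal_density (X w \<alpha>) \<epsilon> (u \<alpha>)) \<partial>M)"
    unfolding smoothed_density_def by (rule integral_complex_of_real[symmetric])
  also have "\<dots> = (\<integral>w. of_real ?C * (\<integral>N. iexp (\<Sum>\<alpha>\<in>UNIV. ((u \<alpha> - X w \<alpha>) / \<epsilon>) * N \<alpha>) \<partial>std_gauss_vec) \<partial>M)"
    by (simp only: pt char_std_gauss_vec of_real_mult)
  also have "\<dots> = of_real ?C * (\<integral>w. (\<integral>N. iexp (\<Sum>\<alpha>\<in>UNIV. ((u \<alpha> - X w \<alpha>) / \<epsilon>) * N \<alpha>) \<partial>std_gauss_vec) \<partial>M)"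
    by (rule integral_mult_right_zero)
  also have "(\<integral>w. (\<integral>N. iexp (\<Sum>\<alpha>\<in>UNIV. ((u \<alpha> - X w \<alpha>) / \<epsilon>) * N \<alpha>) \<partial>std_gauss_vec) \<partial>M)
     = (\<integral>N. (\<integral>w. iexp (\<Sum>\<alpha>\<in>UNIV. ((u \<alpha> - X w \<alpha>) / \<epsilon>) * N \<alpha>) \<partial>M) \<partial>std_gauss_vec)"
  proof (rule P.Fubini_integral[symmetric])
    have "(\<lambda>p. \<Sum>\<alpha>\<in>UNIV. ((u \<alpha> - X (fst p) \<alpha>) / \<epsilon>) * snd p \<alpha>) \<in> borel_measurable (M \<Otimes>\<^sub>M std_gauss_vec)"
      by measurable
    from iexp_integrable_prob[OF P.prob_space_axioms this]
    show "integrable (M \<Otimes>\<^sub>M std_gauss_vec) (\<lambda>(x, y). iexp (\<Sum>\<alpha>\<in>UNIV. ((u \<alpha> - X x \<alpha>) / \<epsilon>) * y \<alpha>))"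
      by (simp add: case_prod_beta')
  qed
  also have "\<dots> = (\<integral>N. iexp (\<Sum>\<alpha>\<in>UNIV. u \<alpha> * N \<alpha> / \<epsilon>) * (\<integral>w. iexp (\<Sum>\<alpha>\<in>UNIV. (- N \<alpha> / \<epsilon>) * X w \<alpha>) \<partial>M) \<partial>std_gauss_vec)"
  proof (rule Bochner_Integration.integral_cong[OF refl])
    fix N :: "'a \<Rightarrow> real"
    have "iexp (\<Sum>\<alpha>\<in>UNIV. ((u \<alpha> - X w \<alpha>) / \<epsilon>) * N \<alpha>) =
       iexp (\<Sum>\<alpha>\<in>UNIV. u \<alpha> * N \<alpha> / \<epsilon>) * iexp (\<Sum>\<alpha>\<in>UNIV. (- N \<alpha> / \<epsilon>) * X w \<alpha>)" for w
      unfolding exp_add[symmetric] distrib_left[symmetric] of_real_add[symmetric] sum.distrib[symmetric]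
      by (intro arg_cong[where f="\<lambda>t. iexp t"] sum.cong refl) (use e in \<open>simp add: field_simps\<close>)
    then show "(\<integral>w. iexp (\<Sum>\<alpha>\<in>UNIV. ((u \<alpha> - X w \<alpha>) / \<epsilon>) * N \<alpha>) \<partial>M) =
       iexp (\<Sum>\<alpha>\<in>UNIV. u \<alpha> * N \<alpha> / \<epsilon>) * (\<integral>w. iexp (\<Sum>\<alpha>\<in>UNIV. (- N \<alpha> / \<epsilon>) * X w \<alpha>) \<partial>M)"
      by simp
  qed
  finally show ?thesis .
qed

text \<open>Justifies the name of \<open>smoothed_density\<close>: it is the Lebesgue density of X +
  \<epsilon> N. Nonnegative test functions leave only Tonelli's theorem to invoke.\<close>

lemma smoothed_expectation:
  fixes X :: "'b \<Rightarrow> 'a::finite \<Rightarrow> real"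
  assumes M: "prob_space M" and [measurable]: "\<And>\<alpha>. (\<lambda>w. X w \<alpha>) \<in> borel_measurable M" and e: "\<epsilon> > 0"
    and F [measurable]: "F \<in> borel_measurable pi_borel"
  shows "(\<integral>\<^sup>+w. (\<integral>\<^sup>+N. F (\<lambda>\<alpha>. X w \<alpha> + \<epsilon> * N \<alpha>) \<partial>std_gauss_vec) \<partial>M)
     = (\<integral>\<^sup>+u. F u * ennreal (smoothed_density M X \<epsilon> u) \<partial>pi_lborel)"
proof -
  interpret M: prob_space M by (rule M)
  interpret lp: product_sigma_finite "\<lambda>_::'a. lborel :: real measure" ..
  interpret lf: sigma_finite_measure "pi_lborel :: ('a \<Rightarrow> real) measure" by (rule lp.sigma_finite) simp
  interpret P: pair_sigma_finite M "pi_lborel :: ('a \<Rightarrow> real) measure" ..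
  have sl: "sets (pi_lborel :: ('a \<Rightarrow> real) measure) = sets pi_borel" by (intro sets_PiM_cong) auto
  have [measurable]: "F \<in> borel_measurable pi_lborel" using F by (simp cong: measurable_cong_sets add: sl)
  have comp [measurable]: "(\<lambda>u. u \<alpha>) \<in> borel_measurable (pi_lborel :: ('a \<Rightarrow> real) measure)" for \<alpha>
    using measurable_component_singleton[of \<alpha> UNIV "\<lambda>_. lborel :: real measure"] by simp
  have inner: "(\<integral>\<^sup>+N. F (\<lambda>\<alpha>. z \<alpha> + \<epsilon> * N \<alpha>) \<partial>std_gauss_vec)
      = (\<integral>\<^sup>+u. F u * ennreal (\<Prod>\<alpha>\<in>UNIV. normal_density (z \<alpha>) \<epsilon> (u \<alpha>)) \<partial>pi_lborel)" for z
  proof -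
    have "(\<integral>\<^sup>+N. F (\<lambda>\<alpha>. z \<alpha> + \<epsilon> * N \<alpha>) \<partial>std_gauss_vec)
       = (\<integral>\<^sup>+u. F u \<partial>distr std_gauss_vec pi_borel (\<lambda>N \<alpha>. z \<alpha> + \<epsilon> * N \<alpha>))"
      by (rule nn_integral_distr[symmetric]) (auto intro!: measurable_PiM_single')
    also have "\<dots> = (\<integral>\<^sup>+u. (\<Prod>\<alpha>\<in>UNIV. ennreal (normal_density (z \<alpha>) \<epsilon> (u \<alpha>))) * F u \<partial>pi_lborel)"
      unfolding shifted_gauss_vec[OF e] by (rule nn_integral_density) measurable
    finally show ?thesis by (simp add: prod_ennreal mult.commute)
  qed
  have "(\<integral>\<^sup>+w. (\<integral>\<^sup>+N. F (\<lambda>\<alpha>. X w \<alpha> + \<epsilon> * N \<alpha>) \<partial>std_gauss_vec) \<partial>M)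
     = (\<integral>\<^sup>+w. (\<integral>\<^sup>+u. F u * ennreal (\<Prod>\<alpha>\<in>UNIV. normal_density (X w \<alpha>) \<epsilon> (u \<alpha>)) \<partial>pi_lborel) \<partial>M)"
    by (simp only: inner)
  also have "\<dots> = (\<integral>\<^sup>+u. (\<integral>\<^sup>+w. F u * ennreal (\<Prod>\<alpha>\<in>UNIV. normal_density (X w \<alpha>) \<epsilon> (u \<alpha>)) \<partial>M) \<partial>pi_lborel)"
    by (rule P.Fubini'[symmetric]) (unfold normal_density_def, measurable)
  also have "\<dots> = (\<integral>\<^sup>+u. F u * ennreal (smoothed_density M X \<epsilon> u) \<partial>pi_lborel)"
  proof (rule nn_integral_cong)
    fix u
    let ?B = "\<Prod>\<alpha>\<in>(UNIV::'a set). 1 / sqrt (2 * pi * \<epsilon>\<^sup>2)"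
    have "norm (\<Prod>\<alpha>\<in>UNIV. normal_density (X w \<alpha>) \<epsilon> (u \<alpha>)) \<le> ?B" for w
      unfolding real_norm_def abs_prod
      by (rule prod_mono) (simp only: abs_of_nonneg normal_density_nonneg normal_density_le[OF e] simp_thms)
    then have i: "integrable M (\<lambda>w. \<Prod>\<alpha>\<in>UNIV. normal_density (X w \<alpha>) \<epsilon> (u \<alpha>))"
      by (intro M.integrable_const_bound[where B="?B"] AE_I2) measurable
    have "(\<integral>\<^sup>+w. F u * ennreal (\<Prod>\<alpha>\<in>UNIV. normal_density (X w \<alpha>) \<epsilon> (u \<alpha>)) \<partial>M)
       = F u * (\<integral>\<^sup>+w. ennreal (\<Prod>\<alpha>\<in>UNIV. normal_density (X w \<alpha>) \<epsilon> (u \<alpha>)) \<partial>M)"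
      by (rule nn_integral_cmult) measurable
    also have "(\<integral>\<^sup>+w. ennreal (\<Prod>\<alpha>\<in>UNIV. normal_density (X w \<alpha>) \<epsilon> (u \<alpha>)) \<partial>M) = ennreal (smoothed_density M X \<epsilon> u)"
      unfolding smoothed_density_def by (rule nn_integral_eq_integral[OF i]) (auto intro!: prod_nonneg)
    finally show "(\<integral>\<^sup>+w. F u * ennreal (\<Prod>\<alpha>\<in>UNIV. normal_density (X w \<alpha>) \<epsilon> (u \<alpha>)) \<partial>M)
       = F u * ennreal (smoothed_density M X \<epsilon> u)" .
  qed
  finally show ?thesis .
qed

lemma continuous_fun_measurable:
  fixes F :: "('a::finite \<Rightarrow> real) \<Rightarrow> real"
  assumes "continuous_on UNIV F"
  shows "F \<in> borel_measurable pi_borel"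
  using borel_measurable_continuous_onI[OF assms] by (simp cong: measurable_cong_sets add: sets_PiM_equal_borel)

lemma smoothing_limit:
  fixes X :: "'b \<Rightarrow> 'a::finite \<Rightarrow> real" and F :: "('a \<Rightarrow> real) \<Rightarrow> real"
  assumes M: "prob_space M" and mX [measurable]: "\<And>\<alpha>. (\<lambda>w. X w \<alpha>) \<in> borel_measurable M"
    and F: "continuous_on UNIV F" and B: "\<And>z. \<bar>F z\<bar> \<le> B"
  shows "(\<lambda>n. \<integral>w. (\<integral>N. F (\<lambda>\<alpha>. X w \<alpha> + inverse (real (Suc n)) * N \<alpha>) \<partial>std_gauss_vec) \<partial>M) \<longlonglongrightarrow> (\<integral>w. F (X w) \<partial>M)"
proof -
  interpret M: prob_space M by (rule M)
  interpret G: prob_space "std_gauss_vec :: ('a \<Rightarrow> real) measure" by (rule prob_space_std_gauss_vec)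
  note [measurable] = continuous_fun_measurable[OF F]
  have m1: "(\<lambda>N. F (\<lambda>\<alpha>. z \<alpha> + c * N \<alpha>)) \<in> borel_measurable std_gauss_vec" for z c
    by (rule measurable_compose[OF _ continuous_fun_measurable[OF F]]) (auto intro!: measurable_PiM_single')
  have m2: "(\<lambda>p. F (\<lambda>\<alpha>. X (fst p) \<alpha> + c * snd p \<alpha>)) \<in> borel_measurable (M \<Otimes>\<^sub>M std_gauss_vec)" for c
    by (rule measurable_compose[OF _ continuous_fun_measurable[OF F]]) (auto intro!: measurable_PiM_single')
  have mFX: "(\<lambda>w. F (X w)) \<in> borel_measurable M"
    by (rule measurable_compose[OF _ continuous_fun_measurable[OF F]]) (auto intro!: measurable_PiM_single')
  have inner: "(\<lambda>n. \<integral>N. F (\<lambda>\<alpha>. z \<alpha> + inverse (real (Suc n)) * N \<alpha>) \<partial>std_gauss_vec) \<longlonglongrightarrow> F z" for z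
  proof -
    have "(\<lambda>n. \<integral>N. F (\<lambda>\<alpha>. z \<alpha> + inverse (real (Suc n)) * N \<alpha>) \<partial>std_gauss_vec)
        \<longlonglongrightarrow> (\<integral>N. F z \<partial>(std_gauss_vec :: ('a \<Rightarrow> real) measure))"
    proof (rule integral_dominated_convergence[where w="\<lambda>_. B"])
      show "AE N in std_gauss_vec. (\<lambda>n. F (\<lambda>\<alpha>. z \<alpha> + inverse (real (Suc n)) * N \<alpha>)) \<longlonglongrightarrow> F z"
      proof (rule AE_I2)
        fix N :: "'a \<Rightarrow> real"
        have "continuous_on UNIV (\<lambda>c::real. F (\<lambda>\<alpha>. z \<alpha> + c * N \<alpha>))"
          by (rule continuous_on_compose2[OF F]) (auto intro!: continuous_intros)
        from continuous_on_tendsto_compose[OF this LIMSEQ_inverse_real_of_nat]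
        show "(\<lambda>n. F (\<lambda>\<alpha>. z \<alpha> + inverse (real (Suc n)) * N \<alpha>)) \<longlonglongrightarrow> F z" by simp
      qed
    qed (use m1 B in auto)
    then show ?thesis by (simp add: G.prob_space)
  qed
  show ?thesis
  proof (rule integral_dominated_convergence[where w="\<lambda>_. B"])
    show "(\<lambda>w. \<integral>N. F (\<lambda>\<alpha>. X w \<alpha> + inverse (real (Suc n)) * N \<alpha>) \<partial>std_gauss_vec) \<in> borel_measurable M" for n
      by (rule G.borel_measurable_lebesgue_integral) (use m2 in \<open>simp add: case_prod_beta'\<close>)
    show "AE w in M. norm (\<integral>N. F (\<lambda>\<alpha>. X w \<alpha> + inverse (real (Suc n)) * N \<alpha>) \<partial>std_gauss_vec) \<le> B" for n
    proof (rule AE_I2)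
      fix w
      have "norm (\<integral>N. F (\<lambda>\<alpha>. X w \<alpha> + inverse (real (Suc n)) * N \<alpha>) \<partial>std_gauss_vec)
         \<le> (\<integral>N. norm (F (\<lambda>\<alpha>. X w \<alpha> + inverse (real (Suc n)) * N \<alpha>)) \<partial>std_gauss_vec)"
        by (rule integral_norm_bound)
      also have "\<dots> \<le> (\<integral>N. B \<partial>(std_gauss_vec :: ('a \<Rightarrow> real) measure))"
        by (intro integral_mono G.integrable_const_bound[where B=B]) (use m1 B order_trans[OF abs_ge_zero B] in auto)
      finally show "norm (\<integral>N. F (\<lambda>\<alpha>. X w \<alpha> + inverse (real (Suc n)) * N \<alpha>) \<partial>std_gauss_vec) \<le> B"
        by (simp add: G.prob_space)
    qed
  qed (use inner mFX in auto)
qed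

text \<open>Bounded continuous nonnegative test functions suffice, since the result is meant for
  exponentials of bounded features. Equal characteristic functions give equal smoothed densities for
  every \<epsilon>, and the smoothing is then removed in the limit.\<close>

lemma expectation_eq_of_char_eq:
  fixes X1 :: "'b \<Rightarrow> 'a::finite \<Rightarrow> real" and X2 :: "'c \<Rightarrow> 'a \<Rightarrow> real" and F :: "('a \<Rightarrow> real) \<Rightarrow> real"
  assumes M1: "prob_space M1" and X1: "\<And>\<alpha>. (\<lambda>w. X1 w \<alpha>) \<in> borel_measurable M1"
    and M2: "prob_space M2" and X2: "\<And>\<alpha>. (\<lambda>w. X2 w \<alpha>) \<in> borel_measurable M2"
    and char: "\<And>t. (\<integral>w. iexp (\<Sum>\<alpha>\<in>UNIV. t \<alpha> * X1 w \<alpha>) \<partial>M1) = (\<integral>w. iexp (\<Sum>\<alpha>\<in>UNIV. t \<alpha> * X2 w \<alpha>) \<partial>M2)"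
    and F: "continuous_on UNIV F" and F0: "\<And>z. 0 \<le> F z" and B: "\<And>z. F z \<le> B"
  shows "(\<integral>w. F (X1 w) \<partial>M1) = (\<integral>w. F (X2 w) \<partial>M2)"
proof -
  interpret G: prob_space "std_gauss_vec :: ('a \<Rightarrow> real) measure" by (rule prob_space_std_gauss_vec)
  have BF: "\<bar>F z\<bar> \<le> B" for z using F0 B by simp
  note mF [measurable] = continuous_fun_measurable[OF F]
  have dens: "smoothed_density M1 X1 \<epsilon> u = smoothed_density M2 X2 \<epsilon> u" if e: "\<epsilon> > 0" for \<epsilon> u
  proof -
    have "complex_of_real (smoothed_density M1 X1 \<epsilon> u) = complex_of_real (smoothed_density M2 X2 \<epsilon> u)"
      unfolding smoothed_density_char[OF M1 X1 e] smoothed_density_char[OF M2 X2 e] char ..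
    then show ?thesis by simp
  qed
  have conv: "(\<integral>w. (\<integral>N. F (\<lambda>\<alpha>. X w \<alpha> + \<epsilon> * N \<alpha>) \<partial>std_gauss_vec) \<partial>M)
     = enn2real (\<integral>\<^sup>+u. F u * ennreal (smoothed_density M X \<epsilon> u) \<partial>pi_lborel)"
    if M: "prob_space M" and X [measurable]: "\<And>\<alpha>. (\<lambda>w. X w \<alpha>) \<in> borel_measurable M" and e: "\<epsilon> > 0"
    for M :: "'d measure" and X \<epsilon>
  proof -
    interpret M: prob_space M by (rule M)
    have m1: "(\<lambda>N. F (\<lambda>\<alpha>. z \<alpha> + \<epsilon> * N \<alpha>)) \<in> borel_measurable std_gauss_vec" for z
      by (rule measurable_compose[OF _ mF]) (auto intro!: measurable_PiM_single')
    have m2: "(\<lambda>p. F (\<lambda>\<alpha>. X (fst p) \<alpha> + \<epsilon> * snd p \<alpha>)) \<in> borel_measurable (M \<Otimes>\<^sub>M std_gauss_vec)"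
      by (rule measurable_compose[OF _ mF]) (auto intro!: measurable_PiM_single')
    have i: "integrable std_gauss_vec (\<lambda>N. F (\<lambda>\<alpha>. z \<alpha> + \<epsilon> * N \<alpha>))" for z
      by (rule G.integrable_const_bound[where B=B]) (use m1 BF in auto)
    have "(\<integral>w. (\<integral>N. F (\<lambda>\<alpha>. X w \<alpha> + \<epsilon> * N \<alpha>) \<partial>std_gauss_vec) \<partial>M)
       = enn2real (\<integral>\<^sup>+w. ennreal (\<integral>N. F (\<lambda>\<alpha>. X w \<alpha> + \<epsilon> * N \<alpha>) \<partial>std_gauss_vec) \<partial>M)"
    proof (rule integral_eq_nn_integral)
      show "(\<lambda>w. \<integral>N. F (\<lambda>\<alpha>. X w \<alpha> + \<epsilon> * N \<alpha>) \<partial>std_gauss_vec) \<in> borel_measurable M"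
        by (rule G.borel_measurable_lebesgue_integral) (use m2 in \<open>simp add: case_prod_beta'\<close>)
    qed (use F0 in \<open>auto intro!: integral_nonneg_AE\<close>)
    also have "(\<integral>\<^sup>+w. ennreal (\<integral>N. F (\<lambda>\<alpha>. X w \<alpha> + \<epsilon> * N \<alpha>) \<partial>std_gauss_vec) \<partial>M)
       = (\<integral>\<^sup>+w. (\<integral>\<^sup>+N. ennreal (F (\<lambda>\<alpha>. X w \<alpha> + \<epsilon> * N \<alpha>)) \<partial>std_gauss_vec) \<partial>M)"
      by (intro nn_integral_cong nn_integral_eq_integral[symmetric] i) (use F0 in auto)
    also have "\<dots> = (\<integral>\<^sup>+u. ennreal (F u) * ennreal (smoothed_density M X \<epsilon> u) \<partial>pi_lborel)"
      by (rule smoothed_expectation[OF M X e]) measurable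
    finally show ?thesis .
  qed
  have "(\<integral>w. (\<integral>N. F (\<lambda>\<alpha>. X1 w \<alpha> + inverse (real (Suc n)) * N \<alpha>) \<partial>std_gauss_vec) \<partial>M1)
     = (\<integral>w. (\<integral>N. F (\<lambda>\<alpha>. X2 w \<alpha> + inverse (real (Suc n)) * N \<alpha>) \<partial>std_gauss_vec) \<partial>M2)" for n
    by (subst conv[OF M1 X1], simp, subst conv[OF M2 X2], simp, simp add: dens)
  then show ?thesis
    using LIMSEQ_unique[OF smoothing_limit[OF M1 X1 F BF]] smoothing_limit[OF M2 X2 F BF] by simp
qed

declare measurable_std_gauss_component [measurable del]

section \<open>Transforms and laws of weighted sums of independent centred Gaussian
  variables\<close>

lemma (in prob_space) distributed_normal_distr:
  assumes X: "centered_gaussian M X s" and s: "s > 0"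
  shows "distr M borel (\<lambda>w. X w / sqrt s) = std_normal_distribution" and "X \<in> borel_measurable M"
proof -
  have d: "distributed M lborel X (\<lambda>t. ennreal (normal_density 0 (sqrt s) t))"
    using X s by (simp add: centered_gaussian_def)
  then show "X \<in> borel_measurable M" by (auto dest: distributed_measurable)
  have "distributed M lborel (\<lambda>w. (X w - 0) / sqrt s) (\<lambda>t. ennreal (std_normal_density t))"
    using normal_standard_normal_convert[of "sqrt s" X 0] d s by simp
  then have "distr M lborel (\<lambda>w. X w / sqrt s) = std_normal_distribution"
    by (auto dest: distributed_distr_eq_density)
  then show "distr M borel (\<lambda>w. X w / sqrt s) = std_normal_distribution"
    by (metis distr_cong sets_lborel)
qed

lemma (in prob_space) centered_gaussian_char:
  assumes X: "centered_gaussian M X s" and s: "s \<ge> 0"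
  shows "(\<integral>w. iexp (u * X w) \<partial>M) = complex_of_real (exp (- (s * u\<^sup>2) / 2))"
proof (cases "s = 0")
  case True
  then have [measurable]: "X \<in> borel_measurable M" and ae: "AE w in M. X w = 0"
    using X by (auto simp: centered_gaussian_def)
  have "(\<integral>w. iexp (u * X w) \<partial>M) = (\<integral>w. 1 \<partial>M)"
    by (rule integral_cong_AE) (measurable, use ae in auto)
  then show ?thesis using True by (simp add: prob_space)
next
  case False
  then have s0: "s > 0" using s by simp
  note [measurable] = distributed_normal_distr(2)[OF X s0]
  have "(\<integral>w. iexp (u * X w) \<partial>M) = (\<integral>w. iexp ((u * sqrt s) * (X w / sqrt s)) \<partial>M)"
    using s0 by simp
  also have "\<dots> = (\<integral>t. iexp ((u * sqrt s) * t) \<partial>distr M borel (\<lambda>w. X w / sqrt s))"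
    by (rule integral_distr[symmetric]) measurable
  also have "\<dots> = char std_normal_distribution (u * sqrt s)"
    by (simp add: distributed_normal_distr(1)[OF X s0] char_def)
  also have "\<dots> = complex_of_real (exp (- (s * u\<^sup>2) / 2))"
    using s0 by (simp add: char_std_normal_distribution power_mult_distrib mult.commute)
  finally show ?thesis .
qed

lemma (in prob_space) centered_gaussian_mgf:
  assumes X: "centered_gaussian M X s" and s: "s \<ge> 0"
  shows "(\<integral>\<^sup>+w. ennreal (exp (u * X w)) \<partial>M) = ennreal (exp (s * u\<^sup>2 / 2))"
proof (cases "s = 0")
  case True
  then have ae: "AE w in M. X w = 0" using X by (auto simp: centered_gaussian_def)
  have "(\<integral>\<^sup>+w. ennreal (exp (u * X w)) \<partial>M) = (\<integral>\<^sup>+w. 1 \<partial>M)"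
    by (rule nn_integral_cong_AE) (use ae in auto)
  then show ?thesis using True by (simp add: emeasure_space_1)
next
  case False
  then have s0: "s > 0" using s by simp
  have d: "distributed M lborel X (\<lambda>t. ennreal (normal_density 0 (sqrt s) t))"
    using X False by (simp add: centered_gaussian_def)
  have "(\<integral>\<^sup>+w. ennreal (exp (u * X w)) \<partial>M)
     = (\<integral>\<^sup>+t. ennreal (normal_density 0 (sqrt s) t) * ennreal (exp (u * t)) \<partial>lborel)"
    by (rule distributed_nn_integral[OF d, symmetric]) measurable
  also have "\<dots> = (\<integral>\<^sup>+t. ennreal (exp (s * u\<^sup>2 / 2)) * ennreal (normal_density (s * u) (sqrt s) t) \<partial>lborel)"
  proof (rule nn_integral_cong)
    fix t :: real
    \<comment> \<open>Completing the square: tilting the centred normal law of variance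
      \<open>s\<close> by \<open>u\<close> shifts its mean to \<open>s * u\<close>.\<close>
    have "- (t - 0)\<^sup>2 / (2 * s) + u * t = s * u\<^sup>2 / 2 + - (t - s * u)\<^sup>2 / (2 * s)"
      using s0 by (simp add: power2_diff field_simps power2_eq_square)
    then have "normal_density 0 (sqrt s) t * exp (u * t) = exp (s * u\<^sup>2 / 2) * normal_density (s * u) (sqrt s) t"
      using s0 by (simp add: normal_density_def exp_add[symmetric] mult.assoc)
    then show "ennreal (normal_density 0 (sqrt s) t) * ennreal (exp (u * t))
       = ennreal (exp (s * u\<^sup>2 / 2)) * ennreal (normal_density (s * u) (sqrt s) t)"
      by (simp add: ennreal_mult[symmetric])
  qed
  also have "\<dots> = ennreal (exp (s * u\<^sup>2 / 2)) * (\<integral>\<^sup>+t. ennreal (normal_density (s * u) (sqrt s) t) \<partial>lborel)"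
    by (rule nn_integral_cmult) measurable
  also have "(\<integral>\<^sup>+t. ennreal (normal_density (s * u) (sqrt s) t) \<partial>lborel) = 1"
    using nn_integral_eq_integral[OF integrable_normal_density[of "sqrt s" "s * u"]] s0
    by (simp add: integral_normal_density)
  finally show ?thesis by simp
qed

text \<open>If \<open>q\<close> is the covariance of a sum of vectors \<open>a j\<close> with
  independent coefficients of variances \<open>s j\<close>, its form at \<open>t\<close> is the
  variance of the component of that sum along \<open>t\<close>.\<close>

lemma quadratic_form_outer_sum:
  fixes q :: "real^'a^'a::finite" and a :: "'j \<Rightarrow> 'a \<Rightarrow> real" and t :: "real^'a"
  assumes q: "\<And>\<alpha> \<beta>. q $ \<alpha> $ \<beta> = (\<Sum>j\<in>J. s j * (a j \<alpha> * a j \<beta>))"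
  shows "t \<bullet> (q *v t) = (\<Sum>j\<in>J. s j * (\<Sum>\<alpha>\<in>UNIV. t $ \<alpha> * a j \<alpha>)\<^sup>2)"
proof -
  have "t \<bullet> (q *v t) = (\<Sum>\<alpha>\<in>UNIV. \<Sum>\<beta>\<in>UNIV. \<Sum>j\<in>J. s j * ((t $ \<alpha> * a j \<alpha>) * (t $ \<beta> * a j \<beta>)))"
    by (simp add: inner_vec_def matrix_vector_mult_def q sum_distrib_left sum_distrib_right mult_ac)
  also have "\<dots> = (\<Sum>\<alpha>\<in>UNIV. \<Sum>j\<in>J. \<Sum>\<beta>\<in>UNIV. s j * ((t $ \<alpha> * a j \<alpha>) * (t $ \<beta> * a j \<beta>)))"
    by (intro sum.cong refl sum.swap)
  also have "\<dots> = (\<Sum>j\<in>J. \<Sum>\<alpha>\<in>UNIV. \<Sum>\<beta>\<in>UNIV. s j * ((t $ \<alpha> * a j \<alpha>) * (t $ \<beta> * a j \<beta>)))"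
    by (rule sum.swap)
  also have "\<dots> = (\<Sum>j\<in>J. s j * (\<Sum>\<alpha>\<in>UNIV. t $ \<alpha> * a j \<alpha>)\<^sup>2)"
    unfolding power2_eq_square sum_product by (simp only: sum_distrib_left)
  finally show ?thesis .
qed

lemma (in prob_space) gaussian_sum_char:
  assumes J: "finite J" and ind: "indep_vars (\<lambda>_. borel) \<xi> J"
    and g: "\<And>j. j \<in> J \<Longrightarrow> centered_gaussian M (\<xi> j) (s j)" and s: "\<And>j. j \<in> J \<Longrightarrow> s j \<ge> 0"
  shows "(\<integral>w. iexp (\<Sum>j\<in>J. u j * \<xi> j w) \<partial>M) = complex_of_real (exp (- (\<Sum>j\<in>J. s j * (u j)\<^sup>2) / 2))"
proof -
  have \<xi>: "\<xi> j \<in> borel_measurable M" if "j \<in> J" for j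
    using ind that by (auto simp: indep_vars_def)
  have "(\<integral>w. iexp (\<Sum>j\<in>J. u j * \<xi> j w) \<partial>M) = (\<integral>w. (\<Prod>j\<in>J. iexp (u j * \<xi> j w)) \<partial>M)"
    using J by (simp add: sum_distrib_left exp_sum)
  also have "\<dots> = (\<Prod>j\<in>J. \<integral>w. iexp (u j * \<xi> j w) \<partial>M)"
  proof (rule indep_vars_lebesgue_integral[OF J])
    show "indep_vars (\<lambda>_. borel) (\<lambda>j w. iexp (u j * \<xi> j w)) J"
      by (rule indep_vars_compose2[OF ind]) measurable
    show "integrable M (\<lambda>w. iexp (u j * \<xi> j w))" if "j \<in> J" for j
      using \<xi>[OF that] iexp_integrable_prob[OF prob_space_axioms, of "\<lambda>w. u j * \<xi> j w"] by simp
  qed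
  also have "\<dots> = (\<Prod>j\<in>J. complex_of_real (exp (- (s j * (u j)\<^sup>2) / 2)))"
    by (intro prod.cong refl centered_gaussian_char g s)
  also have "\<dots> = complex_of_real (exp (- (\<Sum>j\<in>J. s j * (u j)\<^sup>2) / 2))"
    using J by (simp add: of_real_prod[symmetric] exp_sum[symmetric] sum_negf sum_divide_distrib
        del: of_real_prod of_real_exp)
  finally show ?thesis .
qed

lemma (in prob_space) gaussian_sum_mgf:
  assumes J: "finite J" and ind: "indep_vars (\<lambda>_. borel) \<xi> J"
    and g: "\<And>j. j \<in> J \<Longrightarrow> centered_gaussian M (\<xi> j) (s j)" and s: "\<And>j. j \<in> J \<Longrightarrow> s j \<ge> 0"
  shows "(\<integral>\<^sup>+w. ennreal (exp (\<Sum>j\<in>J. u j * \<xi> j w)) \<partial>M) = ennreal (exp ((\<Sum>j\<in>J. s j * (u j)\<^sup>2) / 2))"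
proof -
  have "(\<integral>\<^sup>+w. ennreal (exp (\<Sum>j\<in>J. u j * \<xi> j w)) \<partial>M) = (\<integral>\<^sup>+w. (\<Prod>j\<in>J. ennreal (exp (u j * \<xi> j w))) \<partial>M)"
    using J by (simp add: exp_sum prod_ennreal)
  also have "\<dots> = (\<Prod>j\<in>J. \<integral>\<^sup>+w. ennreal (exp (u j * \<xi> j w)) \<partial>M)"
    by (intro indep_vars_nn_integral[OF J] indep_vars_compose2[OF ind]) auto
  also have "\<dots> = (\<Prod>j\<in>J. ennreal (exp (s j * (u j)\<^sup>2 / 2)))"
    by (intro prod.cong refl centered_gaussian_mgf g s)
  also have "\<dots> = ennreal (exp ((\<Sum>j\<in>J. s j * (u j)\<^sup>2) / 2))"
    using J by (simp add: prod_ennreal exp_sum[symmetric] sum_divide_distrib)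
  finally show ?thesis .
qed

text \<open>Both vectors have the characteristic function exp (-t.(q t) / 2), the second one because
  |q^# t|^2 = t.(q t). A singular \<open>q\<close>, including zero bias variance, needs no separate
  treatment, as no density of the sum is used.\<close>

lemma (in prob_space) gaussian_sum_law:
  fixes a :: "'j \<Rightarrow> 'd::finite \<Rightarrow> real" and q :: "real^'d^'d" and F :: "('d \<Rightarrow> real) \<Rightarrow> real"
  assumes J: "finite J" and ind: "indep_vars (\<lambda>_. borel) \<xi> J"
    and g: "\<And>j. j \<in> J \<Longrightarrow> centered_gaussian M (\<xi> j) (s j)" and s: "\<And>j. j \<in> J \<Longrightarrow> s j \<ge> 0"
    and q: "\<And>\<alpha> \<beta>. q $ \<alpha> $ \<beta> = (\<Sum>j\<in>J. s j * (a j \<alpha> * a j \<beta>))" and psd: "psd_mat q"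
    and F: "continuous_on UNIV F" "\<And>z. 0 \<le> F z" "\<And>z. F z \<le> B"
  shows "(\<integral>w. F (\<lambda>\<alpha>. \<Sum>j\<in>J. a j \<alpha> * \<xi> j w) \<partial>M) = (\<integral>N. F (\<lambda>\<alpha>. gproj q \<alpha> N) \<partial>std_gauss_vec)"
proof (rule expectation_eq_of_char_eq[OF prob_space_axioms _ prob_space_std_gauss_vec _ _ F])
  have \<xi>: "\<xi> j \<in> borel_measurable M" if "j \<in> J" for j
    using ind that by (auto simp: indep_vars_def)
  then show "(\<lambda>w. \<Sum>j\<in>J. a j \<alpha> * \<xi> j w) \<in> borel_measurable M" for \<alpha>
    by (intro borel_measurable_sum borel_measurable_times) auto
  show "(\<lambda>N. gproj q \<alpha> N) \<in> borel_measurable std_gauss_vec" for \<alpha> by measurable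
  fix t :: "'d \<Rightarrow> real"
  define t' :: "real^'d" where "t' = (\<chi> \<alpha>. t \<alpha>)"
  have "(\<integral>w. iexp (\<Sum>\<alpha>\<in>UNIV. t \<alpha> * (\<Sum>j\<in>J. a j \<alpha> * \<xi> j w)) \<partial>M)
     = (\<integral>w. iexp (\<Sum>j\<in>J. (\<Sum>\<alpha>\<in>UNIV. t \<alpha> * a j \<alpha>) * \<xi> j w) \<partial>M)"
    by (intro Bochner_Integration.integral_cong refl arg_cong[where f="\<lambda>x. iexp x"])
       (simp add: sum_distrib_left sum_distrib_right mult.assoc sum.swap[of _ _ J])
  also have "\<dots> = complex_of_real (exp (- (\<Sum>j\<in>J. s j * (\<Sum>\<alpha>\<in>UNIV. t \<alpha> * a j \<alpha>)\<^sup>2) / 2))"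
    by (rule gaussian_sum_char[OF J ind g s])
  also have "(\<Sum>j\<in>J. s j * (\<Sum>\<alpha>\<in>UNIV. t \<alpha> * a j \<alpha>)\<^sup>2) = t' \<bullet> (q *v t')"
    by (subst quadratic_form_outer_sum[OF q]) (simp add: t'_def)
  also have "\<dots> = (norm (psd_sqrt q *v t'))\<^sup>2" by (rule norm_psd_sqrt_mult[OF psd, symmetric])
  also have "\<dots> = (\<Sum>\<gamma>\<in>UNIV. (\<Sum>\<alpha>\<in>UNIV. t \<alpha> * psd_sqrt q $ \<alpha> $ \<gamma>)\<^sup>2)"
  proof -
    have "psd_sqrt q $ \<gamma> $ \<alpha> = psd_sqrt q $ \<alpha> $ \<gamma>" for \<alpha> \<gamma>
      using psd_sqrt(1)[OF psd] by (auto simp: psd_mat_def transpose_def vec_eq_iff)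
    then show ?thesis
      unfolding power2_norm_eq_inner
      by (simp add: inner_vec_def matrix_vector_mult_def t'_def power2_eq_square mult.commute)
  qed
  also have "complex_of_real (exp (- (\<Sum>\<gamma>\<in>UNIV. (\<Sum>\<alpha>\<in>UNIV. t \<alpha> * psd_sqrt q $ \<alpha> $ \<gamma>)\<^sup>2) / 2))
      = (\<integral>N. iexp (\<Sum>\<gamma>\<in>UNIV. (\<Sum>\<alpha>\<in>UNIV. t \<alpha> * psd_sqrt q $ \<alpha> $ \<gamma>) * N \<gamma>) \<partial>std_gauss_vec)"
    by (rule char_std_gauss_vec[symmetric])
  also have "\<dots> = (\<integral>N. iexp (\<Sum>\<alpha>\<in>UNIV. t \<alpha> * gproj q \<alpha> N) \<partial>std_gauss_vec)"
    by (intro Bochner_Integration.integral_cong refl arg_cong[where f="\<lambda>x. iexp x"])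
       (simp add: gproj_def sum_distrib_left sum_distrib_right mult.assoc, rule sum.swap)
  finally show "(\<integral>w. iexp (\<Sum>\<alpha>\<in>UNIV. t \<alpha> * (\<Sum>j\<in>J. a j \<alpha> * \<xi> j w)) \<partial>M)
     = (\<integral>N. iexp (\<Sum>\<alpha>\<in>UNIV. t \<alpha> * gproj q \<alpha> N) \<partial>std_gauss_vec)" .
qed

section \<open>The layers of the network\<close>

text \<open>Conditioning on the block \<open>i0\<close> is Fubini for the product law of the blocks:
  with \<open>U i0\<close> frozen, the other blocks remain independent and the product
  factorises.\<close>

lemma (in prob_space) indep_conditional_product:
  fixes g :: "'x \<Rightarrow> ennreal" and f :: "'i \<Rightarrow> 'x \<Rightarrow> 'x \<Rightarrow> ennreal"
  assumes J: "finite J" "i0 \<notin> J" and ind: "indep_vars Mi U (insert i0 J)"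
    and g [measurable]: "g \<in> borel_measurable (Mi i0)"
    and f: "\<And>i. i \<in> J \<Longrightarrow> case_prod (f i) \<in> borel_measurable (Mi i0 \<Otimes>\<^sub>M Mi i)"
  shows "(\<integral>\<^sup>+w. g (U i0 w) * (\<Prod>i\<in>J. f i (U i0 w) (U i w)) \<partial>M)
       = (\<integral>\<^sup>+w. g (U i0 w) * (\<Prod>i\<in>J. \<integral>\<^sup>+w'. f i (U i0 w) (U i w') \<partial>M) \<partial>M)"
proof -
  let ?I = "insert i0 J"
  have U: "U i \<in> M \<rightarrow>\<^sub>M Mi i" if "i \<in> ?I" for i using ind that by (auto simp: indep_vars_def)
  \<comment> \<open>Product measures are set up for families indexed by the whole type, so indices
    outside \<open>?I\<close> are sent to \<open>i0\<close> to make every \<open>D i\<close> a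
    probability measure.\<close>
  define r where "r i = (if i \<in> ?I then i else i0)" for i
  define D where "D i = distr M (Mi (r i)) (U (r i))" for i
  have rI: "r i \<in> ?I" for i by (simp add: r_def)
  interpret D: prob_space "D i" for i unfolding D_def by (intro prob_space_distr U rI)
  interpret PD: product_sigma_finite D ..
  have sD: "sets (D i) = sets (Mi i)" if "i \<in> ?I" for i using that by (simp add: D_def r_def)
  have law: "distr M (Pi\<^sub>M ?I Mi) (\<lambda>w. \<lambda>i\<in>?I. U i w) = Pi\<^sub>M ?I D"
  proof -
    have "distr M (Pi\<^sub>M ?I Mi) (\<lambda>w. \<lambda>i\<in>?I. U i w) = Pi\<^sub>M ?I (\<lambda>i. distr M (Mi i) (U i))"
      using indep_vars_iff_distr_eq_PiM'[of ?I U Mi] U ind by blast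
    also have "\<dots> = Pi\<^sub>M ?I D" by (rule PiM_cong) (auto simp: D_def r_def)
    finally show ?thesis .
  qed
  let ?h = "\<lambda>u. g (u i0) * (\<Prod>i\<in>J. f i (u i0) (u i))"
  have mf: "(\<lambda>u. f i (u i0) (u i)) \<in> borel_measurable (Pi\<^sub>M ?I Mi)" if i: "i \<in> J" for i
  proof -
    have "(\<lambda>u. (u i0, u i)) \<in> Pi\<^sub>M ?I Mi \<rightarrow>\<^sub>M Mi i0 \<Otimes>\<^sub>M Mi i"
      using i by (intro measurable_Pair measurable_component_singleton) auto
    from measurable_compose[OF this f[OF i]] show ?thesis by simp
  qed
  have "(\<lambda>u. g (u i0)) \<in> borel_measurable (Pi\<^sub>M ?I Mi)"
    using measurable_compose[OF measurable_component_singleton[of i0 ?I Mi] g] by simp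
  then have mh: "?h \<in> borel_measurable (Pi\<^sub>M ?I Mi)"
    using mf by (intro borel_measurable_times_ennreal borel_measurable_prod_ennreal) auto
  then have mh': "?h \<in> borel_measurable (Pi\<^sub>M ?I D)"
    by (rule measurable_cong_sets[THEN equalityD1, THEN subsetD, rotated 2])
       (auto intro!: sets_PiM_cong simp: sD)
  have mU: "(\<lambda>w. \<lambda>i\<in>?I. U i w) \<in> M \<rightarrow>\<^sub>M Pi\<^sub>M ?I Mi"
    using U by (intro measurable_restrict) auto
  have "(\<integral>\<^sup>+w. g (U i0 w) * (\<Prod>i\<in>J. f i (U i0 w) (U i w)) \<partial>M)
      = (\<integral>\<^sup>+w. ?h (\<lambda>i\<in>?I. U i w) \<partial>M)"
    by (intro nn_integral_cong) simp
  also have "\<dots> = (\<integral>\<^sup>+u. ?h u \<partial>Pi\<^sub>M ?I D)"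
    unfolding law[symmetric] by (rule nn_integral_distr[OF mU, symmetric]) (simp add: mh)
  also have "\<dots> = (\<integral>\<^sup>+y. (\<integral>\<^sup>+u. ?h (u(i0 := y)) \<partial>Pi\<^sub>M J D) \<partial>D i0)"
    by (rule PD.product_nn_integral_insert_rev[OF J mh'])
  also have "\<dots> = (\<integral>\<^sup>+y. g y * (\<Prod>i\<in>J. \<integral>\<^sup>+w'. f i y (U i w') \<partial>M) \<partial>D i0)"
  proof (rule nn_integral_cong)
    fix y assume "y \<in> space (D i0)"
    then have y: "y \<in> space (Mi i0)" by (simp add: D_def r_def)
    have fy: "f i y \<in> borel_measurable (Mi i)" if "i \<in> J" for i
      using measurable_compose[OF measurable_Pair1'[OF y] f[OF that]] by simp
    then have fyD: "f i y \<in> borel_measurable (D i)" if "i \<in> J" for i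
      using that sD[of i] by (simp cong: measurable_cong_sets)
    have "(\<integral>\<^sup>+u. ?h (u(i0 := y)) \<partial>Pi\<^sub>M J D) = (\<integral>\<^sup>+u. g y * (\<Prod>i\<in>J. f i y (u i)) \<partial>Pi\<^sub>M J D)"
      using J by (intro nn_integral_cong arg_cong2[where f="(*)"] prod.cong) auto
    also have "\<dots> = g y * (\<integral>\<^sup>+u. (\<Prod>i\<in>J. f i y (u i)) \<partial>Pi\<^sub>M J D)"
    proof (rule nn_integral_cmult, rule borel_measurable_prod_ennreal)
      show "(\<lambda>u. f i y (u i)) \<in> borel_measurable (Pi\<^sub>M J D)" if "i \<in> J" for i
        using measurable_compose[OF measurable_component_singleton[OF that, of D] fyD[OF that]] by simp
    qed
    also have "(\<integral>\<^sup>+u. (\<Prod>i\<in>J. f i y (u i)) \<partial>Pi\<^sub>M J D) = (\<Prod>i\<in>J. \<integral>\<^sup>+t. f i y t \<partial>D i)"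
      by (rule PD.product_nn_integral_prod[OF J(1) fyD])
    also have "\<dots> = (\<Prod>i\<in>J. \<integral>\<^sup>+w'. f i y (U i w') \<partial>M)"
    proof (rule prod.cong[OF refl])
      fix i assume i: "i \<in> J"
      then have "D i = distr M (Mi i) (U i)" by (simp add: D_def r_def)
      then show "(\<integral>\<^sup>+t. f i y t \<partial>D i) = (\<integral>\<^sup>+w'. f i y (U i w') \<partial>M)"
        using fy[OF i] U[of i] i by (simp add: nn_integral_distr)
    qed
    finally show "(\<integral>\<^sup>+u. ?h (u(i0 := y)) \<partial>Pi\<^sub>M J D) = g y * (\<Prod>i\<in>J. \<integral>\<^sup>+w'. f i y (U i w') \<partial>M)" .
  qed
  also have "\<dots> = (\<integral>\<^sup>+w. g (U i0 w) * (\<Prod>i\<in>J. \<integral>\<^sup>+w'. f i (U i0 w) (U i w') \<partial>M) \<partial>M)"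
  proof -
    have "D i0 = distr M (Mi i0) (U i0)" by (simp add: D_def r_def)
    moreover have "(\<lambda>y. \<integral>\<^sup>+w'. f i y (U i w') \<partial>M) \<in> borel_measurable (Mi i0)" if i: "i \<in> J" for i
    proof (rule borel_measurable_nn_integral)
      have "(\<lambda>p. (fst p, U i (snd p))) \<in> Mi i0 \<Otimes>\<^sub>M M \<rightarrow>\<^sub>M Mi i0 \<Otimes>\<^sub>M Mi i"
        using U[of i] i by (intro measurable_Pair measurable_fst measurable_compose[OF measurable_snd]) auto
      from measurable_compose[OF this f[OF i]]
      show "(\<lambda>(y, w'). f i y (U i w')) \<in> borel_measurable (Mi i0 \<Otimes>\<^sub>M M)"
        by (simp add: case_prod_beta')
    qed
    then have "(\<lambda>y. g y * (\<Prod>i\<in>J. \<integral>\<^sup>+w'. f i y (U i w') \<partial>M)) \<in> borel_measurable (Mi i0)"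
      by (intro borel_measurable_times_ennreal borel_measurable_prod_ennreal g)
    ultimately show ?thesis using U[of i0] by (simp add: nn_integral_distr)
  qed
  finally show ?thesis .
qed

text \<open>Treats the inputs as features of layer 0, so that the first layer, which applies no
  \<sigma>, obeys the same recursion as the others.\<close>

definition feat :: "(nat \<Rightarrow> nat) \<Rightarrow> (real \<Rightarrow> real) \<Rightarrow> (nat \<Rightarrow> nat \<Rightarrow> real) \<Rightarrow> (nat \<Rightarrow> nat \<Rightarrow> nat \<Rightarrow> real)
    \<Rightarrow> nat \<Rightarrow> (nat \<Rightarrow> real) \<Rightarrow> nat \<Rightarrow> real" where
  "feat N \<sigma> b W l x k = (if l = 0 then x k else \<sigma> (netZ N \<sigma> b W l x k))"

lemma netZ_Suc_feat:
  "netZ N \<sigma> b W (Suc l) x i = b (Suc l) i + (\<Sum>j=1..N l. W (Suc l) i j * feat N \<sigma> b W l x j)"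
  by (cases l) (simp_all add: feat_def)

definition params_upto :: "(nat \<Rightarrow> nat) \<Rightarrow> nat \<Rightarrow> (nat \<times> nat + nat \<times> nat \<times> nat) set" where
  "params_upto N l = {Inl (l', i) | l' i. l' \<in> {1..l} \<and> i \<in> {1..N l'}} \<union>
     {Inr (l', i, j) | l' i j. l' \<in> {1..l} \<and> i \<in> {1..N l'} \<and> j \<in> {1..N (l' - 1)}}"

lemma param_index_eq: "param_index N L = params_upto N (Suc L)"
  by (simp add: param_index_def params_upto_def)

lemma params_upto_iff [simp]:
  "Inl (l', i) \<in> params_upto N l \<longleftrightarrow> l' \<in> {1..l} \<and> i \<in> {1..N l'}"
  "Inr (l', i, j) \<in> params_upto N l \<longleftrightarrow> l' \<in> {1..l} \<and> i \<in> {1..N l'} \<and> j \<in> {1..N (l' - 1)}"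
  by (auto simp: params_upto_def)

text \<open>\<open>n\<close> is the width of the preceding layer, \<open>l\<close> the layer of the
  neuron and \<open>i\<close> its number. These sets, for different neurons, are disjoint blocks of
  independent parameters.\<close>

definition neuron_params :: "nat \<Rightarrow> nat \<Rightarrow> nat \<Rightarrow> (nat \<times> nat + nat \<times> nat \<times> nat) set" where
  "neuron_params n l i = insert (Inl (l, i)) ((\<lambda>j. Inr (l, i, j)) ` {1..n})"

lemma finite_neuron_params: "finite (neuron_params n l i)"
  by (simp add: neuron_params_def)

lemma sum_neuron_params:
  "(\<Sum>k\<in>neuron_params n l i. f k) = f (Inl (l, i)) + (\<Sum>j=1..n. f (Inr (l, i, j)))"
  unfolding neuron_params_def by (subst sum.insert) (auto simp: sum.reindex inj_on_def)

lemma feat_cong: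
  assumes "\<And>k. k \<in> params_upto N l \<Longrightarrow> p k = p' k" "i \<in> {1..N l}"
  shows "feat N \<sigma> (\<lambda>l i. p (Inl (l, i))) (\<lambda>l i j. p (Inr (l, i, j))) l x i
       = feat N \<sigma> (\<lambda>l i. p' (Inl (l, i))) (\<lambda>l i j. p' (Inr (l, i, j))) l x i"
  using assms
proof (induction l arbitrary: i)
  case (Suc l)
  have "feat N \<sigma> (\<lambda>l i. p (Inl (l, i))) (\<lambda>l i j. p (Inr (l, i, j))) l x j
      = feat N \<sigma> (\<lambda>l i. p' (Inl (l, i))) (\<lambda>l i j. p' (Inr (l, i, j))) l x j" if j: "j \<in> {1..N l}" for j
  proof (rule Suc.IH[OF _ j])
    fix k assume "k \<in> params_upto N l"
    then have "k \<in> params_upto N (Suc l)" by (auto simp: params_upto_def)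
    then show "p k = p' k" by (rule Suc.prems)
  qed
  moreover have "p (Inl (Suc l, i)) = p' (Inl (Suc l, i))"
    using Suc.prems by (intro Suc.prems(1)) auto
  moreover have "p (Inr (Suc l, i, j)) = p' (Inr (Suc l, i, j))" if "j \<in> {1..N l}" for j
    using Suc.prems that by (intro Suc.prems(1)) auto
  ultimately show ?case by (simp add: feat_def[of _ _ _ _ "Suc l"] netZ_Suc_feat)
qed (simp add: feat_def)

lemma feat_measurable:
  assumes "\<And>k. k \<in> params_upto N l \<Longrightarrow> (\<lambda>w. p w k) \<in> borel_measurable M" "i \<in> {1..N l}"
    and \<sigma>: "\<sigma> \<in> borel_measurable borel"
  shows "(\<lambda>w. feat N \<sigma> (\<lambda>l i. p w (Inl (l, i))) (\<lambda>l i j. p w (Inr (l, i, j))) l x i) \<in> borel_measurable M"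
  using assms(1,2)
proof (induction l arbitrary: i)
  case (Suc l)
  have "(\<lambda>w. feat N \<sigma> (\<lambda>l i. p w (Inl (l, i))) (\<lambda>l i j. p w (Inr (l, i, j))) l x j) \<in> borel_measurable M"
    if j: "j \<in> {1..N l}" for j
  proof (rule Suc.IH[OF _ j])
    fix k assume "k \<in> params_upto N l"
    then have "k \<in> params_upto N (Suc l)" by (auto simp: params_upto_def)
    then show "(\<lambda>w. p w k) \<in> borel_measurable M" by (rule Suc.prems)
  qed
  moreover have "(\<lambda>w. p w (Inl (Suc l, i))) \<in> borel_measurable M"
    using Suc.prems by (intro Suc.prems(1)) auto
  moreover have "(\<lambda>w. p w (Inr (Suc l, i, j))) \<in> borel_measurable M" if "j \<in> {1..N l}" for j
    using Suc.prems that by (intro Suc.prems(1)) auto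
  ultimately have "(\<lambda>w. p w (Inl (Suc l, i)) + (\<Sum>j=1..N l. p w (Inr (Suc l, i, j)) *
      feat N \<sigma> (\<lambda>l i. p w (Inl (l, i))) (\<lambda>l i j. p w (Inr (l, i, j))) l x j)) \<in> borel_measurable M"
    by (intro borel_measurable_add borel_measurable_sum borel_measurable_times)
  from measurable_compose[OF this \<sigma>] show ?case
    by (simp add: feat_def[of _ _ _ _ "Suc l"] netZ_Suc_feat)
qed (simp add: feat_def)

definition cov_mat :: "real \<Rightarrow> real \<Rightarrow> nat \<Rightarrow> (nat \<Rightarrow> 'a \<Rightarrow> real) \<Rightarrow> real^'a^'a::finite" where
  "cov_mat Cb Cw n s = (\<chi> \<alpha> \<beta>. Cb + Cw / real n * (\<Sum>j=1..n. s j \<alpha> * s j \<beta>))"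

text \<open>The bias counts as a weight whose feature is 1; this puts the matrix into the weighted
  outer-product form that the results on Gaussian sums expect.\<close>

lemma cov_mat_neuron_params:
  "cov_mat Cb Cw n s $ \<alpha> $ \<beta> = (\<Sum>k\<in>neuron_params n l i.
     (case k of Inl _ \<Rightarrow> Cb | Inr _ \<Rightarrow> Cw / real n) *
     ((case k of Inl _ \<Rightarrow> 1 | Inr (_, _, j) \<Rightarrow> s j \<alpha>) * (case k of Inl _ \<Rightarrow> 1 | Inr (_, _, j) \<Rightarrow> s j \<beta>)))"
  by (simp add: cov_mat_def sum_neuron_params sum_distrib_left)

lemma psd_cov_mat:
  assumes "Cb \<ge> 0" "Cw \<ge> 0"
  shows "psd_mat (cov_mat Cb Cw n s :: real^'a^'a::finite)"
  unfolding psd_mat_def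
proof (intro conjI allI)
  show "transpose (cov_mat Cb Cw n s) = (cov_mat Cb Cw n s :: real^'a^'a)"
    by (simp add: transpose_def vec_eq_iff cov_mat_def mult.commute)
  fix t :: "real^'a"
  show "0 \<le> t \<bullet> (cov_mat Cb Cw n s *v t)"
    \<comment> \<open>The layer and neuron numbers 0 are arbitrary, as the matrix does not depend on
      them.\<close>
    by (subst quadratic_form_outer_sum[OF cov_mat_neuron_params[of Cb Cw n s _ _ 0 0]])
       (use assms in \<open>auto intro!: sum_nonneg mult_nonneg_nonneg split: sum.split\<close>)
qed

lemma cov_mat_in_S:
  assumes "Cb \<ge> 0" "Cw \<ge> 0"
  shows "(cov_mat Cb Cw n s :: real^'a^'a::finite) \<in> S_set Cb"
proof -
  have "cov_mat Cb Cw n s - Cb *\<^sub>R ones_mat = (cov_mat 0 Cw n s :: real^'a^'a)"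
    by (simp add: vec_eq_iff cov_mat_def ones_mat_def)
  then show ?thesis using psd_cov_mat[of Cb Cw n s] psd_cov_mat[of 0 Cw n s] assms by (simp add: S_set_def)
qed

lemma borel_measurable_mat:
  fixes A :: "'b \<Rightarrow> real^'m::finite^'n::finite"
  assumes "\<And>\<alpha> \<beta>. (\<lambda>w. A w $ \<alpha> $ \<beta>) \<in> borel_measurable M"
  shows "A \<in> borel_measurable M"
proof -
  have "(\<lambda>w. A w \<bullet> c) \<in> borel_measurable M" for c :: "real^'m^'n"
    unfolding inner_vec_def inner_real_def
    by (intro borel_measurable_sum borel_measurable_times assms borel_measurable_const)
  then show ?thesis by (intro borel_measurable_euclidean_space[THEN iffD2]) auto
qed

lemma cov_mat_cong:
  "(\<And>j \<alpha>. j \<in> {1..n} \<Longrightarrow> s j \<alpha> = s' j \<alpha>) \<Longrightarrow> cov_mat Cb Cw n s = cov_mat Cb Cw n s'"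
  by (simp add: cov_mat_def)

text \<open>Cumulant generating function of a Gaussian matrix with independent columns of covariance
  \<open>q\<close>, one column for each output neuron.\<close>

definition gauss_cgf :: "real^'a^'a \<Rightarrow> real^'h^'a \<Rightarrow> real" where
  "gauss_cgf q \<theta> = (\<Sum>h\<in>UNIV. column h \<theta> \<bullet> (q *v column h \<theta>)) / 2"

text \<open>A single network with fixed widths. Everything proved here is an exact identity or a
  bound at fixed widths; limits enter only when a sequence of such networks is considered.\<close>

locale gauss_net = prob_space M for M :: "'b measure" +
  fixes N :: "nat \<Rightarrow> nat" and L :: nat and Cb Cw B :: real and \<sigma> :: "real \<Rightarrow> real"
    and x :: "'a::finite \<Rightarrow> nat \<Rightarrow> real"
    and b :: "nat \<Rightarrow> nat \<Rightarrow> 'b \<Rightarrow> real" and W :: "nat \<Rightarrow> nat \<Rightarrow> nat \<Rightarrow> 'b \<Rightarrow> real"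
  assumes Cb: "Cb \<ge> 0" and Cw: "Cw > 0"
    and indep: "indep_vars (\<lambda>_. borel) (\<lambda>k. case k of Inl (l, i) \<Rightarrow> b l i | Inr (l, i, j) \<Rightarrow> W l i j) (param_index N L)"
    and bgauss: "\<And>l i. l \<in> {1..L+1} \<Longrightarrow> i \<in> {1..N l} \<Longrightarrow> centered_gaussian M (b l i) Cb"
    and Wgauss: "\<And>l i j. l \<in> {1..L+1} \<Longrightarrow> i \<in> {1..N l} \<Longrightarrow> j \<in> {1..N (l - 1)} \<Longrightarrow>
        centered_gaussian M (W l i j) (Cw / real (N (l - 1)))"
    and Npos: "\<And>l. l \<in> {1..L} \<Longrightarrow> N l \<ge> 1"
    and \<sigma>cont: "continuous_on UNIV \<sigma>" and \<sigma>bdd: "\<And>t. \<bar>\<sigma> t\<bar> \<le> B"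
begin

definition X :: "nat \<times> nat + nat \<times> nat \<times> nat \<Rightarrow> 'b \<Rightarrow> real" where
  "X k = (case k of Inl (l, i) \<Rightarrow> b l i | Inr (l, i, j) \<Rightarrow> W l i j)"

lemma X_simps [simp]: "X (Inl (l, i)) = b l i" "X (Inr (l, i, j)) = W l i j"
  by (simp_all add: X_def)

lemma indepX: "indep_vars (\<lambda>_. borel) X (params_upto N (Suc L))"
  using indep by (simp add: X_def[abs_def] param_index_eq)

lemma measX: "k \<in> params_upto N (Suc L) \<Longrightarrow> X k \<in> borel_measurable M"
  using indepX by (auto simp: indep_vars_def)

definition Z :: "nat \<Rightarrow> 'a \<Rightarrow> nat \<Rightarrow> 'b \<Rightarrow> real" where
  "Z l \<alpha> i w = netZ N \<sigma> (\<lambda>l i. b l i w) (\<lambda>l i j. W l i j w) l (x \<alpha>) i"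

definition ft :: "nat \<Rightarrow> nat \<Rightarrow> 'a \<Rightarrow> 'b \<Rightarrow> real" where
  "ft l j \<alpha> w = feat N \<sigma> (\<lambda>l i. b l i w) (\<lambda>l i j. W l i j w) l (x \<alpha>) j"

text \<open>Covariance of the neurons of layer l + 1 given the parameters up to layer
  \<open>l\<close>. For positive \<open>l\<close> it is an affine function of the empirical mean
  \<open>Y l\<close>, to which the cumulant theory applies.\<close>

definition G :: "nat \<Rightarrow> 'b \<Rightarrow> real^'a^'a" where
  "G l w = cov_mat Cb Cw (N l) (\<lambda>j \<alpha>. ft l j \<alpha> w)"

definition Y :: "nat \<Rightarrow> 'b \<Rightarrow> real^'a^'a" where
  "Y l w = (1 / real (N l)) *\<^sub>R (\<Sum>i=1..N l. feature_mat \<sigma> (\<lambda>\<alpha>. Z l \<alpha> i w))"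

lemma G_in_S: "G l w \<in> S_set Cb"
  unfolding G_def using Cb Cw by (intro cov_mat_in_S) auto

lemma G_zero: "G 0 w = g0_mat Cb Cw (N 0) x"
  by (simp add: G_def cov_mat_def g0_mat_def ft_def feat_def)

lemma G_pos: "l \<noteq> 0 \<Longrightarrow> G l w = Cb *\<^sub>R ones_mat + Cw *\<^sub>R Y l w"
  by (simp add: G_def cov_mat_def ones_mat_def Y_def ft_def feat_def Z_def feature_mat_def vec_eq_iff)

lemma \<sigma>meas: "\<sigma> \<in> borel_measurable borel"
  using \<sigma>cont by (rule borel_measurable_continuous_onI)

lemma measft:
  assumes "l \<le> L" "j \<in> {1..N l}"
  shows "ft l j \<alpha> \<in> borel_measurable M"
proof -
  have "X k \<in> borel_measurable M" if "k \<in> params_upto N l" for k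
    using that assms by (intro measX) (auto simp: params_upto_def)
  from feat_measurable[where N=N and l=l and p="\<lambda>w k. X k w", OF this assms(2) \<sigma>meas, of "x \<alpha>"]
  show ?thesis by (simp add: ft_def[abs_def])
qed

lemma Z_Suc: "Z (Suc l) \<alpha> i w = b (Suc l) i w + (\<Sum>j=1..N l. W (Suc l) i j w * ft l j \<alpha> w)"
  by (simp add: Z_def netZ_Suc_feat ft_def)

lemma measZ:
  assumes "l \<le> L" "i \<in> {1..N (Suc l)}"
  shows "Z (Suc l) \<alpha> i \<in> borel_measurable M"
proof -
  have "b (Suc l) i \<in> borel_measurable M" using measX[of "Inl (Suc l, i)"] assms by simp
  moreover have "W (Suc l) i j \<in> borel_measurable M" if "j \<in> {1..N l}" for j
    using measX[of "Inr (Suc l, i, j)"] assms that by simp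
  ultimately show ?thesis unfolding Z_Suc[abs_def]
    using measft[OF assms(1)] by (intro borel_measurable_add borel_measurable_sum borel_measurable_times) auto
qed

lemma measG: "l \<le> L \<Longrightarrow> G l \<in> borel_measurable M"
  by (intro borel_measurable_mat)
     (auto simp: G_def cov_mat_def intro!: borel_measurable_add borel_measurable_divide borel_measurable_times
       borel_measurable_sum measft)

lemma measY: "l \<le> L \<Longrightarrow> Y (Suc l) \<in> borel_measurable M"
  unfolding Y_def[abs_def]
  by (intro borel_measurable_scaleR borel_measurable_sum borel_measurable_const borel_measurable_mat)
     (auto simp: feature_mat_def intro!: borel_measurable_times measurable_compose[OF measZ \<sigma>meas])

lemma layer_conditional:
  fixes F :: "nat \<Rightarrow> ('a \<Rightarrow> real) \<Rightarrow> ennreal" and H :: "nat \<Rightarrow> real^'a^'a \<Rightarrow> ennreal"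
  assumes l: "l \<le> L" and D: "D \<in> sets borel"
    and F: "\<And>i. i \<in> {1..N (Suc l)} \<Longrightarrow> F i \<in> borel_measurable pi_borel"
    and H: "\<And>i s. i \<in> {1..N (Suc l)} \<Longrightarrow>
      (\<integral>\<^sup>+w. F i (\<lambda>\<alpha>. b (Suc l) i w + (\<Sum>j=1..N l. W (Suc l) i j w * s j \<alpha>)) \<partial>M) = H i (cov_mat Cb Cw (N l) s)"
  shows "(\<integral>\<^sup>+w. indicator D (G l w) * (\<Prod>i\<in>{1..N (Suc l)}. F i (\<lambda>\<alpha>. Z (Suc l) \<alpha> i w)) \<partial>M)
       = (\<integral>\<^sup>+w. indicator D (G l w) * (\<Prod>i\<in>{1..N (Suc l)}. H i (G l w)) \<partial>M)"
proof -
  let ?J = "{1..N (Suc l)}"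
  \<comment> \<open>Neurons are numbered from 1, so block 0 is free for all parameters of the layers
    up to \<open>l\<close>.\<close>
  define K where "K i = (if i = 0 then params_upto N l else neuron_params (N l) (Suc l) i)" for i
  define U where "U i w = restrict (\<lambda>k. X k w) (K i)" for i w
  define fu where "fu u j \<alpha> = feat N \<sigma> (\<lambda>l i. u (Inl (l, i))) (\<lambda>l i j. u (Inr (l, i, j))) l (x \<alpha>) j"
    for u :: "nat \<times> nat + nat \<times> nat \<times> nat \<Rightarrow> real" and j \<alpha>
  define g where "g u = (indicator D (cov_mat Cb Cw (N l) (fu u)) :: ennreal)" for u
  define f where "f i u t = F i (\<lambda>\<alpha>. t (Inl (Suc l, i)) + (\<Sum>j=1..N l. t (Inr (Suc l, i, j)) * fu u j \<alpha>))"
    for i u and t :: "nat \<times> nat + nat \<times> nat \<times> nat \<Rightarrow> real"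
  let ?Mi = "\<lambda>i. Pi\<^sub>M (K i) (\<lambda>_. borel :: real measure)"
  have ind: "indep_vars ?Mi U (insert 0 ?J)"
    unfolding U_def
  proof (rule indep_vars_restrict[OF indepX])
    show "K i \<subseteq> params_upto N (Suc L)" if "i \<in> insert 0 ?J" for i
      using that l by (auto simp: K_def params_upto_def neuron_params_def)
    show "disjoint_family_on K (insert 0 ?J)"
      by (auto simp: disjoint_family_on_def K_def params_upto_def neuron_params_def)
  qed
  have mfu: "(\<lambda>u. fu u j \<alpha>) \<in> borel_measurable (?Mi 0)" if "j \<in> {1..N l}" for j \<alpha>
    unfolding fu_def
    by (rule feat_measurable[where N=N and l=l and p="\<lambda>u. u", OF _ that \<sigma>meas]) (auto simp: K_def intro!: measurable_component_singleton)
  have mc: "(\<lambda>u. cov_mat Cb Cw (N l) (fu u)) \<in> borel_measurable (?Mi 0)"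
    by (intro borel_measurable_mat)
       (auto simp: cov_mat_def intro!: borel_measurable_add borel_measurable_divide borel_measurable_times
         borel_measurable_sum mfu)
  have mg: "g \<in> borel_measurable (?Mi 0)"
    unfolding g_def[abs_def] using measurable_compose[OF mc borel_measurable_indicator[OF D]] by simp
  have mf: "case_prod (f i) \<in> borel_measurable (?Mi 0 \<Otimes>\<^sub>M ?Mi i)" if i: "i \<in> ?J" for i
  proof -
    have m1: "(\<lambda>p. snd p k) \<in> borel_measurable (?Mi 0 \<Otimes>\<^sub>M ?Mi i)" if "k \<in> K i" for k
      by (rule measurable_compose[OF measurable_snd measurable_component_singleton[OF that, of "\<lambda>_. borel :: real measure"]])
    have m2: "(\<lambda>p. fu (fst p) j \<alpha>) \<in> borel_measurable (?Mi 0 \<Otimes>\<^sub>M ?Mi i)" if "j \<in> {1..N l}" for j \<alpha>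
      by (rule measurable_compose[OF measurable_fst mfu[OF that]])
    have "(\<lambda>p. snd p (Inl (Suc l, i)) + (\<Sum>j=1..N l. snd p (Inr (Suc l, i, j)) * fu (fst p) j \<alpha>))
        \<in> borel_measurable (?Mi 0 \<Otimes>\<^sub>M ?Mi i)" for \<alpha>
      using i by (intro borel_measurable_add borel_measurable_sum borel_measurable_times m1 m2)
        (auto simp: K_def neuron_params_def)
    then have "(\<lambda>p \<alpha>. snd p (Inl (Suc l, i)) + (\<Sum>j=1..N l. snd p (Inr (Suc l, i, j)) * fu (fst p) j \<alpha>))
        \<in> ?Mi 0 \<Otimes>\<^sub>M ?Mi i \<rightarrow>\<^sub>M pi_borel"
      by (intro measurable_PiM_single') auto
    from measurable_compose[OF this F[OF i]] show ?thesis
      by (simp add: f_def case_prod_beta')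
  qed
  have fuU: "fu (U 0 w) j \<alpha> = ft l j \<alpha> w" if "j \<in> {1..N l}" for j \<alpha> w
    unfolding fu_def ft_def
    using feat_cong[of N l "U 0 w" "\<lambda>k. X k w", OF _ that] by (simp add: U_def K_def)
  have gU: "g (U 0 w) = indicator D (G l w)" for w
    unfolding g_def G_def using cov_mat_cong[of "N l" "fu (U 0 w)" "\<lambda>j \<alpha>. ft l j \<alpha> w"] fuU by auto
  have fU': "f i (U 0 w) (U i w') = F i (\<lambda>\<alpha>. b (Suc l) i w' + (\<Sum>j=1..N l. W (Suc l) i j w' * ft l j \<alpha> w))"
    if i: "i \<in> ?J" for i w w'
    unfolding f_def using i
    by (intro arg_cong[where f="F i"] ext arg_cong2[where f="(+)"] sum.cong refl arg_cong2[where f="(*)"] fuU)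
       (auto simp: U_def K_def neuron_params_def)
  have "(\<integral>\<^sup>+w. indicator D (G l w) * (\<Prod>i\<in>?J. F i (\<lambda>\<alpha>. Z (Suc l) \<alpha> i w)) \<partial>M)
      = (\<integral>\<^sup>+w. g (U 0 w) * (\<Prod>i\<in>?J. f i (U 0 w) (U i w)) \<partial>M)"
    by (simp add: gU fU' Z_Suc)
  also have "\<dots> = (\<integral>\<^sup>+w. g (U 0 w) * (\<Prod>i\<in>?J. \<integral>\<^sup>+w'. f i (U 0 w) (U i w') \<partial>M) \<partial>M)"
    by (rule indep_conditional_product[where Mi="?Mi", OF _ _ ind mg mf]) auto
  also have "\<dots> = (\<integral>\<^sup>+w. indicator D (G l w) * (\<Prod>i\<in>?J. H i (G l w)) \<partial>M)"
  proof -
    have "(\<integral>\<^sup>+w'. f i (U 0 w) (U i w') \<partial>M) = H i (G l w)" if i: "i \<in> ?J" for i w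
      using H[OF i, of "\<lambda>j \<alpha>. ft l j \<alpha> w"] by (simp add: fU'[OF i] G_def)
    then show ?thesis by (simp add: gU)
  qed
  finally show ?thesis .
qed

lemma neuron_gaussian:
  assumes l: "l \<le> L" and i: "i \<in> {1..N (Suc l)}"
  shows "indep_vars (\<lambda>_. borel) X (neuron_params (N l) (Suc l) i)"
    and "\<And>k. k \<in> neuron_params (N l) (Suc l) i \<Longrightarrow>
      centered_gaussian M (X k) (case k of Inl _ \<Rightarrow> Cb | Inr _ \<Rightarrow> Cw / real (N l))"
    and "\<And>k. k \<in> neuron_params (N l) (Suc l) i \<Longrightarrow> 0 \<le> (case k of Inl _ \<Rightarrow> Cb | Inr _ \<Rightarrow> Cw / real (N l))"
proof -
  show "indep_vars (\<lambda>_. borel) X (neuron_params (N l) (Suc l) i)"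
    using l i by (intro indep_vars_subset[OF indepX]) (auto simp: neuron_params_def)
  fix k assume "k \<in> neuron_params (N l) (Suc l) i"
  then show "centered_gaussian M (X k) (case k of Inl _ \<Rightarrow> Cb | Inr _ \<Rightarrow> Cw / real (N l))"
    using l i bgauss[of "Suc l" i] Wgauss[of "Suc l" i] by (auto simp: neuron_params_def)
  show "0 \<le> (case k of Inl _ \<Rightarrow> Cb | Inr _ \<Rightarrow> Cw / real (N l))" using Cb Cw by (auto split: sum.split)
qed

lemma neuron_sum:
  "(\<Sum>k\<in>neuron_params (N l) (Suc l) i. (case k of Inl _ \<Rightarrow> 1 | Inr (_, _, j) \<Rightarrow> s j \<alpha>) * X k w)
    = b (Suc l) i w + (\<Sum>j=1..N l. W (Suc l) i j w * s j \<alpha>)"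
  by (simp add: sum_neuron_params mult.commute)

text \<open>The width times \<eta>.Y is a sum over neurons, so the exponential factorises, and each
  neuron contributes the same conditional factor exp \<kappa>.\<close>

lemma hidden_mgf_link:
  assumes l: "l < L"
  shows "mgf_link M (G l) (Y (Suc l)) (real (N (Suc l))) (\<lambda>q \<eta>. kappa \<sigma> \<eta> q)"
  unfolding mgf_link_def
proof (intro conjI allI ballI prob_space_axioms measG measY)
  fix \<eta> :: "real^'a^'a" and D :: "(real^'a^'a) set" assume D: "D \<in> sets borel"
  have lL: "l \<le> L" using l by simp
  have N1: "N (Suc l) \<ge> 1" using l by (intro Npos) auto
  let ?F = "\<lambda>z. exp (\<eta> \<bullet> feature_mat \<sigma> z)"
  let ?C = "norm \<eta> * (CARD('a) * (CARD('a) * B\<^sup>2))"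
  have Fc: "continuous_on UNIV (?F :: ('a \<Rightarrow> real) \<Rightarrow> real)"
    unfolding inner_feature_mat
    by (intro continuous_intros continuous_on_compose2[OF \<sigma>cont] continuous_on_product_coordinates) auto
  have FB: "?F z \<le> exp ?C" for z
    using abs_inner_feature_mat_le[of \<sigma> B \<eta> z, OF \<sigma>bdd] by (simp add: abs_le_iff)
  have Fm: "(\<lambda>z. ennreal (?F z)) \<in> borel_measurable pi_borel"
    using continuous_fun_measurable[OF Fc] by measurable
  have H: "(\<integral>\<^sup>+w. ennreal (?F (\<lambda>\<alpha>. b (Suc l) i w + (\<Sum>j=1..N l. W (Suc l) i j w * s j \<alpha>))) \<partial>M)
      = ennreal (exp (kappa \<sigma> \<eta> (cov_mat Cb Cw (N l) s)))" if i: "i \<in> {1..N (Suc l)}" for i s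
  proof -
    let ?V = "\<lambda>w \<alpha>. b (Suc l) i w + (\<Sum>j=1..N l. W (Suc l) i j w * s j \<alpha>)"
    have "(\<lambda>w. ?V w \<alpha>) \<in> borel_measurable M" for \<alpha>
      using measX[of "Inl (Suc l, i)"] measX[of "Inr (Suc l, i, j)" for j] l i
      by (intro borel_measurable_add borel_measurable_sum borel_measurable_times borel_measurable_const) auto
    then have "?V \<in> M \<rightarrow>\<^sub>M pi_borel" by (intro measurable_PiM_single') auto
    then have m: "(\<lambda>w. ?F (?V w)) \<in> borel_measurable M"
      by (rule measurable_compose[OF _ continuous_fun_measurable[OF Fc]])
    have "(\<integral>\<^sup>+w. ennreal (?F (?V w)) \<partial>M) = ennreal (\<integral>w. ?F (?V w) \<partial>M)"
      by (rule nn_integral_eq_integral) (use m FB in \<open>auto intro!: integrable_const_bound[where B="exp ?C"]\<close>)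
    also have "(\<integral>w. ?F (?V w) \<partial>M) = (\<integral>y. ?F (\<lambda>\<alpha>. gproj (cov_mat Cb Cw (N l) s) \<alpha> y) \<partial>std_gauss_vec)"
      using gaussian_sum_law[OF finite_neuron_params neuron_gaussian[OF lL i] cov_mat_neuron_params psd_cov_mat Fc _ FB,
          of s] Cb Cw
      by (simp add: neuron_sum)
    finally show ?thesis by (simp add: exp_kappa(1)[OF \<sigma>cont \<sigma>bdd])
  qed
  have prodF: "(\<Prod>i\<in>{1..N (Suc l)}. ennreal (?F (\<lambda>\<alpha>. Z (Suc l) \<alpha> i w))) = ennreal (exp (real (N (Suc l)) * (\<eta> \<bullet> Y (Suc l) w)))" for w
    using N1 by (simp add: prod_ennreal exp_sum[symmetric] Y_def inner_sum_right)
  have prodH: "(\<Prod>i\<in>{1..N (Suc l)}. ennreal (exp (kappa \<sigma> \<eta> q))) = ennreal (exp (real (N (Suc l)) * kappa \<sigma> \<eta> q))" for q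
    by (simp add: ennreal_power exp_of_nat_mult)
  show "(\<integral>\<^sup>+w. indicator D (G l w) * ennreal (exp (real (N (Suc l)) * (\<eta> \<bullet> Y (Suc l) w))) \<partial>M)
      = (\<integral>\<^sup>+w. indicator D (G l w) * ennreal (exp (real (N (Suc l)) * kappa \<sigma> \<eta> (G l w))) \<partial>M)"
    using layer_conditional[OF lL D Fm H] unfolding prodF prodH .
qed (use l in auto)

text \<open>Dividing by \<open>sqrt v\<close> and testing with \<open>v * \<theta>\<close> amounts
  to testing the neurons with \<open>sqrt v * \<theta>\<close>, so the quadratic cumulants acquire
  exactly the factor \<open>v\<close>. The test functions are unbounded here, so the moment
  generating function of the Gaussian sum is computed directly.\<close>

lemma output_mgf_link:
  fixes hidx :: "'h::finite \<Rightarrow> nat"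
  assumes hidx: "bij_betw hidx UNIV {1..N (Suc L)}" and v: "v > 0"
  shows "mgf_link M (G L) (\<lambda>w. (\<chi> \<alpha> h. Z (Suc L) \<alpha> (hidx h) w / sqrt v) :: real^'h^'a) v gauss_cgf"
  unfolding mgf_link_def
proof (intro conjI allI ballI prob_space_axioms measG order_refl)
  let ?Y = "\<lambda>w. (\<chi> \<alpha> h. Z (Suc L) \<alpha> (hidx h) w / sqrt v) :: real^'h^'a"
  have hin: "hidx h \<in> {1..N (Suc L)}" for h using hidx by (auto simp: bij_betw_def)
  show "?Y \<in> borel_measurable M"
    by (intro borel_measurable_mat) (use measZ[of L] hin in \<open>auto intro!: borel_measurable_divide\<close>)
  fix \<theta> :: "real^'h^'a" and D :: "(real^'a^'a) set" assume D: "D \<in> sets borel"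
  \<comment> \<open>The product runs over neuron numbers, while the columns of \<theta> are indexed
    by the type \<open>'h\<close>.\<close>
  define hi where "hi = inv_into UNIV hidx"
  have hi: "hi (hidx h) = h" for h
    using hidx by (simp add: hi_def bij_betw_def)
  let ?u = "\<lambda>h \<alpha>. sqrt v * \<theta> $ \<alpha> $ h"
  let ?F = "\<lambda>i z. ennreal (exp (\<Sum>\<alpha>\<in>UNIV. ?u (hi i) \<alpha> * z \<alpha>))"
  let ?H = "\<lambda>i q. ennreal (exp (v * (column (hi i) \<theta> \<bullet> (q *v column (hi i) \<theta>)) / 2))"
  have H: "(\<integral>\<^sup>+w. ?F i (\<lambda>\<alpha>. b (Suc L) i w + (\<Sum>j=1..N L. W (Suc L) i j w * s j \<alpha>)) \<partial>M) = ?H i (cov_mat Cb Cw (N L) s)"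
    if i: "i \<in> {1..N (Suc L)}" for i s
  proof -
    let ?a = "\<lambda>k \<alpha>. case k of Inl _ \<Rightarrow> 1 | Inr (_, _, j) \<Rightarrow> s j \<alpha>"
    let ?s = "\<lambda>k. case k of Inl _ \<Rightarrow> Cb | Inr _ \<Rightarrow> Cw / real (N L)"
    let ?K = "neuron_params (N L) (Suc L) i"
    have "(\<integral>\<^sup>+w. ?F i (\<lambda>\<alpha>. b (Suc L) i w + (\<Sum>j=1..N L. W (Suc L) i j w * s j \<alpha>)) \<partial>M)
       = (\<integral>\<^sup>+w. ennreal (exp (\<Sum>k\<in>?K. (\<Sum>\<alpha>\<in>UNIV. ?u (hi i) \<alpha> * ?a k \<alpha>) * X k w)) \<partial>M)"
      unfolding neuron_sum[symmetric]
      by (intro nn_integral_cong arg_cong[where f="\<lambda>x. ennreal (exp x)"])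
         (simp only: sum_distrib_left sum_distrib_right mult.assoc, rule sum.swap)
    also have "\<dots> = ennreal (exp ((\<Sum>k\<in>?K. ?s k * (\<Sum>\<alpha>\<in>UNIV. ?u (hi i) \<alpha> * ?a k \<alpha>)\<^sup>2) / 2))"
      by (rule gaussian_sum_mgf[OF finite_neuron_params neuron_gaussian[OF order_refl i]])
    also have "(\<Sum>k\<in>?K. ?s k * (\<Sum>\<alpha>\<in>UNIV. ?u (hi i) \<alpha> * ?a k \<alpha>)\<^sup>2)
       = v * (column (hi i) \<theta> \<bullet> (cov_mat Cb Cw (N L) s *v column (hi i) \<theta>))"
      unfolding quadratic_form_outer_sum[OF cov_mat_neuron_params[of Cb Cw "N L" s _ _ "Suc L" i]]
      using v by (simp add: column_def sum_distrib_left[symmetric] mult.assoc power_mult_distrib mult.left_commute[of _ v])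
    finally show ?thesis .
  qed
  have Fm: "?F i \<in> borel_measurable pi_borel" for i by measurable
  have re: "(\<Prod>i\<in>{1..N (Suc L)}. f i) = (\<Prod>h\<in>UNIV. f (hidx h))" for f :: "nat \<Rightarrow> ennreal"
    by (rule prod.reindex_bij_betw[OF hidx, symmetric])
  have prodF: "(\<Prod>i\<in>{1..N (Suc L)}. ?F i (\<lambda>\<alpha>. Z (Suc L) \<alpha> i w)) = ennreal (exp (v * (\<theta> \<bullet> ?Y w)))" for w
  proof -
    have e: "v * (c / sqrt v) = sqrt v * c" for c
      using v real_div_sqrt[of v] by (metis less_imp_le times_divide_eq_left times_divide_eq_right)
    have "v * (\<theta> \<bullet> ?Y w) = (\<Sum>\<alpha>\<in>UNIV. \<Sum>h\<in>UNIV. ?u h \<alpha> * Z (Suc L) \<alpha> (hidx h) w)"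
      by (simp add: inner_vec_def sum_distrib_left e[symmetric] mult.assoc)
    also have "\<dots> = (\<Sum>h\<in>UNIV. \<Sum>\<alpha>\<in>UNIV. ?u h \<alpha> * Z (Suc L) \<alpha> (hidx h) w)"
      by (rule sum.swap)
    finally show ?thesis unfolding re hi by (simp add: prod_ennreal exp_sum[symmetric])
  qed
  have prodH: "(\<Prod>i\<in>{1..N (Suc L)}. ?H i q) = ennreal (exp (v * gauss_cgf q \<theta>))" for q
    unfolding re hi by (simp add: prod_ennreal exp_sum[symmetric] gauss_cgf_def sum_distrib_left sum_divide_distrib)
  show "(\<integral>\<^sup>+w. indicator D (G L w) * ennreal (exp (v * (\<theta> \<bullet> ?Y w))) \<partial>M)
      = (\<integral>\<^sup>+w. indicator D (G L w) * ennreal (exp (v * gauss_cgf (G L w) \<theta>)) \<partial>M)"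
    using layer_conditional[OF order_refl D Fm H] unfolding prodF prodH .
qed

end

section \<open>The rate function\<close>

lemma inner_matrix_columns:
  fixes A B :: "real^'h::finite^'a::finite"
  shows "A \<bullet> B = (\<Sum>h\<in>UNIV. column h A \<bullet> column h B)"
  by (simp add: inner_vec_def column_def) (rule sum.swap)

lemma column_matrix_mult: "column h (q ** \<theta>) = q *v column h \<theta>"
  by (simp add: vec_eq_iff column_def matrix_matrix_mult_def matrix_vector_mult_def)

lemma gauss_cgf_eq: "gauss_cgf q \<theta> = (\<theta> \<bullet> (q ** \<theta>)) / 2"
  by (simp add: gauss_cgf_def inner_matrix_columns column_matrix_mult)

lemma psd_mat_matrix_selfadjoint:
  "psd_mat q \<Longrightarrow> (q ** \<theta>) \<bullet> \<eta> = \<theta> \<bullet> (q ** \<eta>)"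
  by (simp add: inner_matrix_columns column_matrix_mult psd_mat_selfadjoint)

lemma psd_mat_matrix_nonneg: "psd_mat q \<Longrightarrow> 0 \<le> \<theta> \<bullet> (q ** \<theta>)"
  by (simp add: inner_matrix_columns column_matrix_mult psd_mat_def sum_nonneg)

lemma inner_matrix_mult_le:
  fixes q :: "real^'a^'a::finite" and \<theta> :: "real^'h::finite^'a"
  shows "\<theta> \<bullet> (q ** \<theta>) \<le> norm q * (norm \<theta>)\<^sup>2"
proof -
  have "v \<bullet> (q *v v) \<le> norm q * (v \<bullet> v)" for v
  proof -
    have "v \<bullet> (q *v v) \<le> norm v * norm (q *v v)" by (rule norm_cauchy_schwarz)
    also have "\<dots> \<le> norm v * (norm q * norm v)" by (intro mult_left_mono norm_matrix_vector_le) simp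
    finally show ?thesis by (simp add: power2_norm_eq_inner[symmetric] power2_eq_square mult_ac)
  qed
  then have "(\<Sum>h\<in>UNIV. column h \<theta> \<bullet> (q *v column h \<theta>)) \<le> (\<Sum>h\<in>UNIV. norm q * (column h \<theta> \<bullet> column h \<theta>))"
    by (intro sum_mono)
  then show ?thesis
    by (simp add: inner_matrix_columns column_matrix_mult power2_norm_eq_inner sum_distrib_left)
qed

text \<open>The second-order expansion of a quadratic form is exact, with remainder h.(q h) / 2
  between 0 and norm q * |h|^2 / 2.\<close>

lemma gauss_smooth_cgf:
  fixes q :: "real^'a^'a::finite"
  assumes q: "psd_mat q"
  shows "smooth_cgf (gauss_cgf q :: real^'h::finite^'a \<Rightarrow> real) (\<lambda>\<theta>. q ** \<theta>) (norm q)"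
proof -
  have e: "gauss_cgf q (\<eta> + h) = gauss_cgf q \<eta> + h \<bullet> (q ** \<eta>) + (h \<bullet> (q ** h)) / 2" for \<eta> h :: "real^'h^'a"
    using psd_mat_matrix_selfadjoint[OF q, of \<eta> h]
    by (simp add: gauss_cgf_eq matrix_add_ldistrib inner_add inner_commute[of h "q ** \<eta>"] field_simps)
  have "gauss_cgf q (\<eta> + h) \<le> gauss_cgf q \<eta> + h \<bullet> (q ** \<eta>) + norm q * (norm h)\<^sup>2" for \<eta> h :: "real^'h^'a"
    using inner_matrix_mult_le[of h q] psd_mat_matrix_nonneg[OF q, of h] by (simp add: e)
  moreover have "gauss_cgf q \<eta> + h \<bullet> (q ** \<eta>) \<le> gauss_cgf q (\<eta> + h)" for \<eta> h :: "real^'h^'a"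
    using psd_mat_matrix_nonneg[OF q, of h] by (simp add: e)
  ultimately show ?thesis by (auto simp: smooth_cgf_def gauss_cgf_eq)
qed

lemma continuous_on_gauss_cgf: "continuous_on S (\<lambda>q. gauss_cgf q \<theta>)"
  unfolding gauss_cgf_def inner_vec_def matrix_vector_mult_def
  by (intro continuous_intros) (auto intro!: continuous_intros)

lemma norm_psd_sqrt_matrix_mult:
  assumes "psd_mat q"
  shows "(norm (psd_sqrt q ** \<theta>))\<^sup>2 = \<theta> \<bullet> (q ** \<theta>)"
proof -
  have "(norm (psd_sqrt q ** \<theta>))\<^sup>2 = \<theta> \<bullet> (psd_sqrt q ** (psd_sqrt q ** \<theta>))"
    using psd_mat_matrix_selfadjoint[OF psd_sqrt(1)[OF assms]] by (simp add: power2_norm_eq_inner)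
  then show ?thesis by (simp add: matrix_mul_assoc psd_sqrt(2)[OF assms])
qed

text \<open>Weak duality: \<theta>.z = (q^# \<theta>).r is at most (|q^# \<theta>|^2 + |r|^2) / 2,
  and the first square is twice the cumulant.\<close>

lemma legendre_gauss_le:
  assumes q: "psd_mat q" and r: "psd_sqrt q ** r = z"
  shows "legendre (gauss_cgf q) z \<le> ereal ((norm r)\<^sup>2 / 2)"
  unfolding legendre_def
proof (rule SUP_least)
  fix \<theta>
  have "\<theta> \<bullet> z = (psd_sqrt q ** \<theta>) \<bullet> r"
    using psd_mat_matrix_selfadjoint[OF psd_sqrt(1)[OF q], of \<theta> r] r by simp
  moreover have "0 \<le> (norm (psd_sqrt q ** \<theta> - r))\<^sup>2" by simp
  then have "2 * ((psd_sqrt q ** \<theta>) \<bullet> r) \<le> (norm (psd_sqrt q ** \<theta>))\<^sup>2 + (norm r)\<^sup>2"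
    by (simp add: power2_norm_eq_inner inner_diff inner_commute)
  ultimately show "ereal (\<theta> \<bullet> z - gauss_cgf q \<theta>) \<le> ereal ((norm r)\<^sup>2 / 2)"
    by (simp add: gauss_cgf_eq norm_psd_sqrt_matrix_mult[OF q])
qed

text \<open>The preimages \<open>r\<^sub>n = q\<^sup># \<theta>\<^sub>n\<close> of near-optimal tilts have
  \<open>\<parallel>r\<^sub>n\<parallel>\<^sup>2 / 2\<close> bounded by the Legendre transform up to \<open>o(1)\<close>, so a limit point is a minimiser.\<close>

lemma legendre_gauss_attained:
  fixes q :: "real^'a^'a::finite" and z :: "real^'h::finite^'a"
  assumes q: "psd_mat q" and l: "legendre (gauss_cgf q) z = ereal l"
  obtains r where "psd_sqrt q ** r = z" "(norm r)\<^sup>2 / 2 \<le> l"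
proof -
  have "\<exists>\<theta>. norm (q ** \<theta> - z) < inverse (real (Suc n)) \<and> (\<theta> \<bullet> (q ** \<theta>)) / 2 < l + inverse (real (Suc n))" for n
  proof -
    have lt: "legendre (gauss_cgf q) z < ereal (l + inverse (real (Suc n)))" by (simp add: l)
    have "0 < inverse (real (Suc n))" by simp
    from legendre_approx[OF gauss_smooth_cgf[OF q] lt this] obtain \<theta> where
      "norm (q ** \<theta> - z) < inverse (real (Suc n))"
      "\<theta> \<bullet> (q ** \<theta>) - gauss_cgf q \<theta> < l + inverse (real (Suc n))" by blast
    then show ?thesis by (intro exI[of _ \<theta>]) (simp add: gauss_cgf_eq)
  qed
  then obtain \<theta> where \<theta>: "\<And>n. norm (q ** \<theta> n - z) < inverse (real (Suc n))"
      "\<And>n. (\<theta> n \<bullet> (q ** \<theta> n)) / 2 < l + inverse (real (Suc n))" by metis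
  define r where "r n = psd_sqrt q ** \<theta> n" for n
  have rn: "(norm (r n))\<^sup>2 / 2 < l + inverse (real (Suc n))" for n
    using \<theta>(2)[of n] by (simp add: r_def norm_psd_sqrt_matrix_mult[OF q])
  have "norm (r n) \<le> sqrt (2 * (l + 1))" for n
  proof (rule real_le_rsqrt)
    have "inverse (real (Suc n)) \<le> 1" by (simp add: inverse_le_1_iff)
    then show "(norm (r n))\<^sup>2 \<le> 2 * (l + 1)" using rn[of n] by simp
  qed
  then have "bounded (range r)" by (intro boundedI) auto
  then obtain r' f where f: "strict_mono f" "(r \<circ> f) \<longlonglongrightarrow> r'"
    using bounded_imp_convergent_subsequence by blast
  have c0: "(\<lambda>n. inverse (real (Suc n))) \<longlonglongrightarrow> 0" by (rule LIMSEQ_inverse_real_of_nat)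
  have "(\<lambda>n. norm (q ** \<theta> n - z)) \<longlonglongrightarrow> 0"
    by (rule tendsto_sandwich[OF _ _ tendsto_const c0]) (use \<theta>(1) in \<open>auto intro!: always_eventually less_imp_le\<close>)
  then have "(\<lambda>n. q ** \<theta> n) \<longlonglongrightarrow> z" by (simp add: tendsto_norm_zero_iff LIM_zero_iff)
  then have 1: "(\<lambda>n. psd_sqrt q ** r (f n)) \<longlonglongrightarrow> z"
    using LIMSEQ_subseq_LIMSEQ[OF _ f(1)] by (simp add: r_def matrix_mul_assoc psd_sqrt(2)[OF q] comp_def)
  have rf: "(\<lambda>n. r (f n)) \<longlonglongrightarrow> r'" using f(2) by (simp add: comp_def)
  have 2: "(\<lambda>n. psd_sqrt q ** r (f n)) \<longlonglongrightarrow> psd_sqrt q ** r'"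
    unfolding matrix_matrix_mult_def by (intro tendsto_intros tendsto_vec_lambda tendsto_vec_nth rf)
  have e: "psd_sqrt q ** r' = z" by (rule LIMSEQ_unique[OF 2 1])
  have "(\<lambda>n. (norm (r (f n)))\<^sup>2 / 2) \<longlonglongrightarrow> (norm r')\<^sup>2 / 2" by (intro tendsto_intros rf) simp
  moreover have "(\<lambda>n. l + inverse (real (Suc (f n)))) \<longlonglongrightarrow> l + 0"
    using LIMSEQ_subseq_LIMSEQ[OF c0 f(1)] by (intro tendsto_intros) (simp add: comp_def)
  ultimately have "(norm r')\<^sup>2 / 2 \<le> l + 0"
    by (rule LIMSEQ_le) (use rn in \<open>auto intro: less_imp_le\<close>)
  then show ?thesis using e by (intro that[of r']) auto
qed

section \<open>Path costs as a recursion over layers\<close>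

lemma kappa_star_eq: "kappa_star \<sigma> y q = legendre (\<lambda>\<eta>. kappa \<sigma> \<eta> q) y"
  by (simp add: kappa_star_def legendre_def inner_vec_def)

text \<open>The covariance is an affine function of the empirical mean, so its transition cost is
  \<open>step_rate\<close> in the rescaled variable, in both branches of \<gamma>.\<close>

lemma Jrate_eq:
  assumes Cw: "Cw > 0" and m: "m q 0 = ymat \<sigma> q"
  shows "Jrate \<sigma> Cb Cw gl g q = step_rate gl (\<lambda>q \<eta>. kappa \<sigma> \<eta> q) m ((1 / Cw) *\<^sub>R (g - Cb *\<^sub>R ones_mat)) q"
proof -
  have "(g = Cb *\<^sub>R ones_mat + Cw *\<^sub>R ymat \<sigma> q) \<longleftrightarrow> ((1 / Cw) *\<^sub>R (g - Cb *\<^sub>R ones_mat) = ymat \<sigma> q)"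
    using Cw by (auto simp: vec_eq_iff field_simps)
  then show ?thesis by (simp add: Jrate_def step_rate_def Delta_def kappa_star_eq m)
qed

lemma kappa_zero: "kappa \<sigma> 0 (q :: real^'a^'a::finite) = 0"
proof -
  interpret prob_space "std_gauss_vec :: ('a \<Rightarrow> real) measure" by (rule prob_space_std_gauss_vec)
  show ?thesis by (simp add: kappa_eq prob_space)
qed

lemma Jrate_nonneg: "gl \<ge> 1 \<Longrightarrow> 0 \<le> Jrate \<sigma> Cb Cw gl g q"
  using legendre_upper[of 0 "(1 / Cw) *\<^sub>R (g - Cb *\<^sub>R ones_mat)" "\<lambda>\<eta>. kappa \<sigma> \<eta> q"] order_trans[of 0 1 gl]
  by (auto simp: Jrate_def Delta_def kappa_star_eq kappa_zero zero_ereal_def[symmetric] intro!: ereal_0_le_mult)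

lemma IG_nonneg:
  assumes "\<And>l. l \<in> {1..L} \<Longrightarrow> \<gamma> l \<ge> 1"
  shows "0 \<le> IG \<sigma> Cb Cw L \<gamma> g0 g"
  unfolding IG_def by (intro INF_greatest sum_nonneg Jrate_nonneg assms)

text \<open>Depth 0 is not a network but starts the recursion: the two endpoint conditions fall on
  the same index, and the infimum over no path is infinite.\<close>

lemma IG_zero:
  fixes g0 g :: "real^'a^'a::finite"
  shows "IG \<sigma> Cb Cw 0 \<gamma> g0 g = (if g = g0 then 0 else \<infinity>)"
proof (cases "g = g0")
  case True
  then have "{gs :: nat \<Rightarrow> real^'a^'a. gs 0 = g0 \<and> gs 0 = g \<and> (\<forall>l\<in>{1..0 - 1}. gs l \<in> S_set Cb)} \<noteq> {}"
    by (auto intro!: exI[of _ "\<lambda>_. g0"])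
  then show ?thesis using True by (simp add: IG_def)
next
  case False
  then have "{gs :: nat \<Rightarrow> real^'a^'a. gs 0 = g0 \<and> gs 0 = g} = {}" by auto
  then show ?thesis using False by (simp add: IG_def top_ereal_def del: Collect_empty_eq)
qed

text \<open>Dynamic programming: a path of length l + 1 is cut before its last step. The cut point
  lies in \<open>S_set Cb\<close> by the constraint on interior points, or by the hypothesis on
  \<open>g0\<close> when l = 0.\<close>

lemma IG_Suc:
  fixes g0 g :: "real^'a^'a::finite"
  assumes \<gamma>: "\<And>k. k \<in> {1..Suc l} \<Longrightarrow> \<gamma> k \<ge> 1" and g0: "g0 \<in> S_set Cb"
  shows "IG \<sigma> Cb Cw (Suc l) \<gamma> g0 g = (INF q\<in>S_set Cb. IG \<sigma> Cb Cw l \<gamma> g0 q + Jrate \<sigma> Cb Cw (\<gamma> (Suc l)) g q)"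
proof (rule antisym)
  let ?J = "Jrate \<sigma> Cb Cw (\<gamma> (Suc l)) g"
  let ?T = "\<lambda>n gs. \<Sum>k=1..n. Jrate \<sigma> Cb Cw (\<gamma> k) (gs k) (gs (k - 1))"
  let ?A = "\<lambda>n g. {gs. gs 0 = g0 \<and> gs n = g \<and> (\<forall>k\<in>{1..n - 1}. gs k \<in> S_set Cb)}"
  have J0: "0 \<le> ?J q" for q by (intro Jrate_nonneg \<gamma>) simp
  show "IG \<sigma> Cb Cw (Suc l) \<gamma> g0 g \<le> (INF q\<in>S_set Cb. IG \<sigma> Cb Cw l \<gamma> g0 q + ?J q)"
  proof (rule INF_greatest)
    fix q :: "real^'a^'a" assume q: "q \<in> S_set Cb"
    have le: "IG \<sigma> Cb Cw (Suc l) \<gamma> g0 g \<le> ?T l gs + ?J q" if gs: "gs \<in> ?A l q" for gs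
    proof -
      define hs where "hs = gs(Suc l := g)"
      have "gs k \<in> S_set Cb" if "k \<in> {1..l}" for k
        using gs q that by (cases "k = l") auto
      then have "hs \<in> ?A (Suc l) g" using gs by (auto simp: hs_def)
      then have "IG \<sigma> Cb Cw (Suc l) \<gamma> g0 g \<le> ?T (Suc l) hs" unfolding IG_def by (rule INF_lower)
      also have "\<dots> = ?T l hs + ?J q" using gs by (simp add: hs_def)
      also have "?T l hs = ?T l gs" by (intro sum.cong refl) (auto simp: hs_def)
      finally show ?thesis .
    qed
    show "IG \<sigma> Cb Cw (Suc l) \<gamma> g0 g \<le> IG \<sigma> Cb Cw l \<gamma> g0 q + ?J q"
    \<comment> \<open>A finite cost of the last step can be subtracted, which moves it out of the
      infimum over paths; an infinite one makes the bound trivial.\<close>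
    proof (cases "?J q")
      case (real j)
      have "IG \<sigma> Cb Cw (Suc l) \<gamma> g0 g - ereal j \<le> ?T l gs" if "gs \<in> ?A l q" for gs
        using le[OF that] real by (simp add: ereal_minus_le)
      then have "IG \<sigma> Cb Cw (Suc l) \<gamma> g0 g - ereal j \<le> IG \<sigma> Cb Cw l \<gamma> g0 q"
        unfolding IG_def[of _ _ _ l] by (rule INF_greatest)
      then show ?thesis using real by (simp add: ereal_minus_le)
    qed (use J0[of q] in auto)
  qed
  show "(INF q\<in>S_set Cb. IG \<sigma> Cb Cw l \<gamma> g0 q + ?J q) \<le> IG \<sigma> Cb Cw (Suc l) \<gamma> g0 g"
    unfolding IG_def[of _ _ _ "Suc l"]
  proof (rule INF_greatest)
    fix gs assume gs: "gs \<in> ?A (Suc l) g"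
    then have q: "gs l \<in> S_set Cb" using g0 by (cases l) auto
    have "gs \<in> ?A l (gs l)" using gs by auto
    then have "IG \<sigma> Cb Cw l \<gamma> g0 (gs l) \<le> ?T l gs" unfolding IG_def by (rule INF_lower)
    then have "IG \<sigma> Cb Cw l \<gamma> g0 (gs l) + ?J (gs l) \<le> ?T l gs + ?J (gs l)" by (rule add_right_mono)
    also have "\<dots> = ?T (Suc l) gs" using gs by simp
    finally show "(INF q\<in>S_set Cb. IG \<sigma> Cb Cw l \<gamma> g0 q + ?J q) \<le> ?T (Suc l) gs"
      using q by (meson INF_lower2)
  qed
qed

text \<open>For fixed \<open>q\<close> the infimum over \<open>r\<close> is the Legendre transform
  of the Gaussian cumulants, so the output layer has the same shape as a hidden transition with
  ratio 1.\<close>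

lemma IZ_eq:
  fixes g0 :: "real^'a^'a::finite" and z :: "real^'h::finite^'a"
  assumes \<gamma>: "\<And>l. l \<in> {1..L} \<Longrightarrow> \<gamma> l \<ge> 1"
  shows "IZ \<sigma> Cb Cw L \<gamma> g0 z = (INF q\<in>S_set Cb. IG \<sigma> Cb Cw L \<gamma> g0 q + step_rate 1 gauss_cgf (**) z q)"
proof (rule antisym)
  have st: "step_rate 1 gauss_cgf (**) z q = legendre (gauss_cgf q) z" for q :: "real^'a^'a"
    by (simp add: step_rate_def)
  let ?I = "IG \<sigma> Cb Cw L \<gamma> g0"
  have I0: "0 \<le> ?I q" for q using \<gamma> by (rule IG_nonneg)
  show "IZ \<sigma> Cb Cw L \<gamma> g0 z \<le> (INF q\<in>S_set Cb. ?I q + step_rate 1 gauss_cgf (**) z q)"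
  proof (rule INF_greatest)
    fix q :: "real^'a^'a" assume q: "q \<in> S_set Cb"
    then have psd: "psd_mat q" by (simp add: S_set_def)
    have l0: "0 \<le> legendre (gauss_cgf q) z" by (rule legendre_nonneg[OF gauss_smooth_cgf[OF psd]])
    show "IZ \<sigma> Cb Cw L \<gamma> g0 z \<le> ?I q + step_rate 1 gauss_cgf (**) z q"
    proof (cases "legendre (gauss_cgf q) z")
      case (real l)
      obtain r where r: "psd_sqrt q ** r = z" "(norm r)\<^sup>2 / 2 \<le> l"
        using legendre_gauss_attained[OF psd real] by blast
      have "IZ \<sigma> Cb Cw L \<gamma> g0 z \<le> ?I (fst (q, r)) + ereal ((norm (snd (q, r)))\<^sup>2 / 2)"
        unfolding IZ_def by (rule INF_lower) (use q r in simp)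
      also have "\<dots> \<le> ?I q + ereal l" using r by (intro add_mono) auto
      finally show ?thesis by (simp add: st real)
    qed (use I0[of q] l0 in \<open>auto simp: st\<close>)
  qed
  show "(INF q\<in>S_set Cb. ?I q + step_rate 1 gauss_cgf (**) z q) \<le> IZ \<sigma> Cb Cw L \<gamma> g0 z"
    unfolding IZ_def
  proof (rule INF_greatest)
    fix p assume "p \<in> {(gL, r). gL \<in> S_set Cb \<and> psd_sqrt gL ** r = z}"
    then obtain q r where p: "p = (q, r)" and q: "q \<in> S_set Cb" "psd_sqrt q ** r = z" by auto
    have psd: "psd_mat q" using q by (simp add: S_set_def)
    have "(INF q\<in>S_set Cb. ?I q + step_rate 1 gauss_cgf (**) z q) \<le> ?I q + legendre (gauss_cgf q) z"
      unfolding st by (rule INF_lower) (rule q)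
    also have "\<dots> \<le> ?I q + ereal ((norm r)\<^sup>2 / 2)"
      by (intro add_left_mono legendre_gauss_le psd q)
    finally show "(INF q\<in>S_set Cb. ?I q + step_rate 1 gauss_cgf (**) z q) \<le> ?I (fst p) + ereal ((norm (snd p))\<^sup>2 / 2)"
      by (simp add: p)
  qed
qed

section \<open>Passing local bounds along the layers, and tightness of the output\<close>

lemma closed_S_set: "closed (S_set Cb :: (real^'a^'a::finite) set)"
proof -
  have "S_set Cb = {q::real^'a^'a. psd_mat q} \<inter> (\<lambda>q. q - Cb *\<^sub>R ones_mat) -` {q. psd_mat q}"
    by (auto simp: S_set_def)
  then show ?thesis
    by (simp only:) (intro closed_Int closed_psd closed_vimage continuous_intros)
qed

text \<open>Translates bounds for the empirical mean of a layer into bounds for its covariance; an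
  affine map with positive factor sends balls to balls.\<close>

lemma ldp_affine:
  fixes Y :: "nat \<Rightarrow> 'b \<Rightarrow> 'e::euclidean_space"
  assumes c: "c > 0" and G: "\<And>n w. G n w = a + c *\<^sub>R Y n w" and I: "\<And>g. I' g = I ((1 / c) *\<^sub>R (g - a))"
  shows "ldp_upper M Y v I UNIV \<Longrightarrow> ldp_upper M G v I' UNIV"
    and "ldp_lower M Y v I UNIV \<Longrightarrow> ldp_lower M G v I' UNIV"
proof -
  have ball: "G n w \<in> ball g (c * \<delta>) \<longleftrightarrow> Y n w \<in> ball ((1 / c) *\<^sub>R (g - a)) \<delta>" for n w g \<delta>
  proof -
    have "g - G n w = c *\<^sub>R ((1 / c) *\<^sub>R (g - a) - Y n w)"
      using c by (simp add: G scaleR_diff_right algebra_simps)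
    then have "norm (g - G n w) = c * norm ((1 / c) *\<^sub>R (g - a) - Y n w)" using c by simp
    then show ?thesis using c by (simp add: dist_norm)
  qed
  {
    assume up: "ldp_upper M Y v I UNIV"
    show "ldp_upper M G v I' UNIV"
      unfolding ldp_upper_def
    proof (intro ballI allI impI)
      fix g e assume "ereal e < I' g"
      then obtain \<delta> where "\<delta> > 0" "\<forall>\<^sub>F n in sequentially.
         \<P>(w in M n. Y n w \<in> ball ((1 / c) *\<^sub>R (g - a)) \<delta>) \<le> exp (- e * v n)"
        using up unfolding ldp_upper_def I by blast
      then show "\<exists>\<delta>>0. \<forall>\<^sub>F n in sequentially.
         \<P>(w in M n. G n w \<in> ball g \<delta>) \<le> exp (- e * v n)"
        using c by (intro exI[of _ "c * \<delta>"]) (simp only: ball, simp)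
    qed
  }
  {
    assume lo: "ldp_lower M Y v I UNIV"
    show "ldp_lower M G v I' UNIV"
      unfolding ldp_lower_def
    proof (intro ballI allI impI)
      fix g e and \<delta> :: real assume g: "I' g < ereal e" and d: "\<delta> > 0"
      then have "\<delta> / c > 0" using c by simp
      then have "\<forall>\<^sub>F n in sequentially. exp (- e * v n) \<le>
         \<P>(w in M n. Y n w \<in> ball ((1 / c) *\<^sub>R (g - a)) (\<delta> / c))"
        using lo g unfolding ldp_lower_def I by blast
      then show "\<forall>\<^sub>F n in sequentially. exp (- e * v n) \<le>
         \<P>(w in M n. G n w \<in> ball g \<delta>)"
        using ball[of _ _ g "\<delta> / c"] c by simp
    qed
  }
qed

lemma ldp_subset:
  "ldp_upper M X v I UNIV \<Longrightarrow> ldp_upper M X v I S" "ldp_lower M X v I UNIV \<Longrightarrow> ldp_lower M X v I S"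
  by (auto simp: ldp_upper_def ldp_lower_def)

lemma ldp_const:
  assumes X: "\<And>n w. X n w = g0" and M: "\<And>n. prob_space (M n)" and v: "\<And>n. v n \<ge> 0"
    and I: "\<And>g. I g = (if g = g0 then 0 else \<infinity>)"
  shows "ldp_upper M X v I UNIV" and "ldp_lower M X v I UNIV"
proof -
  have one: "measure (M n) (space (M n)) = 1" for n using M by (rule prob_space.prob_space)
  show "ldp_upper M X v I UNIV"
    unfolding ldp_upper_def
  proof (intro ballI allI impI)
    fix g c assume c: "ereal c < I g"
    show "\<exists>\<delta>>0. \<forall>\<^sub>F n in sequentially. \<P>(w in M n. X n w \<in> ball g \<delta>) \<le> exp (- c * v n)"
    proof (cases "g = g0")
      case True
      then have "c < 0" using c by (simp add: I)
      then have "c * v n \<le> 0" for n using v[of n] by (simp add: mult_nonpos_nonneg)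
      then show ?thesis using True by (intro exI[of _ 1]) (simp add: X one)
    next
      case False
      then show ?thesis by (intro exI[of _ "dist g g0"]) (simp add: X)
    qed
  qed
  show "ldp_lower M X v I UNIV"
    unfolding ldp_lower_def
  proof (intro ballI allI impI)
    fix g c and \<delta> :: real assume c: "I g < ereal c" and d: "\<delta> > 0"
    then have "g = g0" "c > 0" by (auto simp: I zero_ereal_def split: if_splits)
    then show "\<forall>\<^sub>F n in sequentially. exp (- c * v n) \<le> \<P>(w in M n. X n w \<in> ball g \<delta>)"
      using d v by (simp add: X one)
  qed
qed

text \<open>Chernoff bounds with the unit tilts of \<open>signed_basis\<close> suffice when their
  cumulants have a common bound \<open>U\<close>.\<close>

lemma mgf_exponential_tightness:
  fixes Y :: "nat \<Rightarrow> 'b \<Rightarrow> 'e::euclidean_space"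
  assumes link: "\<And>n. mgf_link (M n) (G n) (Y n) (v n) \<Lambda>" and v: "\<And>n. v n \<ge> 1"
    and U: "\<And>n w h. w \<in> space (M n) \<Longrightarrow> h \<in> signed_basis \<Longrightarrow> \<Lambda> (G n w) h \<le> U"
  shows "\<exists>R. \<forall>\<^sub>F n in sequentially. \<P>(w in M n. R < norm (Y n w)) \<le> exp (- c * v n)"
proof -
  let ?D = "real DIM('e)"
  \<comment> \<open>The summand ln (2 D) pays for the at most 2 D directions: v \<ge> 1 gives v ln
    (2 D) \<ge> ln (2 D).\<close>
  define r where "r = U + c + ln (2 * ?D)"
  have "\<P>(w in M n. ?D * r < norm (Y n w)) \<le> exp (- c * v n)" for n
  proof -
    interpret prob_space "M n" using link by (simp add: mgf_link_def)
    have Ym [measurable]: "Y n \<in> borel_measurable (M n)" using link by (simp add: mgf_link_def)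
    have sp: "{w \<in> space (M n). G n w \<in> UNIV} = space (M n)" by simp
    have eq: "(\<integral>\<^sup>+w. indicator (space (M n)) w * ennreal (exp (v n * (h \<bullet> Y n w))) \<partial>M n)
        = (\<integral>\<^sup>+w. indicator (space (M n)) w * ennreal (exp (v n * \<Lambda> (G n w) h)) \<partial>M n)" for h
      using mgf_link_event(2)[OF link[of n], of UNIV h] by simp
    have h: "prob {w \<in> space (M n). r \<le> h \<bullet> Y n w} \<le> exp (- v n * (r - U))" if "h \<in> signed_basis" for h
      using chernoff_on_event[OF sets.top Ym eq, of h U r] v[of n] U that by (simp add: prob_space)
    have "prob {w \<in> space (M n). ?D * r < norm (Y n w)}
        \<le> prob (\<Union>h\<in>signed_basis. {w \<in> space (M n). r \<le> h \<bullet> Y n w})"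
    proof (rule finite_measure_mono)
      show "{w \<in> space (M n). ?D * r < norm (Y n w)} \<subseteq> (\<Union>h\<in>signed_basis. {w \<in> space (M n). r \<le> h \<bullet> Y n w})"
      proof
        fix w assume w: "w \<in> {w \<in> space (M n). ?D * r < norm (Y n w)}"
        then obtain h where "h \<in> signed_basis" "\<not> h \<bullet> Y n w \<le> r"
          using norm_lt_signed_basis[of "Y n w" r] by force
        then show "w \<in> (\<Union>h\<in>signed_basis. {w \<in> space (M n). r \<le> h \<bullet> Y n w})" using w by force
      qed
      show "(\<Union>h\<in>signed_basis. {w \<in> space (M n). r \<le> h \<bullet> Y n w}) \<in> events"
        by (intro sets.finite_UN finite_signed_basis) measurable
    qed
    also have "\<dots> \<le> (\<Sum>h\<in>signed_basis. prob {w \<in> space (M n). r \<le> h \<bullet> Y n w})"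
      by (intro finite_measure_subadditive_finite finite_signed_basis) (auto, measurable)
    also have "\<dots> \<le> (\<Sum>h\<in>(signed_basis::'e set). exp (- v n * (r - U)))" by (intro sum_mono h)
    also have "\<dots> = real (card (signed_basis::'e set)) * exp (- v n * (r - U))" by simp
    also have "\<dots> \<le> (2 * ?D) * exp (- v n * (r - U))"
      using of_nat_mono[OF card_signed_basis[where 'e='e], where 'a=real] by (intro mult_right_mono) auto
    also have "\<dots> = exp (ln (2 * ?D)) * exp (- v n * (r - U))" by (subst exp_ln) auto
    also have "\<dots> = exp (ln (2 * ?D) - v n * (r - U))" by (simp only: exp_add[symmetric]) simp
    also have "\<dots> \<le> exp (- c * v n)"
    proof -
      have "ln (2 * ?D) \<ge> 0" using DIM_positive[where 'a='e] by (intro ln_ge_zero) linarith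
      then have "1 * ln (2 * ?D) \<le> v n * ln (2 * ?D)" using v[of n] by (intro mult_right_mono) auto
      then show ?thesis by (simp add: r_def algebra_simps)
    qed
    finally show ?thesis .
  qed
  then show ?thesis by (intro exI[of _ "?D * r"]) simp
qed

text \<open>Each \<open>n\<close> has its own probability space, as only the laws of the networks
  matter. Output coordinates are indexed by the finite type \<open>'h\<close>, and
  \<open>hidx\<close> matches them with the neuron numbers 1 to n_{L+1}.\<close>

theorem theorem2p1:
  fixes L n0 :: nat and Cb Cw :: real and \<sigma> :: "real \<Rightarrow> real"
    and nw :: "nat \<Rightarrow> nat \<Rightarrow> nat"
    and x :: "'a::finite \<Rightarrow> nat \<Rightarrow> real"
    and hidx :: "'h::finite \<Rightarrow> nat"
    and M :: "nat \<Rightarrow> 'b measure"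
    and b :: "nat \<Rightarrow> nat \<Rightarrow> nat \<Rightarrow> 'b \<Rightarrow> real"
    and W :: "nat \<Rightarrow> nat \<Rightarrow> nat \<Rightarrow> nat \<Rightarrow> 'b \<Rightarrow> real"
    and lhat :: nat and \<gamma> :: "nat \<Rightarrow> ereal"
  assumes L: "L \<ge> 1" and n0: "n0 \<ge> 1" and Cb: "Cb \<ge> 0" and Cw: "Cw > 0"
    and hidx: "bij_betw hidx UNIV {1..CARD('h)}"
    and nw0: "\<And>n. nw n 0 = n0"
    and nwout: "\<And>n. nw n (L + 1) = CARD('h)"
    and nwpos: "\<And>n l. l \<in> {1..L} \<Longrightarrow> nw n l \<ge> 1"
    and nwlim: "\<And>l. l \<in> {1..L} \<Longrightarrow> filterlim (\<lambda>n. nw n l) at_top sequentially"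
    and prob: "\<And>n. prob_space (M n)"
    and indep: "\<And>n. prob_space.indep_vars (M n) (\<lambda>_. borel)
        (\<lambda>k. case k of Inl (l, i) \<Rightarrow> b n l i | Inr (l, i, j) \<Rightarrow> W n l i j)
        (param_index (nw n) L)"
    and bgauss: "\<And>n l i. l \<in> {1..L+1} \<Longrightarrow> i \<in> {1..nw n l} \<Longrightarrow>
        centered_gaussian (M n) (b n l i) Cb"
    and Wgauss: "\<And>n l i j. l \<in> {1..L+1} \<Longrightarrow> i \<in> {1..nw n l} \<Longrightarrow> j \<in> {1..nw n (l - 1)} \<Longrightarrow>
        centered_gaussian (M n) (W n l i j) (Cw / real (nw n (l - 1)))"
    and \<sigma>cont: "continuous_on UNIV \<sigma>" and \<sigma>bdd: "bounded (range \<sigma>)"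
    and lhat: "lhat \<in> {1..L}"
    and \<gamma>ge: "\<And>l. l \<in> {1..L} \<Longrightarrow> \<gamma> l \<ge> 1"
    and \<gamma>lim: "\<And>l. l \<in> {1..L} \<Longrightarrow>
        (\<lambda>n. ereal (real (nw n l) / real (nw n lhat))) \<longlonglongrightarrow> \<gamma> l"
  shows "LDP M
     (\<lambda>n \<omega>. (\<chi> \<alpha> h. netZ (nw n) \<sigma> (\<lambda>l i. b n l i \<omega>) (\<lambda>l i j. W n l i j \<omega>) (L + 1) (x \<alpha>) (hidx h)
              / sqrt (real (nw n lhat))) :: real^'h^'a)
     (\<lambda>n. real (nw n lhat))
     (IZ \<sigma> Cb Cw L \<gamma> (g0_mat Cb Cw n0 x))
   \<and> good_rate_function (IZ \<sigma> Cb Cw L \<gamma> (g0_mat Cb Cw n0 x) :: real^'h^'a \<Rightarrow> ereal)"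
proof -
  obtain B0 where "\<forall>y\<in>range \<sigma>. norm y \<le> B0" using \<sigma>bdd unfolding bounded_iff by blast
  then have B0: "\<bar>\<sigma> t\<bar> \<le> B0" for t by simp
  let ?v = "\<lambda>n. real (nw n lhat)"
  let ?g0 = "g0_mat Cb Cw n0 x"
  interpret net: gauss_net "M n" "nw n" L Cb Cw B0 \<sigma> x "b n" "W n" for n
    unfolding gauss_net_def gauss_net_axioms_def
    using prob[of n] indep[of n] bgauss[where n=n] Wgauss[where n=n] nwpos[where n=n] Cb Cw \<sigma>cont B0
    by blast
  have v1: "?v n \<ge> 1" for n using nwpos[OF lhat, of n] by simp
  have vpos: "?v n > 0" for n using v1[of n] by linarith
  have vlim: "filterlim ?v at_top sequentially"
    by (rule filterlim_compose[OF filterlim_real_sequentially nwlim[OF lhat]])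
  define I where "I l = IG \<sigma> Cb Cw l \<gamma> ?g0" for l
  have I0: "0 \<le> I l g" if "l \<le> L" for l g
    unfolding I_def using that \<gamma>ge by (intro IG_nonneg) auto
  have g0S: "?g0 \<in> S_set Cb" using net.G_in_S[of 0 0 undefined] by (simp add: net.G_zero nw0)
  \<comment> \<open>One radius for all layers: the first summand bounds the deterministic layer 0,
    the other two bound every later covariance, whose features are bounded through \<sigma>.\<close>
  define R where "R = norm ?g0 + norm (Cb *\<^sub>R ones_mat :: real^'a^'a) + Cw * (CARD('a) * (CARD('a) * B0\<^sup>2))"
  have GR: "norm (net.G n l w) \<le> R" if l: "l \<le> L" for n l w
  proof (cases "l = 0")
    case True
    then show ?thesis using Cw by (simp add: net.G_zero nw0 R_def)
  next
    case False
    let ?C = "real CARD('a) * (real CARD('a) * B0\<^sup>2)"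
    have n1: "nw n l \<ge> 1" using False l by (intro nwpos) auto
    have "norm (net.Y n l w) \<le> (1 / real (nw n l)) * (\<Sum>i=1..nw n l. ?C)"
      unfolding net.Y_def norm_scaleR using n1
      by (intro mult_mono order_trans[OF norm_sum] sum_mono norm_feature_mat_le B0) auto
    also have "\<dots> = ?C" using n1 by simp
    finally have "Cw * norm (net.Y n l w) \<le> Cw * ?C" using Cw by simp
    moreover have "norm (Cw *\<^sub>R net.Y n l w) = Cw * norm (net.Y n l w)" using Cw by simp
    ultimately show ?thesis
      using norm_triangle_ineq[of "Cb *\<^sub>R ones_mat :: real^'a^'a" "Cw *\<^sub>R net.Y n l w"] norm_ge_zero[of ?g0]
      unfolding net.G_pos[OF False] R_def by linarith
  qed
  define C where "C = S_set Cb \<inter> cball (0 :: real^'a^'a) R"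
  have compC: "compact C" unfolding C_def by (intro closed_Int_compact closed_S_set compact_cball)
  have GC: "net.G n l w \<in> C" if "l \<le> L" for n l w
    using GR[OF that] net.G_in_S by (simp add: C_def)
  have CS: "C \<subseteq> S_set Cb" by (simp add: C_def)
  have Spsd: "S_set Cb \<subseteq> {q :: real^'a^'a. psd_mat q}" by (auto simp: S_set_def)
  obtain m K where m: "\<And>q::real^'a^'a. smooth_cgf (\<lambda>\<eta>. kappa \<sigma> \<eta> q) (m q) K" "\<And>q. m q 0 = ymat \<sigma> q"
    using kappa_smooth_cgf[OF \<sigma>cont B0] by blast
  \<comment> \<open>The bounds are carried at all centres, including those outside
    \<open>S_set Cb\<close>; the next step uses only the centres inside.\<close>
  have layers: "ldp_upper M (\<lambda>n. net.G n l) ?v (I l) UNIV \<and> ldp_lower M (\<lambda>n. net.G n l) ?v (I l) UNIV"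
    if "l \<le> L" for l
    using that
  proof (induction l)
    case 0
    have "I 0 g = (if g = ?g0 then 0 else \<infinity>)" for g by (simp add: I_def IG_zero)
    moreover have "net.G n 0 w = ?g0" for n w by (simp add: net.G_zero nw0)
    ultimately show ?case
      using prob by (intro conjI ldp_const[where ?g0.0="?g0"]) auto
  next
    case (Suc l)
    then have l: "l < L" "l \<le> L" and Sl: "Suc l \<in> {1..L}" by auto
    interpret mgf_step M "\<lambda>n. net.G n l" "\<lambda>n. net.Y n (Suc l)" "\<lambda>n. real (nw n (Suc l))" ?v
      "\<lambda>q \<eta>. kappa \<sigma> \<eta> q" m "\<lambda>_. K" "S_set Cb" "\<gamma> (Suc l)"
    proof
      show "mgf_link (M n) (net.G n l) (net.Y n (Suc l)) (real (nw n (Suc l))) (\<lambda>q \<eta>. kappa \<sigma> \<eta> q)" for n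
        by (rule net.hidden_mgf_link[OF l(1)])
      show "filterlim (\<lambda>n. real (nw n (Suc l))) at_top sequentially"
        by (rule filterlim_compose[OF filterlim_real_sequentially nwlim[OF Sl]])
      show "continuous_on (S_set Cb) (\<lambda>q. kappa \<sigma> \<eta> q)" for \<eta> :: "real^'a^'a"
        by (rule continuous_on_subset[OF continuous_on_kappa[OF \<sigma>cont B0] Spsd])
    qed (use m net.G_in_S vlim \<gamma>lim[OF Sl] \<gamma>ge[OF Sl] in auto)
    let ?I = "\<lambda>y. INF q\<in>S_set Cb. I l q + step_rate (\<gamma> (Suc l)) (\<lambda>q \<eta>. kappa \<sigma> \<eta> q) m y q"
    have up: "ldp_upper M (\<lambda>n. net.Y n (Suc l)) ?v ?I UNIV"
      by (rule compose_upper[where I="I l", OF ldp_subset(1) I0[OF l(2)] compC CS GC[OF l(2)]])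
        (use Suc.IH[OF l(2)] in blast)
    have lo: "ldp_lower M (\<lambda>n. net.Y n (Suc l)) ?v ?I UNIV"
      by (rule compose_lower[where I="I l", OF ldp_subset(2) I0[OF l(2)]]) (use Suc.IH[OF l(2)] in blast)
    have IS: "I (Suc l) g = ?I ((1 / Cw) *\<^sub>R (g - Cb *\<^sub>R ones_mat))" for g
      unfolding I_def using \<gamma>ge Suc.prems g0S by (subst IG_Suc) (auto simp: Jrate_eq[where m=m, OF Cw m(2)])
    have GY: "net.G n (Suc l) w = Cb *\<^sub>R ones_mat + Cw *\<^sub>R net.Y n (Suc l) w" for n w
      by (rule net.G_pos) simp
    show ?case
      by (intro conjI ldp_affine(1)[OF Cw GY IS up] ldp_affine(2)[OF Cw GY IS lo])
  qed
  let ?X = "\<lambda>n w. (\<chi> \<alpha> h. net.Z n (Suc L) \<alpha> (hidx h) w / sqrt (?v n)) :: real^'h^'a"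
  have hidx': "bij_betw hidx UNIV {1..nw n (Suc L)}" for n using hidx nwout[of n] by simp
  have link: "mgf_link (M n) (net.G n L) (?X n) (?v n) gauss_cgf" for n
    by (rule net.output_mgf_link[OF hidx' vpos])
  \<comment> \<open>The exponents of the output are already on the scale \<open>?v\<close>, whatever
    the width of layer \<open>L\<close>, hence the ratio 1.\<close>
  interpret out: mgf_step M "\<lambda>n. net.G n L" ?X ?v ?v gauss_cgf "(**)" norm "S_set Cb" 1
  proof
    show "smooth_cgf (gauss_cgf q :: real^'h^'a \<Rightarrow> real) ((**) q) (norm q)" if "q \<in> S_set Cb" for q :: "real^'a^'a"
      using that Spsd by (intro gauss_smooth_cgf) auto
    have "(\<lambda>n. ereal (?v n / ?v n)) = (\<lambda>_. 1)"
      using vpos by (auto simp: fun_eq_iff one_ereal_def less_imp_neq[symmetric])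
    then show "(\<lambda>n. ereal (?v n / ?v n)) \<longlonglongrightarrow> 1" by simp
  qed (use link vlim net.G_in_S continuous_on_gauss_cgf in auto)
  have IZ: "IZ \<sigma> Cb Cw L \<gamma> ?g0 = (\<lambda>z. INF q\<in>S_set Cb. I L q + step_rate 1 gauss_cgf (**) z q)"
    unfolding I_def by (intro ext IZ_eq \<gamma>ge)
  interpret res: local_ldp M ?X ?v "IZ \<sigma> Cb Cw L \<gamma> ?g0 :: real^'h^'a \<Rightarrow> ereal"
  proof
    show "ldp_upper M ?X ?v (IZ \<sigma> Cb Cw L \<gamma> ?g0) UNIV"
      unfolding IZ
      by (rule out.compose_upper[where I="I L", OF ldp_subset(1) I0[OF order_refl] compC CS GC[OF order_refl]])
        (use layers in blast)
    show "ldp_lower M ?X ?v (IZ \<sigma> Cb Cw L \<gamma> ?g0) UNIV"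
      unfolding IZ
      by (rule out.compose_lower[where I="I L", OF ldp_subset(2) I0[OF order_refl]]) (use layers in blast)
    show "0 \<le> IZ \<sigma> Cb Cw L \<gamma> ?g0 z" for z :: "real^'h^'a"
      unfolding IZ by (intro INF_greatest add_nonneg_nonneg I0 out.step_rate_nonneg) auto
    fix c
    \<comment> \<open>The output is unbounded, but its conditional covariance is not: a unit tilt
      has a cumulant of at most half the norm of that covariance.\<close>
    have "gauss_cgf (net.G n L w) h \<le> R" if "h \<in> signed_basis" for n w and h :: "real^'h^'a"
    proof -
      have "h \<bullet> (net.G n L w ** h) \<le> norm (net.G n L w)"
        using inner_matrix_mult_le[of h "net.G n L w"] norm_signed_basis[OF that] by simp
      then show ?thesis
        using GR[OF order_refl, of n w] norm_ge_zero[of "net.G n L w"] unfolding gauss_cgf_eq by linarith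
    qed
    then show "\<exists>R. \<forall>\<^sub>F n in sequentially. \<P>(w in M n. R < norm (?X n w)) \<le> exp (- c * ?v n)"
      by (intro mgf_exponential_tightness[where U=R, OF link v1]) auto
  qed (use prob vlim out.measY in auto)
  show ?thesis
    using res.LDP res.good by (simp add: net.Z_def)
qed

end
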